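(* Let $E=(E^0,E^1,r,s)$ be a finite directed graph with no sources (every vertex receives at least one edge). Suppose that $\{w(e):e\in E^1\}$ are non-zero complex numbers such that $\sum_{s(e)=v}|w(e)|^2=|s^{-1}(v)|$ for every $v\in E^0$; define $w_k:E^{[-k,\infty)}\to\mathbb C$ by $$w_k(c)=\prod_{j=-k}^{-1}w(c_j)|s^{-1}(s(c_j))|^{-1/2},$$ and define $m=\sum_{e\in E^1}w(e)\chi_{Z(e)}$. Then $m$ is a filter in the correspondence $M_L$ over $C(E^\infty)$. Let $(M_\infty,\iota^k)=\varinjlim(M_L^{\otimes k},T_k)$ be the direct limit of the system with $T_kn=m\otimes n$ (and $T_0a=m\cdot a$). For $c\in E^\infty$ let $\mu^c$ be the probability measure on $\pi_0^{-1}(c)\subset E^{(-\infty,\infty)}$ determined by the weights $w_k$, and let $X_\infty(E)$ be the Hilbert $C(E^\infty)$-module obtained by completing $C(E^{(-\infty,\infty)})$ in the inner product defined by the measures $\mu^c$. Let $h$ denote the backward shift homeomorphism on $E^{(-\infty,\infty)}$, and define $D:C(E^{(-\infty,\infty)})\to C(E^{(-\infty,\infty)})$ by $$(Dx)(c)=m(\pi_0(c))\,x(h(c)).$$ Then $D$ extends to a linear isomorphism of $X_\infty(E)$ onto itself, $(X_\infty(E),D,1)$ is a scaling function for $m$, and there is an isomorphism $Q$ of $M_\infty$ onto $X_\infty(E)$ such that $V_k:=Q(\iota^k(M_{L^k}))$ is a projective multi-resolution analysis for $X_\infty(E)$.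
   Context: Graph notation. $r,s:E^1\to E^0$ are the range and source maps. $E^\infty$ is the compact space of right-infinite paths $c=c_0c_1c_2\cdots$ ($c_i\in E^1$, $s(c_i)=r(c_{i+1})$), with the product topology; $r(c):=r(c_0)$; $Z(e)=\{c\in E^\infty:c_0=e\}$; $\sigma(c_0c_1c_2\cdots)=c_1c_2\cdots$ is the backward shift on $E^\infty$. $E^{[-k,\infty)}$ is the space of paths $c_{-k}\cdots c_{-1}c_0c_1\cdots$ and $E^{(-\infty,\infty)}$ the space of doubly infinite paths $\cdots c_{-1}c_0c_1\cdots$ (again $s(c_i)=r(c_{i+1})$); $\pi_k:E^{(-\infty,\infty)}\to E^{[-k,\infty)}$ is truncation $c\mapsto c_{-k}c_{-k+1}\cdots$ (so $\pi_0$ maps to $E^\infty=E^{[0,\infty)}$); $r^{(k)}:E^{[-k,\infty)}\to E^\infty$ is $c\mapsto c_0c_1\cdots$; $h(c)_i=c_{i+1}$. Empty products are $1$, so $w_0=1$. Modules. $A=C(E^\infty)$, $\alpha(f)=f\circ\sigma$, and $L$ is the transfer operator $L(f)(c)=\frac{1}{|s^{-1}(r(c))|}\sum_{s(e)=r(c)}f(ec)$, where $ec$ is the path $e c_0c_1\cdots$. $M_L$ is the correspondence over $A$ obtained by completing the vector space $C(E^\infty)$ with right action $n\cdot a=n\alpha(a)$, left action $a\cdot n=an$ and inner product $\langle n,n'\rangle=L(n^*n')$ (the underlying space is still $C(E^\infty)$). A filter in $M_L$ is an element $m$ with $\langle m,m\rangle=1$. $M_{L^k}$ is defined the same way from $\alpha^k,L^k$,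 and the internal tensor power $M_L^{\otimes k}$ ($M_L^{\otimes 0}=A$) is identified with $M_{L^k}$ via $n_1\otimes\cdots\otimes n_k\mapsto n_1\alpha(n_2)\cdots\alpha^{k-1}(n_k)$. $\varinjlim$ is the Hilbert-module direct limit: the completion of the quotient of $\bigsqcup_kM_L^{\otimes k}$ identifying $n$ with $T_kn$, with canonical inner-product preserving maps $\iota^k$. Measures. $\mu^c$ is the unique probability measure on $\pi_0^{-1}(c)$ with $\int(x\circ\pi_k)\,d\mu^c=\sum_{r^{(k)}(d)=c}x(d)|w_k(d)|^2$ for all $k\ge0$ and $x\in C(E^{[-k,\infty)})$. $X_\infty(E)$ is the completion of $C(E^{(-\infty,\infty)})$ with right action $(x\cdot f)(d)=x(d)f(\pi_0(d))$, $f\in C(E^\infty)$, and inner product $\langle x,y\rangle(c)=\int_{\pi_0^{-1}(c)}\overline{x(d)}y(d)\,d\mu^c(d)$. Scaling functions. For a Hilbert $A$-module $X$, $X_L$ denotes the Hilbert $A$-module with underlying vector space $X$, action $x\cdot_La=x\cdot\alpha(a)$ and inner product $L(\langle x,y\rangle)$; it is isomorphic to the internal tensor product $X\otimes_AM_L$ via $x\otimes a\mapsto x\cdot a$. $(X,D,\phi)$ is a scaling function for $m$ if $D$ is a Hilbert-module isomorphism of $X$ onto $X_L\cong X\otimes_AM_L$ (i.e. a linear bijection $D:X\to X$ with $D(x\cdot f)=(Dx)\cdot\alpha(f)$ and $L(\langle Dx,Dy\rangle)=\langle x,y\rangle$), $\phi\in X$ satisfies $\langle\phi,\phi\rangle=1$,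 and $D\phi=\phi\cdot m$ (corresponding to $\phi\otimes m$). Multi-resolution analyses. $\{V_k\}_{k\ge0}$ is a projective multi-resolution analysis for $X=X_\infty(E)$ if: (i) $V_0$ is a complemented submodule of $X$; (ii) $V_k=D^{-k}(V_0)$ for $k\ge0$; (iii) $V_k$ is a complemented submodule of $V_{k+1}$ for $k\ge 0$; (iv) $\bigcup_kV_k$ is dense in $X$. (A closed submodule $N$ of $X$ is complemented if $(p,n)\mapsto p+n$ is a Hilbert-module isomorphism of $N\oplus N^\perp$ onto $X$.)
   Formalization: The graph is additionally assumed to have no sinks (every vertex also emits an edge); otherwise |s^{-1}(r(c))| = 0 for some path c, so L and the probability measure on the fibre over c are undefined and m is not a filter. *)

theory Defs
  imports "HOL-Probability.Probability" "Graph_Theory.Digraph"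
begin

section \<open>Hilbert modules over \<open>C(X)\<close>\<close>

text \<open>Functions on a carrier are made canonical by requiring the value \<open>0\<close> off the carrier, so
  that equality in \<open>C(X)\<close> is equality in HOL.\<close>

definition C_of :: "'x topology \<Rightarrow> ('x \<Rightarrow> complex) set" where
  "C_of X = {f. continuous_map X euclidean f \<and> (\<forall>x. x \<notin> topspace X \<longrightarrow> f x = 0)}"

definition one_C :: "'x topology \<Rightarrow> 'x \<Rightarrow> complex" where
  "one_C X = indicator (topspace X)"

text \<open>A (pre-)Hilbert module over \<open>C(hbase M)\<close>: \<open>hact\<close> is the right action, \<open>hip\<close> the inner
  product, conjugate linear in the first variable.\<close>

record ('x, 'm) hmod =
  hbase :: "'x topology"
  hcarrier :: "'m set"
  hzero :: 'm
  hadd :: "'m \<Rightarrow> 'm \<Rightarrow> 'm"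
  hscale :: "complex \<Rightarrow> 'm \<Rightarrow> 'm"
  hact :: "'m \<Rightarrow> ('x \<Rightarrow> complex) \<Rightarrow> 'm"
  hip :: "'m \<Rightarrow> 'm \<Rightarrow> 'x \<Rightarrow> complex"

record ('x, 'm) corr = "('x, 'm) hmod" +
  lact :: "('x \<Rightarrow> complex) \<Rightarrow> 'm \<Rightarrow> 'm"

definition hminus :: "('x, 'm, 'z) hmod_scheme \<Rightarrow> 'm \<Rightarrow> 'm \<Rightarrow> 'm" where
  "hminus M x y = hadd M x (hscale M (-1) y)"

text \<open>The \<open>0\<close> is inserted only to give the right supremum when \<open>hbase M\<close> is empty.\<close>

definition hnorm :: "('x, 'm, 'z) hmod_scheme \<Rightarrow> 'm \<Rightarrow> real" where
  "hnorm M x = sqrt (Sup (insert 0 ((\<lambda>c. cmod (hip M x x c)) ` topspace (hbase M))))"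

definition hconverges :: "('x, 'm, 'z) hmod_scheme \<Rightarrow> (nat \<Rightarrow> 'm) \<Rightarrow> 'm \<Rightarrow> bool" where
  "hconverges M x l \<longleftrightarrow> (\<lambda>n. hnorm M (hminus M (x n) l)) \<longlonglongrightarrow> 0"

definition hcauchy :: "('x, 'm, 'z) hmod_scheme \<Rightarrow> (nat \<Rightarrow> 'm) set" where
  "hcauchy M = {x. (\<forall>n. x n \<in> hcarrier M) \<and>
     (\<forall>\<epsilon>>0. \<exists>N. \<forall>i\<ge>N. \<forall>j\<ge>N. hnorm M (hminus M (x i) (x j)) < \<epsilon>)}"

locale hilbert_module =
  fixes M :: "('x, 'm, 'z) hmod_scheme"
  assumes base: "compact_space (hbase M)" "Hausdorff_space (hbase M)"
    and zero_closed: "hzero M \<in> hcarrier M"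
    and add_closed: "\<lbrakk>x \<in> hcarrier M; y \<in> hcarrier M\<rbrakk> \<Longrightarrow> hadd M x y \<in> hcarrier M"
    and scale_closed: "x \<in> hcarrier M \<Longrightarrow> hscale M z x \<in> hcarrier M"
    and act_closed: "\<lbrakk>x \<in> hcarrier M; f \<in> C_of (hbase M)\<rbrakk> \<Longrightarrow> hact M x f \<in> hcarrier M"
    and add_assoc: "\<lbrakk>x \<in> hcarrier M; y \<in> hcarrier M; u \<in> hcarrier M\<rbrakk>
      \<Longrightarrow> hadd M (hadd M x y) u = hadd M x (hadd M y u)"
    and add_commute: "\<lbrakk>x \<in> hcarrier M; y \<in> hcarrier M\<rbrakk> \<Longrightarrow> hadd M x y = hadd M y x"
    and add_zero: "x \<in> hcarrier M \<Longrightarrow> hadd M x (hzero M) = x"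
    and minus_self: "x \<in> hcarrier M \<Longrightarrow> hminus M x x = hzero M"
    and scale_one: "x \<in> hcarrier M \<Longrightarrow> hscale M 1 x = x"
    and scale_scale: "x \<in> hcarrier M \<Longrightarrow> hscale M z (hscale M z' x) = hscale M (z * z') x"
    and scale_add: "\<lbrakk>x \<in> hcarrier M; y \<in> hcarrier M\<rbrakk>
      \<Longrightarrow> hscale M z (hadd M x y) = hadd M (hscale M z x) (hscale M z y)"
    and add_scale: "x \<in> hcarrier M
      \<Longrightarrow> hscale M (z + z') x = hadd M (hscale M z x) (hscale M z' x)"
    and act_one: "x \<in> hcarrier M \<Longrightarrow> hact M x (one_C (hbase M)) = x"
    and act_act: "\<lbrakk>x \<in> hcarrier M; f \<in> C_of (hbase M); g \<in> C_of (hbase M)\<rbrakk>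
      \<Longrightarrow> hact M (hact M x f) g = hact M x (\<lambda>c. f c * g c)"
    and act_add: "\<lbrakk>x \<in> hcarrier M; f \<in> C_of (hbase M); g \<in> C_of (hbase M)\<rbrakk>
      \<Longrightarrow> hact M x (\<lambda>c. f c + g c) = hadd M (hact M x f) (hact M x g)"
    and add_act: "\<lbrakk>x \<in> hcarrier M; y \<in> hcarrier M; f \<in> C_of (hbase M)\<rbrakk>
      \<Longrightarrow> hact M (hadd M x y) f = hadd M (hact M x f) (hact M y f)"
    and scale_act: "\<lbrakk>x \<in> hcarrier M; f \<in> C_of (hbase M)\<rbrakk>
      \<Longrightarrow> hact M (hscale M z x) f = hscale M z (hact M x f)"
    and act_scale: "\<lbrakk>x \<in> hcarrier M; f \<in> C_of (hbase M)\<rbrakk>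
      \<Longrightarrow> hact M x (\<lambda>c. z * f c) = hscale M z (hact M x f)"
    and ip_closed: "\<lbrakk>x \<in> hcarrier M; y \<in> hcarrier M\<rbrakk> \<Longrightarrow> hip M x y \<in> C_of (hbase M)"
    and ip_add: "\<lbrakk>x \<in> hcarrier M; y \<in> hcarrier M; u \<in> hcarrier M\<rbrakk>
      \<Longrightarrow> hip M x (hadd M y u) = (\<lambda>c. hip M x y c + hip M x u c)"
    and ip_scale: "\<lbrakk>x \<in> hcarrier M; y \<in> hcarrier M\<rbrakk>
      \<Longrightarrow> hip M x (hscale M z y) = (\<lambda>c. z * hip M x y c)"
    and ip_act: "\<lbrakk>x \<in> hcarrier M; y \<in> hcarrier M; f \<in> C_of (hbase M)\<rbrakk>
      \<Longrightarrow> hip M x (hact M y f) = (\<lambda>c. hip M x y c * f c)"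
    and ip_cnj: "\<lbrakk>x \<in> hcarrier M; y \<in> hcarrier M\<rbrakk> \<Longrightarrow> hip M y x = (\<lambda>c. cnj (hip M x y c))"
    and ip_nonneg: "x \<in> hcarrier M \<Longrightarrow> hip M x x c \<in> \<real>\<^sub>\<ge>\<^sub>0"
    and ip_definite: "\<lbrakk>x \<in> hcarrier M; hip M x x = (\<lambda>_. 0)\<rbrakk> \<Longrightarrow> x = hzero M"
    and complete: "s \<in> hcauchy M \<Longrightarrow> \<exists>l\<in>hcarrier M. hconverges M s l"

text \<open>The left action is a \<open>*\<close>-homomorphism of \<open>C(X)\<close> into the adjointable operators.\<close>

locale correspondence = hilbert_module M for M :: "('x, 'm, 'z) corr_scheme" +
  assumes lact_closed: "\<lbrakk>a \<in> C_of (hbase M); x \<in> hcarrier M\<rbrakk> \<Longrightarrow> lact M a x \<in> hcarrier M"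
    and lact_add: "\<lbrakk>a \<in> C_of (hbase M); b \<in> C_of (hbase M); x \<in> hcarrier M\<rbrakk>
      \<Longrightarrow> lact M (\<lambda>c. a c + b c) x = hadd M (lact M a x) (lact M b x)"
    and lact_scale: "\<lbrakk>a \<in> C_of (hbase M); x \<in> hcarrier M\<rbrakk>
      \<Longrightarrow> lact M (\<lambda>c. z * a c) x = hscale M z (lact M a x)"
    and lact_mult: "\<lbrakk>a \<in> C_of (hbase M); b \<in> C_of (hbase M); x \<in> hcarrier M\<rbrakk>
      \<Longrightarrow> lact M (\<lambda>c. a c * b c) x = lact M a (lact M b x)"
    and lact_adjoint: "\<lbrakk>a \<in> C_of (hbase M); x \<in> hcarrier M; y \<in> hcarrier M\<rbrakk>
      \<Longrightarrow> hip M (lact M a x) y = hip M x (lact M (\<lambda>c. cnj (a c)) y)"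

definition is_filter_elt :: "('x, 'm, 'z) corr_scheme \<Rightarrow> 'm \<Rightarrow> bool" where
  "is_filter_elt M m \<longleftrightarrow>
     correspondence M \<and> m \<in> hcarrier M \<and> hip M m m = one_C (hbase M)"

definition linear_iso ::
  "('x, 'm, 'z) hmod_scheme \<Rightarrow> ('x, 'n, 'y) hmod_scheme \<Rightarrow> ('m \<Rightarrow> 'n) \<Rightarrow> bool" where
  "linear_iso M N f \<longleftrightarrow> bij_betw f (hcarrier M) (hcarrier N) \<and>
     (\<forall>x\<in>hcarrier M. \<forall>y\<in>hcarrier M. f (hadd M x y) = hadd N (f x) (f y)) \<and>
     (\<forall>z. \<forall>x\<in>hcarrier M. f (hscale M z x) = hscale N z (f x))"

definition hilbert_iso ::
  "('x, 'm, 'z) hmod_scheme \<Rightarrow> ('x, 'n, 'y) hmod_scheme \<Rightarrow> ('m \<Rightarrow> 'n) \<Rightarrow> bool" where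
  "hilbert_iso M N f \<longleftrightarrow> hbase M = hbase N \<and> linear_iso M N f \<and>
     (\<forall>x\<in>hcarrier M. \<forall>a\<in>C_of (hbase M). f (hact M x a) = hact N (f x) a) \<and>
     (\<forall>x\<in>hcarrier M. \<forall>y\<in>hcarrier M. hip N (f x) (f y) = hip M x y)"

definition hsubmod :: "('x, 'm, 'z) hmod_scheme \<Rightarrow> 'm set \<Rightarrow> ('x, 'm, 'z) hmod_scheme" where
  "hsubmod M N = M\<lparr>hcarrier := N\<rparr>"

definition closed_submodule :: "('x, 'm, 'z) hmod_scheme \<Rightarrow> 'm set \<Rightarrow> bool" where
  "closed_submodule M N \<longleftrightarrow> N \<subseteq> hcarrier M \<and> hzero M \<in> N \<and>
     (\<forall>x\<in>N. \<forall>y\<in>N. hadd M x y \<in> N) \<and>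
     (\<forall>z. \<forall>x\<in>N. hscale M z x \<in> N) \<and>
     (\<forall>x\<in>N. \<forall>a\<in>C_of (hbase M). hact M x a \<in> N) \<and>
     (\<forall>x. \<forall>l\<in>hcarrier M. (\<forall>n. x n \<in> N) \<and> hconverges M x l \<longrightarrow> l \<in> N)"

definition orth_compl :: "('x, 'm, 'z) hmod_scheme \<Rightarrow> 'm set \<Rightarrow> 'm set" where
  "orth_compl M N = {x \<in> hcarrier M. \<forall>y\<in>N. hip M x y = (\<lambda>_. 0)}"

definition hsum ::
  "('x, 'm, 'z) hmod_scheme \<Rightarrow> ('x, 'n, 'y) hmod_scheme \<Rightarrow> ('x, 'm \<times> 'n) hmod" where
  "hsum M N = \<lparr>hbase = hbase M, hcarrier = hcarrier M \<times> hcarrier N, hzero = (hzero M, hzero N),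
     hadd = (\<lambda>(x, x') (y, y'). (hadd M x y, hadd N x' y')),
     hscale = (\<lambda>z (x, x'). (hscale M z x, hscale N z x')),
     hact = (\<lambda>(x, x') a. (hact M x a, hact N x' a)),
     hip = (\<lambda>(x, x') (y, y') c. hip M x y c + hip N x' y' c)\<rparr>"

definition complemented :: "('x, 'm, 'z) hmod_scheme \<Rightarrow> 'm set \<Rightarrow> bool" where
  "complemented M N \<longleftrightarrow> closed_submodule M N \<and>
     hilbert_iso (hsum (hsubmod M N) (hsubmod M (orth_compl M N))) M (\<lambda>(p, n). hadd M p n)"

definition dense_in :: "('x, 'm, 'z) hmod_scheme \<Rightarrow> 'm set \<Rightarrow> bool" where
  "dense_in M S \<longleftrightarrow> S \<subseteq> hcarrier M \<and>
     (\<forall>x\<in>hcarrier M. \<forall>\<epsilon>>0. \<exists>y\<in>S. hnorm M (hminus M x y) < \<epsilon>)"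

text \<open>\<open>D\<^sup>-\<^sup>k(V\<^sub>0)\<close> is written as a preimage.\<close>

definition projective_mra ::
  "('x, 'm, 'z) hmod_scheme \<Rightarrow> ('m \<Rightarrow> 'm) \<Rightarrow> (nat \<Rightarrow> 'm set) \<Rightarrow> bool" where
  "projective_mra M D V \<longleftrightarrow>
     complemented M (V 0) \<and>
     (\<forall>k. V k = {x \<in> hcarrier M. (D ^^ k) x \<in> V 0}) \<and>
     (\<forall>k. complemented (hsubmod M (V (Suc k))) (V k)) \<and>
     dense_in M (\<Union>k. V k)"


section \<open>Completions and direct limits\<close>

text \<open>The completion consists of Cauchy sequences modulo null sequences; it also divides out
  vectors of length zero. Operations are computed on arbitrary representatives.\<close>

definition rep :: "'a set \<Rightarrow> 'a" where
  "rep q = (SOME x. x \<in> q)"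

definition null_rel :: "('x, 'm, 'z) hmod_scheme \<Rightarrow> ((nat \<Rightarrow> 'm) \<times> (nat \<Rightarrow> 'm)) set" where
  "null_rel M = {(x, y). x \<in> hcauchy M \<and> y \<in> hcauchy M \<and>
     (\<lambda>n. hnorm M (hminus M (x n) (y n))) \<longlonglongrightarrow> 0}"

definition completion ::
  "('x, 'm, 'z) hmod_scheme \<Rightarrow> ('x, (nat \<Rightarrow> 'm) set) hmod" where
  "completion M = \<lparr>hbase = hbase M, hcarrier = hcauchy M // null_rel M,
     hzero = null_rel M `` {\<lambda>_. hzero M},
     hadd = (\<lambda>p q. null_rel M `` {\<lambda>n. hadd M (rep p n) (rep q n)}),
     hscale = (\<lambda>z p. null_rel M `` {\<lambda>n. hscale M z (rep p n)}),
     hact = (\<lambda>p a. null_rel M `` {\<lambda>n. hact M (rep p n) a}),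
     hip = (\<lambda>p q c. if c \<in> topspace (hbase M) then lim (\<lambda>n. hip M (rep p n) (rep q n) c) else 0)\<rparr>"

definition to_completion :: "('x, 'm, 'z) hmod_scheme \<Rightarrow> 'm \<Rightarrow> (nat \<Rightarrow> 'm) set" where
  "to_completion M x = null_rel M `` {\<lambda>_. x}"

text \<open>A direct system \<open>T k : M k \<rightarrow> M (k + 1)\<close>. The disjoint union of the \<open>M k\<close> is a
  \<open>Sigma\<close>, and \<open>limit_rel\<close> is the equivalence relation generated by identifying \<open>n\<close> with \<open>T k n\<close>.\<close>

definition limit_union :: "(nat \<Rightarrow> ('x, 'm, 'z) hmod_scheme) \<Rightarrow> (nat \<times> 'm) set" where
  "limit_union M = Sigma UNIV (\<lambda>k. hcarrier (M k))"

definition limit_rel ::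
  "(nat \<Rightarrow> ('x, 'm, 'z) hmod_scheme) \<Rightarrow> (nat \<Rightarrow> 'm \<Rightarrow> 'm) \<Rightarrow> ((nat \<times> 'm) \<times> (nat \<times> 'm)) set" where
  "limit_rel M T = (let R = {((k, n), (Suc k, T k n)) | k n. n \<in> hcarrier (M k)}
     in (R \<union> R\<inverse>)\<^sup>* \<inter> (limit_union M \<times> limit_union M))"

text \<open>\<open>push T k j = T (k + j - 1) \<circ> \<dots> \<circ> T k\<close>\<close>

primrec push :: "(nat \<Rightarrow> 'm \<Rightarrow> 'm) \<Rightarrow> nat \<Rightarrow> nat \<Rightarrow> 'm \<Rightarrow> 'm" where
  "push T k 0 n = n"
| "push T k (Suc j) n = T (k + j) (push T k j n)"

definition alg_limit ::
  "(nat \<Rightarrow> ('x, 'm, 'z) hmod_scheme) \<Rightarrow> (nat \<Rightarrow> 'm \<Rightarrow> 'm) \<Rightarrow> ('x, (nat \<times> 'm) set) hmod" where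
  "alg_limit M T = \<lparr>hbase = hbase (M 0), hcarrier = limit_union M // limit_rel M T,
     hzero = limit_rel M T `` {(0, hzero (M 0))},
     hadd = (\<lambda>p q. case rep p of (k, x) \<Rightarrow> case rep q of (l, y) \<Rightarrow>
       let i = max k l in
       limit_rel M T `` {(i, hadd (M i) (push T k (i - k) x) (push T l (i - l) y))}),
     hscale = (\<lambda>z p. case rep p of (k, x) \<Rightarrow> limit_rel M T `` {(k, hscale (M k) z x)}),
     hact = (\<lambda>p a. case rep p of (k, x) \<Rightarrow> limit_rel M T `` {(k, hact (M k) x a)}),
     hip = (\<lambda>p q. case rep p of (k, x) \<Rightarrow> case rep q of (l, y) \<Rightarrow>
       let i = max k l in hip (M i) (push T k (i - k) x) (push T l (i - l) y))\<rparr>"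

definition direct_limit ::
  "(nat \<Rightarrow> ('x, 'm, 'z) hmod_scheme) \<Rightarrow> (nat \<Rightarrow> 'm \<Rightarrow> 'm) \<Rightarrow> ('x, (nat \<Rightarrow> (nat \<times> 'm) set) set) hmod"
  where
  "direct_limit M T = completion (alg_limit M T)"

definition limit_map ::
  "(nat \<Rightarrow> ('x, 'm, 'z) hmod_scheme) \<Rightarrow> (nat \<Rightarrow> 'm \<Rightarrow> 'm) \<Rightarrow> nat \<Rightarrow> 'm \<Rightarrow> (nat \<Rightarrow> (nat \<times> 'm) set) set"
  where
  "limit_map M T k n = to_completion (alg_limit M T) (limit_rel M T `` {(k, n)})"


section \<open>Path spaces\<close>

text \<open>The range map \<open>r\<close> is \<open>head G\<close> and the source map \<open>s\<close> is \<open>tail G\<close>, so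
  \<open>s\<^sup>-\<^sup>1(v) = out_arcs G v\<close>. The spaces \<open>E\<^sup>\<infinity>\<close>, \<open>E\<^sup>[\<^sup>-\<^sup>k\<^sup>,\<^sup>\<infinity>\<^sup>)\<close> and
  \<open>E\<^sup>(\<^sup>-\<^sup>\<infinity>\<^sup>,\<^sup>\<infinity>\<^sup>)\<close> are \<open>path_space G I\<close> for \<open>I = {0..}\<close>, \<open>{- int k..}\<close> and
  \<open>UNIV\<close>; points are \<open>undefined\<close> off \<open>I\<close>, as in \<open>product_topology\<close>, and so every truncation is a
  \<open>restrict\<close>.\<close>

definition path_space :: "('v, 'e) pre_digraph \<Rightarrow> int set \<Rightarrow> (int \<Rightarrow> 'e) topology" where
  "path_space G I = subtopology (product_topology (\<lambda>_. discrete_topology (arcs G)) I)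
     {c. \<forall>i. i \<in> I \<and> i + 1 \<in> I \<longrightarrow> tail G (c i) = head G (c (i + 1))}"

abbreviation E_inf :: "('v, 'e) pre_digraph \<Rightarrow> (int \<Rightarrow> 'e) topology" where
  "E_inf G \<equiv> path_space G {0..}"

abbreviation E_from :: "('v, 'e) pre_digraph \<Rightarrow> nat \<Rightarrow> (int \<Rightarrow> 'e) topology" where
  "E_from G k \<equiv> path_space G {- int k..}"

abbreviation E_two :: "('v, 'e) pre_digraph \<Rightarrow> (int \<Rightarrow> 'e) topology" where
  "E_two G \<equiv> path_space G UNIV"

definition trunc :: "nat \<Rightarrow> (int \<Rightarrow> 'e) \<Rightarrow> int \<Rightarrow> 'e" where
  "trunc k d = restrict d {- int k..}"

definition drop_neg :: "(int \<Rightarrow> 'e) \<Rightarrow> int \<Rightarrow> 'e" where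
  "drop_neg d = restrict d {0..}"

definition path_shift :: "(int \<Rightarrow> 'e) \<Rightarrow> int \<Rightarrow> 'e" where
  "path_shift c = restrict (\<lambda>i. c (i + 1)) {0..}"

definition path_cons :: "'e \<Rightarrow> (int \<Rightarrow> 'e) \<Rightarrow> int \<Rightarrow> 'e" where
  "path_cons e c = restrict (\<lambda>i. if i = 0 then e else c (i - 1)) {0..}"

definition two_shift :: "(int \<Rightarrow> 'e) \<Rightarrow> int \<Rightarrow> 'e" where
  "two_shift c = (\<lambda>i. c (i + 1))"

definition path_range :: "('v, 'e) pre_digraph \<Rightarrow> (int \<Rightarrow> 'e) \<Rightarrow> 'v" where
  "path_range G c = head G (c 0)"

definition cyl :: "('v, 'e) pre_digraph \<Rightarrow> 'e \<Rightarrow> (int \<Rightarrow> 'e) set" where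
  "cyl G e = {c \<in> topspace (E_inf G). c 0 = e}"


section \<open>The correspondences \<open>M\<^sub>L\<^sup>k\<close> and scaling functions\<close>

definition shift_endo ::
  "('v, 'e) pre_digraph \<Rightarrow> ((int \<Rightarrow> 'e) \<Rightarrow> complex) \<Rightarrow> (int \<Rightarrow> 'e) \<Rightarrow> complex" where
  "shift_endo G f = (\<lambda>c. if c \<in> topspace (E_inf G) then f (path_shift c) else 0)"

text \<open>The division is meaningful only if every vertex emits an edge.\<close>

definition transfer ::
  "('v, 'e) pre_digraph \<Rightarrow> ((int \<Rightarrow> 'e) \<Rightarrow> complex) \<Rightarrow> (int \<Rightarrow> 'e) \<Rightarrow> complex" where
  "transfer G f = (\<lambda>c. if c \<in> topspace (E_inf G)
     then 1 / of_nat (card (out_arcs G (path_range G c))) *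
       (\<Sum>e\<in>out_arcs G (path_range G c). f (path_cons e c))
     else 0)"

text \<open>\<open>M_pow G k\<close> is the correspondence of \<open>(\<alpha>\<^sup>k, L\<^sup>k)\<close>; it needs no completion. It stands for
  the \<open>k\<close>-th internal tensor power of \<open>M\<^sub>L = M_pow G 1\<close>, via
  \<open>n\<^sub>1 \<otimes> \<dots> \<otimes> n\<^sub>k \<mapsto> n\<^sub>1 \<alpha>(n\<^sub>2) \<dots> \<alpha>\<^sup>k\<^sup>-\<^sup>1(n\<^sub>k)\<close>.\<close>

definition M_pow ::
  "('v, 'e) pre_digraph \<Rightarrow> nat \<Rightarrow> (int \<Rightarrow> 'e, (int \<Rightarrow> 'e) \<Rightarrow> complex) corr" where
  "M_pow G k = \<lparr>hbase = E_inf G, hcarrier = C_of (E_inf G), hzero = (\<lambda>_. 0),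
     hadd = (\<lambda>n n' c. n c + n' c),
     hscale = (\<lambda>z n c. z * n c),
     hact = (\<lambda>n a c. n c * (shift_endo G ^^ k) a c),
     hip = (\<lambda>n n'. (transfer G ^^ k) (\<lambda>c. cnj (n c) * n' c)),
     lact = (\<lambda>a n c. a c * n c)\<rparr>"

text \<open>Under the same identification, \<open>tensor G j\<close> is the tensor product of an element of
  \<open>M_pow G j\<close> with an element of \<open>M_pow G k\<close>, as an element of \<open>M_pow G (j + k)\<close>.\<close>

definition tensor ::
  "('v, 'e) pre_digraph \<Rightarrow> nat \<Rightarrow> ((int \<Rightarrow> 'e) \<Rightarrow> complex) \<Rightarrow> ((int \<Rightarrow> 'e) \<Rightarrow> complex)
    \<Rightarrow> (int \<Rightarrow> 'e) \<Rightarrow> complex" where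
  "tensor G j n n' = (\<lambda>c. n c * (shift_endo G ^^ j) n' c)"

definition filter_tensor ::
  "('v, 'e) pre_digraph \<Rightarrow> ((int \<Rightarrow> 'e) \<Rightarrow> complex) \<Rightarrow> nat \<Rightarrow> ((int \<Rightarrow> 'e) \<Rightarrow> complex)
    \<Rightarrow> (int \<Rightarrow> 'e) \<Rightarrow> complex" where
  "filter_tensor G m k n = (if k = 0 then hact (M_pow G 1) m n else tensor G 1 m n)"

definition M_inf ::
  "('v, 'e) pre_digraph \<Rightarrow> ((int \<Rightarrow> 'e) \<Rightarrow> complex) \<Rightarrow>
   (int \<Rightarrow> 'e, (nat \<Rightarrow> (nat \<times> ((int \<Rightarrow> 'e) \<Rightarrow> complex)) set) set) hmod" where
  "M_inf G m = direct_limit (M_pow G) (filter_tensor G m)"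

definition iota ::
  "('v, 'e) pre_digraph \<Rightarrow> ((int \<Rightarrow> 'e) \<Rightarrow> complex) \<Rightarrow> nat \<Rightarrow> ((int \<Rightarrow> 'e) \<Rightarrow> complex) \<Rightarrow>
   (nat \<Rightarrow> (nat \<times> ((int \<Rightarrow> 'e) \<Rightarrow> complex)) set) set" where
  "iota G m = limit_map (M_pow G) (filter_tensor G m)"

definition twist_L :: "('v, 'e) pre_digraph \<Rightarrow> (int \<Rightarrow> 'e, 'm, 'z) hmod_scheme \<Rightarrow>
    (int \<Rightarrow> 'e, 'm, 'z) hmod_scheme" where
  "twist_L G X = X\<lparr>hact := (\<lambda>x a. hact X x (shift_endo G a)),
     hip := (\<lambda>x y. transfer G (hip X x y))\<rparr>"

definition scaling_function ::
  "('v, 'e) pre_digraph \<Rightarrow> ((int \<Rightarrow> 'e) \<Rightarrow> complex) \<Rightarrow> (int \<Rightarrow> 'e, 'm, 'z) hmod_scheme \<Rightarrow>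
   ('m \<Rightarrow> 'm) \<Rightarrow> 'm \<Rightarrow> bool" where
  "scaling_function G m X D \<phi> \<longleftrightarrow>
     hilbert_module X \<and> hbase X = E_inf G \<and>
     hilbert_iso X (twist_L G X) D \<and>
     \<phi> \<in> hcarrier X \<and> hip X \<phi> \<phi> = one_C (E_inf G) \<and> D \<phi> = hact X \<phi> m"


section \<open>The module \<open>X\<^sub>\<infinity>(E)\<close>\<close>

definition filter_of :: "('v, 'e) pre_digraph \<Rightarrow> ('e \<Rightarrow> complex) \<Rightarrow> (int \<Rightarrow> 'e) \<Rightarrow> complex" where
  "filter_of G w = (\<lambda>c. \<Sum>e\<in>arcs G. w e * indicator (cyl G e) c)"

definition path_weight ::
  "('v, 'e) pre_digraph \<Rightarrow> ('e \<Rightarrow> complex) \<Rightarrow> nat \<Rightarrow> (int \<Rightarrow> 'e) \<Rightarrow> complex" where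
  "path_weight G w k c = (\<Prod>j\<in>{- int k..-1}.
     w (c j) * of_real (real (card (out_arcs G (tail G (c j)))) powr (-1/2)))"

definition fibre :: "('v, 'e) pre_digraph \<Rightarrow> (int \<Rightarrow> 'e) \<Rightarrow> (int \<Rightarrow> 'e) set" where
  "fibre G c = {d \<in> topspace (E_two G). trunc 0 d = c}"

definition fibre_measure ::
  "('v, 'e) pre_digraph \<Rightarrow> ('e \<Rightarrow> complex) \<Rightarrow> (int \<Rightarrow> 'e) \<Rightarrow> (int \<Rightarrow> 'e) measure" where
  "fibre_measure G w c = (THE \<mu>. prob_space \<mu> \<and> space \<mu> = fibre G c \<and>
     sets \<mu> = sigma_sets (fibre G c) {U. openin (subtopology (E_two G) (fibre G c)) U} \<and>
     (\<forall>k. \<forall>x\<in>C_of (E_from G k). (LINT d|\<mu>. x (trunc k d)) =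
       (\<Sum>d | d \<in> topspace (E_from G k) \<and> drop_neg d = c.
          x d * of_real ((cmod (path_weight G w k d))\<^sup>2))))"

definition X_pre :: "('v, 'e) pre_digraph \<Rightarrow> ('e \<Rightarrow> complex) \<Rightarrow>
    (int \<Rightarrow> 'e, (int \<Rightarrow> 'e) \<Rightarrow> complex) hmod" where
  "X_pre G w = \<lparr>hbase = E_inf G, hcarrier = C_of (E_two G), hzero = (\<lambda>_. 0),
     hadd = (\<lambda>x y d. x d + y d),
     hscale = (\<lambda>z x d. z * x d),
     hact = (\<lambda>x f d. x d * f (trunc 0 d)),
     hip = (\<lambda>x y c. if c \<in> topspace (E_inf G)
       then LINT d|fibre_measure G w c. cnj (x d) * y d else 0)\<rparr>"

definition X_inf :: "('v, 'e) pre_digraph \<Rightarrow> ('e \<Rightarrow> complex) \<Rightarrow>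
    (int \<Rightarrow> 'e, (nat \<Rightarrow> (int \<Rightarrow> 'e) \<Rightarrow> complex) set) hmod" where
  "X_inf G w = completion (X_pre G w)"

definition dilation_pre :: "('v, 'e) pre_digraph \<Rightarrow> ('e \<Rightarrow> complex) \<Rightarrow>
    ((int \<Rightarrow> 'e) \<Rightarrow> complex) \<Rightarrow> (int \<Rightarrow> 'e) \<Rightarrow> complex" where
  "dilation_pre G w x = (\<lambda>c. filter_of G w (trunc 0 c) * x (two_shift c))"

end

theory Submission
  imports Defs
begin

text \<open>The fibre measure \<open>\<mu>\<^sup>c\<close> is the law of a Markov chain that prolongs \<open>c\<close> into the past. Its
  Markov property is the identity \<open>\<Phi>(x) = L(\<Phi>(|m|\<^sup>2 \<cdot> (x \<circ> h)))\<close> for the integration \<open>\<Phi>\<close> over the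
  fibres, so that \<open>D\<close> preserves inner products when \<open>X\<^sub>\<infinity>(E)\<close> is twisted by \<open>L\<close>; it is
  onto because the weights do not vanish. The vectors \<open>D\<^sup>-\<^sup>k(\<phi> \<cdot> n)\<close>, for \<open>n\<close> in \<open>C(E\<^sup>\<infinity>)\<close>, are
  the functions that depend only on the coordinates from \<open>-k\<close> on. They have the inner products of
  \<open>M\<^sub>L\<^sup>k\<close>, satisfy \<open>D\<^sup>-\<^sup>k\<^sup>-\<^sup>1(\<phi> \<cdot> m\<alpha>(n)) = D\<^sup>-\<^sup>k(\<phi> \<cdot> n)\<close>, and by uniform continuity they are dense, whence
  the isomorphism of the direct limit with \<open>X\<^sub>\<infinity>(E)\<close>.\<close>


section \<open>Pre-Hilbert modules and their completions\<close>

text \<open>Positivity alone gives Cauchy-Schwarz and a seminorm, and passing to Cauchy sequences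
  modulo null sequences supplies definiteness; hence the detour through pre-Hilbert modules. Two
  difficulties shape the rest. The algebraic direct limit computes on arbitrarily chosen
  representatives, which makes its module laws awkward. They are never checked: the limit is
  compared with \<open>X_pre\<close> through an inner-product preserving map, and
  \<open>dense_isometry\<close> asks of its domain, apart from compatibility with the map, only
  closure under the operations. Next, D is isometric for L(<x,y>), so its extension lands in the
  completion for another norm. Since c is among the at most |E^1| paths averaged at \<sigma>(c), the
  two norms differ by a factor of at most sqrt |E^1|, and both completions have the same underlying
  set. Finally, one sequence of choices drives the chain from all starting paths c at once. Fibre
  integrals become integrals over a probability space independent of c, which gives their continuity
  in c; and one frozen sequence of choices provides the continuous section of \<pi>_0 used for
  density.\<close>

lemma C_ofI:
  "continuous_map X euclidean f \<Longrightarrow> (\<And>x. x \<notin> topspace X \<Longrightarrow> f x = 0) \<Longrightarrow> f \<in> C_of X"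
  by (simp add: C_of_def)

lemma C_of_continuous: "f \<in> C_of X \<Longrightarrow> continuous_map X euclidean f"
  and C_of_outside: "f \<in> C_of X \<Longrightarrow> x \<notin> topspace X \<Longrightarrow> f x = 0"
  by (simp_all add: C_of_def)

lemma C_of_add: "f \<in> C_of X \<Longrightarrow> g \<in> C_of X \<Longrightarrow> (\<lambda>c. f c + g c) \<in> C_of X"
  by (simp add: C_of_def continuous_map_add)

lemma C_of_mult: "f \<in> C_of X \<Longrightarrow> g \<in> C_of X \<Longrightarrow> (\<lambda>c. f c * g c) \<in> C_of X"
  by (simp add: C_of_def continuous_map_atin tendsto_mult)

lemma C_of_scale: "f \<in> C_of X \<Longrightarrow> (\<lambda>c. z * f c) \<in> C_of X"
  by (simp add: C_of_def continuous_map_atin tendsto_mult)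

lemma C_of_cnj: "f \<in> C_of X \<Longrightarrow> (\<lambda>c. cnj (f c)) \<in> C_of X"
  by (simp add: C_of_def continuous_map_atin tendsto_cnj)

lemma C_of_zero: "(\<lambda>c. 0) \<in> C_of X"
  by (simp add: C_of_def)

lemma C_of_one: "one_C X \<in> C_of X"
proof -
  have "continuous_map X euclidean (one_C X)"
    by (rule continuous_map_eq[of X euclidean "\<lambda>_. 1"]) (simp_all add: one_C_def)
  then show ?thesis by (simp add: C_of_def one_C_def)
qed

lemma C_of_bounded:
  assumes "compact_space X" "f \<in> C_of X"
  obtains B where "B \<ge> 0" "\<And>x. cmod (f x) \<le> B"
proof -
  have "compactin euclidean (f ` topspace X)"
    using assms by (meson C_of_continuous compact_space_def image_compactin)
  then have "bounded (f ` topspace X)"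
    by (simp add: compact_imp_bounded)
  then obtain B where B: "\<And>x. x \<in> topspace X \<Longrightarrow> cmod (f x) \<le> B"
    by (auto simp: bounded_iff)
  have "cmod (f x) \<le> max B 0" for x
    using B[of x] C_of_outside[OF assms(2), of x] by (cases "x \<in> topspace X") auto
  then show thesis
    using that[of "max B 0"] by auto
qed

text \<open>The uniform limit theorem serves twice: for inner products of Cauchy sequences and for
  completeness of C(E^\<infinity>). The bound ranges over all c, also off the carrier, where it
  forces the limit to be 0.\<close>

lemma C_of_uniform_limit:
  fixes F :: "nat \<Rightarrow> 'x \<Rightarrow> complex"
  assumes F: "\<And>n. F n \<in> C_of X"
    and lim: "\<And>\<epsilon>. \<epsilon> > 0 \<Longrightarrow> \<exists>N. \<forall>n\<ge>N. \<forall>c. cmod (F n c - f c) \<le> \<epsilon>"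
  shows "f \<in> C_of X"
proof (rule C_ofI)
  have "\<forall>\<^sub>F n in sequentially. continuous_map X euclidean (F n)"
    using F by (simp add: C_of_continuous)
  moreover have "\<forall>\<^sub>F n in sequentially. \<forall>x\<in>topspace X. dist (F n x) (f x) < \<epsilon>" if e: "\<epsilon> > 0" for \<epsilon> :: real
  proof -
    obtain N where N: "\<forall>n\<ge>N. \<forall>c. cmod (F n c - f c) \<le> \<epsilon> / 2"
      using lim[OF half_gt_zero[OF e]] by blast
    show ?thesis
      unfolding eventually_sequentially
    proof (intro exI allI impI ballI)
      fix n x assume "n \<ge> N"
      then have "cmod (F n x - f x) \<le> \<epsilon> / 2" using N by blast
      then show "dist (F n x) (f x) < \<epsilon>"
        using e by (simp add: dist_norm)
    qed
  qed
  ultimately show "continuous_map X euclidean f"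
    using Met_TC.continuous_map_uniform_limit_alt[of X F sequentially f] by simp
next
  fix x assume x: "x \<notin> topspace X"
  have "cmod (f x) \<le> \<epsilon>" if "\<epsilon> > 0" for \<epsilon>
  proof -
    obtain N where "\<forall>n\<ge>N. \<forall>c. cmod (F n c - f c) \<le> \<epsilon>"
      using lim \<open>\<epsilon> > 0\<close> by auto
    then have "cmod (F N x - f x) \<le> \<epsilon>" by blast
    then show ?thesis
      using C_of_outside[OF F x, of N] by simp
  qed
  then show "f x = 0"
    using field_le_epsilon[of "cmod (f x)" 0] by auto
qed

section \<open>Pre-Hilbert modules: Cauchy-Schwarz and the seminorm\<close>

abbreviation hdist :: "('x, 'm, 'z) hmod_scheme \<Rightarrow> 'm \<Rightarrow> 'm \<Rightarrow> real" where
  "hdist M x y \<equiv> hnorm M (hminus M x y)"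

text \<open>The laws of \<open>hilbert_module\<close> without definiteness and completeness. What
  remains is a semi-inner product over every point of the base, enough for the seminorm; the
  completion restores the two missing laws.\<close>

locale pre_hilbert_module =
  fixes M :: "('x, 'm, 'z) hmod_scheme"
  assumes base: "compact_space (hbase M)" "Hausdorff_space (hbase M)"
    and zero_closed: "hzero M \<in> hcarrier M"
    and add_closed: "\<lbrakk>x \<in> hcarrier M; y \<in> hcarrier M\<rbrakk> \<Longrightarrow> hadd M x y \<in> hcarrier M"
    and scale_closed: "x \<in> hcarrier M \<Longrightarrow> hscale M z x \<in> hcarrier M"
    and act_closed: "\<lbrakk>x \<in> hcarrier M; f \<in> C_of (hbase M)\<rbrakk> \<Longrightarrow> hact M x f \<in> hcarrier M"
    and add_assoc: "\<lbrakk>x \<in> hcarrier M; y \<in> hcarrier M; u \<in> hcarrier M\<rbrakk>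
      \<Longrightarrow> hadd M (hadd M x y) u = hadd M x (hadd M y u)"
    and add_commute: "\<lbrakk>x \<in> hcarrier M; y \<in> hcarrier M\<rbrakk> \<Longrightarrow> hadd M x y = hadd M y x"
    and add_zero: "x \<in> hcarrier M \<Longrightarrow> hadd M x (hzero M) = x"
    and minus_self: "x \<in> hcarrier M \<Longrightarrow> hminus M x x = hzero M"
    and scale_one: "x \<in> hcarrier M \<Longrightarrow> hscale M 1 x = x"
    and scale_scale: "x \<in> hcarrier M \<Longrightarrow> hscale M z (hscale M z' x) = hscale M (z * z') x"
    and scale_add: "\<lbrakk>x \<in> hcarrier M; y \<in> hcarrier M\<rbrakk>
      \<Longrightarrow> hscale M z (hadd M x y) = hadd M (hscale M z x) (hscale M z y)"
    and add_scale: "x \<in> hcarrier M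
      \<Longrightarrow> hscale M (z + z') x = hadd M (hscale M z x) (hscale M z' x)"
    and act_one: "x \<in> hcarrier M \<Longrightarrow> hact M x (one_C (hbase M)) = x"
    and act_act: "\<lbrakk>x \<in> hcarrier M; f \<in> C_of (hbase M); g \<in> C_of (hbase M)\<rbrakk>
      \<Longrightarrow> hact M (hact M x f) g = hact M x (\<lambda>c. f c * g c)"
    and act_add: "\<lbrakk>x \<in> hcarrier M; f \<in> C_of (hbase M); g \<in> C_of (hbase M)\<rbrakk>
      \<Longrightarrow> hact M x (\<lambda>c. f c + g c) = hadd M (hact M x f) (hact M x g)"
    and add_act: "\<lbrakk>x \<in> hcarrier M; y \<in> hcarrier M; f \<in> C_of (hbase M)\<rbrakk>
      \<Longrightarrow> hact M (hadd M x y) f = hadd M (hact M x f) (hact M y f)"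
    and scale_act: "\<lbrakk>x \<in> hcarrier M; f \<in> C_of (hbase M)\<rbrakk>
      \<Longrightarrow> hact M (hscale M z x) f = hscale M z (hact M x f)"
    and act_scale: "\<lbrakk>x \<in> hcarrier M; f \<in> C_of (hbase M)\<rbrakk>
      \<Longrightarrow> hact M x (\<lambda>c. z * f c) = hscale M z (hact M x f)"
    and ip_closed: "\<lbrakk>x \<in> hcarrier M; y \<in> hcarrier M\<rbrakk> \<Longrightarrow> hip M x y \<in> C_of (hbase M)"
    and ip_add: "\<lbrakk>x \<in> hcarrier M; y \<in> hcarrier M; u \<in> hcarrier M\<rbrakk>
      \<Longrightarrow> hip M x (hadd M y u) = (\<lambda>c. hip M x y c + hip M x u c)"
    and ip_scale: "\<lbrakk>x \<in> hcarrier M; y \<in> hcarrier M\<rbrakk>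
      \<Longrightarrow> hip M x (hscale M z y) = (\<lambda>c. z * hip M x y c)"
    and ip_act: "\<lbrakk>x \<in> hcarrier M; y \<in> hcarrier M; f \<in> C_of (hbase M)\<rbrakk>
      \<Longrightarrow> hip M x (hact M y f) = (\<lambda>c. hip M x y c * f c)"
    and ip_cnj: "\<lbrakk>x \<in> hcarrier M; y \<in> hcarrier M\<rbrakk> \<Longrightarrow> hip M y x = (\<lambda>c. cnj (hip M x y c))"
    and ip_nonneg: "x \<in> hcarrier M \<Longrightarrow> hip M x x c \<in> \<real>\<^sub>\<ge>\<^sub>0"
begin

lemma minus_closed: "x \<in> hcarrier M \<Longrightarrow> y \<in> hcarrier M \<Longrightarrow> hminus M x y \<in> hcarrier M"
  by (simp add: hminus_def add_closed scale_closed)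

lemmas closed = zero_closed add_closed scale_closed act_closed minus_closed

lemma ip_add_left: "\<lbrakk>x \<in> hcarrier M; y \<in> hcarrier M; u \<in> hcarrier M\<rbrakk>
    \<Longrightarrow> hip M (hadd M y u) x = (\<lambda>c. hip M y x c + hip M u x c)"
  by (subst ip_cnj[of x]) (auto simp: closed ip_add ip_cnj[of x y] ip_cnj[of x u] fun_eq_iff)

lemma ip_scale_left: "\<lbrakk>x \<in> hcarrier M; y \<in> hcarrier M\<rbrakk>
    \<Longrightarrow> hip M (hscale M z y) x = (\<lambda>c. cnj z * hip M y x c)"
  by (subst ip_cnj[of x]) (auto simp: closed ip_scale ip_cnj[of x y] fun_eq_iff)

lemma ip_act_left: "\<lbrakk>x \<in> hcarrier M; y \<in> hcarrier M; f \<in> C_of (hbase M)\<rbrakk>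
    \<Longrightarrow> hip M (hact M y f) x = (\<lambda>c. cnj (f c) * hip M y x c)"
  by (subst ip_cnj[of x]) (auto simp: closed ip_act ip_cnj[of x y] fun_eq_iff)

lemma ip_minus: "\<lbrakk>x \<in> hcarrier M; y \<in> hcarrier M; u \<in> hcarrier M\<rbrakk>
    \<Longrightarrow> hip M x (hminus M y u) = (\<lambda>c. hip M x y c - hip M x u c)"
  by (simp add: hminus_def closed ip_add ip_scale)

lemma ip_minus_left: "\<lbrakk>x \<in> hcarrier M; y \<in> hcarrier M; u \<in> hcarrier M\<rbrakk>
    \<Longrightarrow> hip M (hminus M y u) x = (\<lambda>c. hip M y x c - hip M u x c)"
  by (simp add: hminus_def closed ip_add_left ip_scale_left)

lemmas ip_expand = ip_add ip_scale ip_act ip_minus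
  ip_add_left ip_scale_left ip_act_left ip_minus_left

lemma ip_zero: "x \<in> hcarrier M \<Longrightarrow> hip M x (hzero M) = (\<lambda>_. 0)"
  by (subst minus_self[symmetric, of x]) (simp_all add: ip_minus closed)

lemma ip_zero_left: "x \<in> hcarrier M \<Longrightarrow> hip M (hzero M) x = (\<lambda>_. 0)"
  by (subst ip_cnj[of x]) (simp_all add: ip_zero closed)

lemma ip_outside: "\<lbrakk>x \<in> hcarrier M; y \<in> hcarrier M; c \<notin> topspace (hbase M)\<rbrakk> \<Longrightarrow> hip M x y c = 0"
  by (meson C_of_outside ip_closed)

lemma ip_self: "x \<in> hcarrier M \<Longrightarrow> hip M x x c = of_real (cmod (hip M x x c))"
  using ip_nonneg[of x c] by (auto simp: nonneg_Reals_def)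

text \<open>At a fixed c the scalars <x,y>(c) form a semi-inner product, so the classical argument
  applies: <x + ty, x + ty>(c) is nonnegative for all complex t, and this is tested on suitable
  t.\<close>

lemma Cauchy_Schwarz:
  assumes x: "x \<in> hcarrier M" and y: "y \<in> hcarrier M"
  shows "(cmod (hip M x y c))\<^sup>2 \<le> cmod (hip M x x c) * cmod (hip M y y c)"
proof -
  define a b z where "a = cmod (hip M x x c)" and "b = cmod (hip M y y c)" and "z = hip M x y c"
  have nn: "0 \<le> a + 2 * Re (t * z) + (cmod t)\<^sup>2 * b" for t
  proof -
    let ?u = "hadd M x (hscale M t y)"
    have u: "?u \<in> hcarrier M" by (simp add: x y closed)
    have "hip M ?u ?u c = hip M x x c + t * hip M x y c + cnj (t * hip M x y c) + (cnj t * t) * hip M y y c"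
      using x y by (simp add: ip_expand closed ip_cnj[of x y] algebra_simps)
    also have "\<dots> = of_real a + t * z + cnj (t * z) + (cnj t * t) * of_real b"
      unfolding a_def b_def z_def ip_self[OF x, of c, symmetric] ip_self[OF y, of c, symmetric] ..
    also have "cnj t * t = of_real ((cmod t)\<^sup>2)"
      by (simp only: complex_norm_square mult.commute)
    finally have "Re (hip M ?u ?u c) = a + 2 * Re (t * z) + (cmod t)\<^sup>2 * b"
      by simp
    moreover have "Re (hip M ?u ?u c) \<ge> 0"
      using ip_nonneg[OF u, of c] by (simp add: complex_nonneg_Reals_iff)
    ultimately show ?thesis by simp
  qed
  have b0: "b \<ge> 0" by (simp add: b_def)
  have sq: "cnj z * z = of_real ((cmod z)\<^sup>2)"
    by (simp only: complex_norm_square mult.commute)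
  \<comment> \<open>The choice t = -s cnj z makes t z real and leaves a quadratic inequality in the
    real parameter s.\<close>
  have "0 \<le> a + 2 * Re (of_real (- s) * cnj z * z) + (s * cmod z)\<^sup>2 * b" for s
    using nn[of "of_real (- s) * cnj z"] by (simp add: norm_mult power_mult_distrib)
  then have nn': "0 \<le> a - 2 * s * (cmod z)\<^sup>2 + s\<^sup>2 * (cmod z)\<^sup>2 * b" for s
    unfolding mult.assoc sq by (simp add: power_mult_distrib mult.assoc flip: of_real_mult)
  show ?thesis
  proof (cases "b = 0")
    case True
    have "(cmod z)\<^sup>2 = 0"
    proof (rule ccontr)
      assume n: "(cmod z)\<^sup>2 \<noteq> 0"
      \<comment> \<open>With b = 0 the inequality is affine in s, and this s makes its right side -a
        - 2, which is negative.\<close>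
      have "0 \<le> a - 2 * ((a + 1) / (cmod z)\<^sup>2) * (cmod z)\<^sup>2"
        using nn'[of "(a + 1) / (cmod z)\<^sup>2"] True by simp
      then have "0 \<le> a - 2 * (a + 1)"
        using n by simp
      moreover have "a \<ge> 0" by (simp add: a_def)
      ultimately show False by simp
    qed
    then show ?thesis by (simp add: z_def)
  next
    case False
    with b0 have "b > 0" by simp
    \<comment> \<open>s = 1 / b minimises the quadratic; multiplying by b clears the
      denominators.\<close>
    have "0 \<le> (a - 2 * (1 / b) * (cmod z)\<^sup>2 + (1 / b)\<^sup>2 * (cmod z)\<^sup>2 * b) * b"
      using nn'[of "1 / b"] b0 by (rule mult_nonneg_nonneg)
    also have "\<dots> = a * b - (cmod z)\<^sup>2"
      using False by (simp add: field_simps power2_eq_square)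
    finally show ?thesis by (simp add: a_def b_def z_def)
  qed
qed

lemma hnorm_le:
  assumes "B \<ge> 0" and "\<And>c. c \<in> topspace (hbase M) \<Longrightarrow> cmod (hip M x x c) \<le> B\<^sup>2"
  shows "hnorm M x \<le> B"
proof -
  have "Sup (insert 0 ((\<lambda>c. cmod (hip M x x c)) ` topspace (hbase M))) \<le> B\<^sup>2"
    using assms by (intro cSup_least) auto
  then show ?thesis
    unfolding hnorm_def using assms(1) by (simp add: real_le_lsqrt)
qed

lemma ip_bdd_above:
  assumes "x \<in> hcarrier M"
  shows "bdd_above (insert 0 ((\<lambda>c. cmod (hip M x x c)) ` topspace (hbase M)))"
proof -
  obtain B where "\<And>c. cmod (hip M x x c) \<le> B"
    using C_of_bounded[OF base(1) ip_closed[OF assms assms]] by blast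
  then show ?thesis by (auto intro!: bdd_aboveI2)
qed

lemma ip_le_hnorm_sq:
  assumes "x \<in> hcarrier M"
  shows "cmod (hip M x x c) \<le> (hnorm M x)\<^sup>2"
proof -
  let ?S = "insert 0 ((\<lambda>c. cmod (hip M x x c)) ` topspace (hbase M))"
  have 0: "0 \<le> Sup ?S"
    using ip_bdd_above[OF assms] by (intro cSup_upper) auto
  have "cmod (hip M x x c) \<le> Sup ?S"
  proof (cases "c \<in> topspace (hbase M)")
    case True
    then show ?thesis using ip_bdd_above[OF assms] by (intro cSup_upper) auto
  next
    case False
    then show ?thesis using 0 ip_outside[OF assms assms] by simp
  qed
  then show ?thesis using 0 by (simp add: hnorm_def)
qed

lemma hnorm_nonneg: "x \<in> hcarrier M \<Longrightarrow> 0 \<le> hnorm M x"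
  unfolding hnorm_def using ip_bdd_above by (auto intro!: cSup_upper)

lemma ip_le_hnorm:
  assumes "x \<in> hcarrier M" "y \<in> hcarrier M"
  shows "cmod (hip M x y c) \<le> hnorm M x * hnorm M y"
proof -
  have "(cmod (hip M x y c))\<^sup>2 \<le> cmod (hip M x x c) * cmod (hip M y y c)"
    by (rule Cauchy_Schwarz[OF assms])
  also have "\<dots> \<le> (hnorm M x)\<^sup>2 * (hnorm M y)\<^sup>2"
    using assms by (intro mult_mono ip_le_hnorm_sq) auto
  finally show ?thesis
    using assms by (simp add: hnorm_nonneg flip: power_mult_distrib)
qed

lemma hnorm_zero: "hnorm M (hzero M) = 0"
  using hnorm_le[of 0 "hzero M"] hnorm_nonneg[OF zero_closed] by (simp add: ip_zero zero_closed)

text \<open>The seminorm sees only <x,x>. Two vectors are thus shown to have the same length by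
  expanding inner products, with no rearrangement of sums inside the module; the distance estimates
  below start this way.\<close>

lemma hnorm_cong: "(\<And>c. hip M x x c = hip M y y c) \<Longrightarrow> hnorm M x = hnorm M y"
  by (simp add: hnorm_def)

lemma hnorm_add:
  assumes x: "x \<in> hcarrier M" and y: "y \<in> hcarrier M"
  shows "hnorm M (hadd M x y) \<le> hnorm M x + hnorm M y"
proof (rule hnorm_le)
  show "0 \<le> hnorm M x + hnorm M y" by (simp add: x y hnorm_nonneg)
  fix c
  have "hip M (hadd M x y) (hadd M x y) c = hip M x x c + hip M x y c + (hip M y x c + hip M y y c)"
    using x y by (simp add: ip_expand closed)
  also have "cmod \<dots> \<le> cmod (hip M x x c) + cmod (hip M x y c) + (cmod (hip M y x c) + cmod (hip M y y c))"
    by (intro order.trans[OF norm_triangle_ineq] add_mono order_refl)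
  also have "\<dots> \<le> hnorm M x * hnorm M x + hnorm M x * hnorm M y + (hnorm M y * hnorm M x + hnorm M y * hnorm M y)"
    using x y by (intro add_mono ip_le_hnorm)
  also have "\<dots> = (hnorm M x + hnorm M y)\<^sup>2"
    by (simp add: power2_eq_square algebra_simps)
  finally show "cmod (hip M (hadd M x y) (hadd M x y) c) \<le> (hnorm M x + hnorm M y)\<^sup>2" .
qed

lemma hnorm_scale:
  assumes x: "x \<in> hcarrier M"
  shows "hnorm M (hscale M z x) \<le> cmod z * hnorm M x"
proof (rule hnorm_le)
  show "0 \<le> cmod z * hnorm M x" by (simp add: x hnorm_nonneg)
  fix c
  have "hip M (hscale M z x) (hscale M z x) c = cnj z * z * hip M x x c"
    using x by (simp add: ip_expand closed)
  then have "cmod (hip M (hscale M z x) (hscale M z x) c) = (cmod z)\<^sup>2 * cmod (hip M x x c)"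
    by (simp add: norm_mult power2_eq_square)
  also have "\<dots> \<le> (cmod z)\<^sup>2 * (hnorm M x)\<^sup>2"
    using x by (intro mult_left_mono ip_le_hnorm_sq) auto
  finally show "cmod (hip M (hscale M z x) (hscale M z x) c) \<le> (cmod z * hnorm M x)\<^sup>2"
    by (simp add: power_mult_distrib)
qed

lemma hnorm_act:
  assumes x: "x \<in> hcarrier M" and f: "f \<in> C_of (hbase M)" and B: "\<And>c. cmod (f c) \<le> B"
  shows "hnorm M (hact M x f) \<le> B * hnorm M x"
proof (rule hnorm_le)
  have B0: "B \<ge> 0" using B[of undefined] norm_ge_zero[of "f undefined"] by linarith
  then show "0 \<le> B * hnorm M x" by (simp add: x hnorm_nonneg)
  fix c
  have "hip M (hact M x f) (hact M x f) c = cnj (f c) * f c * hip M x x c"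
    using x f by (simp add: ip_expand closed)
  then have "cmod (hip M (hact M x f) (hact M x f) c) = (cmod (f c))\<^sup>2 * cmod (hip M x x c)"
    by (simp add: norm_mult power2_eq_square)
  also have "\<dots> \<le> B\<^sup>2 * (hnorm M x)\<^sup>2"
    using x B0 B by (intro mult_mono ip_le_hnorm_sq power_mono) auto
  finally show "cmod (hip M (hact M x f) (hact M x f) c) \<le> (B * hnorm M x)\<^sup>2"
    by (simp add: power_mult_distrib)
qed

lemma hdist_sym:
  "x \<in> hcarrier M \<Longrightarrow> y \<in> hcarrier M \<Longrightarrow> hdist M x y = hdist M y x"
  by (rule hnorm_cong) (simp add: ip_expand closed)

lemma hdist_triangle:
  assumes "x \<in> hcarrier M" "y \<in> hcarrier M" "u \<in> hcarrier M"
  shows "hdist M x u \<le> hdist M x y + hdist M y u"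
proof -
  have "hdist M x u = hnorm M (hadd M (hminus M x y) (hminus M y u))"
    using assms by (intro hnorm_cong) (simp add: ip_expand closed)
  then show ?thesis using assms by (simp add: hnorm_add closed)
qed

lemma hdist_add:
  assumes "x \<in> hcarrier M" "y \<in> hcarrier M" "x' \<in> hcarrier M" "y' \<in> hcarrier M"
  shows "hdist M (hadd M x y) (hadd M x' y') \<le> hdist M x x' + hdist M y y'"
proof -
  have "hdist M (hadd M x y) (hadd M x' y') = hnorm M (hadd M (hminus M x x') (hminus M y y'))"
    using assms by (intro hnorm_cong) (simp add: ip_expand closed)
  then show ?thesis using assms by (simp add: hnorm_add closed)
qed

lemma hdist_scale:
  assumes "x \<in> hcarrier M" "y \<in> hcarrier M"
  shows "hdist M (hscale M z x) (hscale M z y) \<le> cmod z * hdist M x y"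
proof -
  have "hdist M (hscale M z x) (hscale M z y) = hnorm M (hscale M z (hminus M x y))"
    using assms by (intro hnorm_cong) (simp add: ip_expand closed algebra_simps)
  then show ?thesis using assms by (simp add: hnorm_scale closed)
qed

lemma hdist_act:
  assumes "x \<in> hcarrier M" "y \<in> hcarrier M" "f \<in> C_of (hbase M)" "\<And>c. cmod (f c) \<le> B"
  shows "hdist M (hact M x f) (hact M y f) \<le> B * hdist M x y"
proof -
  have "hdist M (hact M x f) (hact M y f) = hnorm M (hact M (hminus M x y) f)"
    using assms by (intro hnorm_cong) (simp add: ip_expand closed algebra_simps)
  then show ?thesis using assms by (simp add: hnorm_act closed)
qed

lemma hdist_self: "x \<in> hcarrier M \<Longrightarrow> hdist M x x = 0"
  by (simp add: minus_self hnorm_zero)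

lemma hdist_nonneg: "x \<in> hcarrier M \<Longrightarrow> y \<in> hcarrier M \<Longrightarrow> 0 \<le> hdist M x y"
  by (simp add: hnorm_nonneg closed)

section \<open>Cauchy sequences and null sequences\<close>

lemma cauchy_carrier: "x \<in> hcauchy M \<Longrightarrow> x n \<in> hcarrier M"
  by (simp add: hcauchy_def)

lemma cauchyD:
  assumes "x \<in> hcauchy M" "\<epsilon> > 0"
  obtains N where "\<And>i j. i \<ge> N \<Longrightarrow> j \<ge> N \<Longrightarrow> hdist M (x i) (x j) < \<epsilon>"
  using assms unfolding hcauchy_def by blast

lemma cauchy_const: "x \<in> hcarrier M \<Longrightarrow> (\<lambda>_. x) \<in> hcauchy M"
  by (auto simp: hcauchy_def hdist_self)

lemma cauchy_add:
  assumes x: "x \<in> hcauchy M" and y: "y \<in> hcauchy M"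
  shows "(\<lambda>n. hadd M (x n) (y n)) \<in> hcauchy M"
  unfolding hcauchy_def mem_Collect_eq
proof (intro conjI allI impI)
  fix \<epsilon> :: real assume "\<epsilon> > 0"
  then have e: "\<epsilon> / 2 > 0" by simp
  obtain N where N: "\<And>i j. i \<ge> N \<Longrightarrow> j \<ge> N \<Longrightarrow> hdist M (x i) (x j) < \<epsilon> / 2"
    using cauchyD[OF x e] by blast
  obtain N' where N': "\<And>i j. i \<ge> N' \<Longrightarrow> j \<ge> N' \<Longrightarrow> hdist M (y i) (y j) < \<epsilon> / 2"
    using cauchyD[OF y e] by blast
  show "\<exists>N. \<forall>i\<ge>N. \<forall>j\<ge>N. hdist M (hadd M (x i) (y i)) (hadd M (x j) (y j)) < \<epsilon>"
  proof (intro exI allI impI)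
    fix i j assume ij: "i \<ge> max N N'" "j \<ge> max N N'"
    have "hdist M (hadd M (x i) (y i)) (hadd M (x j) (y j))
        \<le> hdist M (x i) (x j) + hdist M (y i) (y j)"
      by (intro hdist_add cauchy_carrier x y)
    then show "hdist M (hadd M (x i) (y i)) (hadd M (x j) (y j)) < \<epsilon>"
      using N[of i j] N'[of i j] ij by simp
  qed
qed (use x y in \<open>simp add: closed cauchy_carrier\<close>)

text \<open>Scalar multiples and the action of a bounded function are Lipschitz, hence both preserve
  Cauchy sequences.\<close>

lemma cauchy_lipschitz:
  assumes x: "x \<in> hcauchy M" and y: "\<And>n. y n \<in> hcarrier M"
    and B: "\<And>i j. hdist M (y i) (y j) \<le> B * hdist M (x i) (x j)"
  shows "y \<in> hcauchy M"
  unfolding hcauchy_def mem_Collect_eq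
proof (intro conjI allI impI)
  fix \<epsilon> :: real assume "\<epsilon> > 0"
  \<comment> \<open>|B| + 1 is a positive divisor whatever the sign of B.\<close>
  then have e: "\<epsilon> / (\<bar>B\<bar> + 1) > 0" by simp
  obtain N where N: "\<And>i j. i \<ge> N \<Longrightarrow> j \<ge> N \<Longrightarrow> hdist M (x i) (x j) < \<epsilon> / (\<bar>B\<bar> + 1)"
    using cauchyD[OF x e] by blast
  show "\<exists>N. \<forall>i\<ge>N. \<forall>j\<ge>N. hdist M (y i) (y j) < \<epsilon>"
  proof (intro exI allI impI)
    fix i j assume ij: "i \<ge> N" "j \<ge> N"
    have nn: "0 \<le> hdist M (x i) (x j)"
      by (intro hdist_nonneg cauchy_carrier x)
    have "hdist M (y i) (y j) \<le> B * hdist M (x i) (x j)" by (rule B)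
    also have "\<dots> \<le> (\<bar>B\<bar> + 1) * hdist M (x i) (x j)"
      using nn by (intro mult_right_mono) auto
    also have "\<dots> < (\<bar>B\<bar> + 1) * (\<epsilon> / (\<bar>B\<bar> + 1))"
      using N[OF ij] by (intro mult_strict_left_mono) auto
    finally show "hdist M (y i) (y j) < \<epsilon>" by (simp add: add_pos_nonneg)
  qed
qed (rule y)

lemma cauchy_scale:
  assumes "x \<in> hcauchy M" shows "(\<lambda>n. hscale M z (x n)) \<in> hcauchy M"
  by (rule cauchy_lipschitz[OF assms, where B = "cmod z"])
    (use assms in \<open>simp_all add: closed cauchy_carrier hdist_scale\<close>)

lemma cauchy_act:
  assumes x: "x \<in> hcauchy M" and f: "f \<in> C_of (hbase M)"
  shows "(\<lambda>n. hact M (x n) f) \<in> hcauchy M"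
proof -
  obtain B where "\<And>c. cmod (f c) \<le> B"
    using C_of_bounded[OF base(1) f] by blast
  then show ?thesis
    by (intro cauchy_lipschitz[OF x, where B = B] hdist_act) (simp_all add: f x closed cauchy_carrier)
qed

lemma cauchy_minus:
  "x \<in> hcauchy M \<Longrightarrow> y \<in> hcauchy M \<Longrightarrow> (\<lambda>n. hminus M (x n) (y n)) \<in> hcauchy M"
  unfolding hminus_def by (intro cauchy_add cauchy_scale)

lemma cauchy_bounded:
  assumes x: "x \<in> hcauchy M"
  obtains B where "B > 0" "\<And>n. hnorm M (x n) \<le> B"
proof -
  obtain N where N: "\<And>i j. i \<ge> N \<Longrightarrow> j \<ge> N \<Longrightarrow> hdist M (x i) (x j) < 1"
    using cauchyD[OF x, of 1] by auto
  \<comment> \<open>The sum dominates each of the first norms; the extra 1 bounds the distance of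
    the later terms from term N.\<close>
  define B where "B = (\<Sum>i\<le>N. hnorm M (x i)) + 1"
  have nn: "hnorm M (x i) \<ge> 0" for i by (intro hnorm_nonneg cauchy_carrier x)
  have S: "hnorm M (x i) \<le> (\<Sum>i\<le>N. hnorm M (x i))" if "i \<le> N" for i
    using that nn by (intro member_le_sum) auto
  have "hnorm M (x n) \<le> B" for n
  proof (cases "n \<le> N")
    case True then show ?thesis using S[of n] by (simp add: B_def)
  next
    case False
    have "hnorm M (x n) = hnorm M (hadd M (hminus M (x n) (x N)) (x N))"
      using x by (intro hnorm_cong) (simp add: ip_expand closed cauchy_carrier)
    also have "\<dots> \<le> hdist M (x n) (x N) + hnorm M (x N)"
      by (intro hnorm_add closed cauchy_carrier x)
    also have "\<dots> \<le> B"
      using N[of n N] S[of N] False by (simp add: B_def)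
    finally show ?thesis .
  qed
  moreover have "B > 0" using nn by (simp add: B_def add_nonneg_pos sum_nonneg)
  ultimately show thesis using that by blast
qed

lemma null_relD:
  assumes "(x, y) \<in> null_rel M"
  shows "x \<in> hcauchy M" "y \<in> hcauchy M" "(\<lambda>n. hdist M (x n) (y n)) \<longlonglongrightarrow> 0"
  using assms by (auto simp: null_rel_def)

lemma null_relI:
  assumes "x \<in> hcauchy M" "y \<in> hcauchy M" and "a \<longlonglongrightarrow> 0"
    and "\<And>n. hdist M (x n) (y n) \<le> a n"
  shows "(x, y) \<in> null_rel M"
proof -
  have "(\<lambda>n. hdist M (x n) (y n)) \<longlonglongrightarrow> 0"
    by (rule real_tendsto_sandwich[OF _ _ tendsto_const assms(3)])
      (use assms in \<open>auto intro!: always_eventually hdist_nonneg simp: cauchy_carrier\<close>)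
  then show ?thesis using assms by (simp add: null_rel_def)
qed

lemma equiv_null_rel: "equiv (hcauchy M) (null_rel M)"
proof (rule equivI)
  show "null_rel M \<subseteq> hcauchy M \<times> hcauchy M"
    by (auto simp: null_rel_def)
  show "refl_on (hcauchy M) (null_rel M)"
    by (auto simp: refl_on_def null_rel_def hdist_self cauchy_carrier)
  show "sym (null_rel M)"
    by (auto simp: sym_def null_rel_def hdist_sym cauchy_carrier)
  show "trans (null_rel M)"
  proof (rule transI)
    fix x y u assume xy: "(x, y) \<in> null_rel M" and yu: "(y, u) \<in> null_rel M"
    have "(\<lambda>n. hdist M (x n) (y n) + hdist M (y n) (u n)) \<longlonglongrightarrow> 0"
      using tendsto_add[OF null_relD(3)[OF xy] null_relD(3)[OF yu]] by simp
    then show "(x, u) \<in> null_rel M"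
      using null_relD(1,2)[OF xy] null_relD(1,2)[OF yu]
      by (elim null_relI[rotated 2]) (auto intro!: hdist_triangle simp: cauchy_carrier)
  qed
qed

section \<open>Operations and inner products of classes of Cauchy sequences\<close>

abbreviation "Mc \<equiv> completion M"

abbreviation cls :: "(nat \<Rightarrow> 'm) \<Rightarrow> (nat \<Rightarrow> 'm) set" where
  "cls x \<equiv> null_rel M `` {x}"

lemma cls_eq_iff: "x \<in> hcauchy M \<Longrightarrow> y \<in> hcauchy M \<Longrightarrow> cls x = cls y \<longleftrightarrow> (x, y) \<in> null_rel M"
  using eq_equiv_class_iff[OF equiv_null_rel] by blast

lemma cls_carrier: "x \<in> hcauchy M \<Longrightarrow> cls x \<in> hcarrier Mc"
  by (simp add: completion_def quotientI)

lemma completion_cases: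
  assumes "p \<in> hcarrier Mc"
  obtains x where "x \<in> hcauchy M" "p = cls x"
  using assms by (auto simp: completion_def elim: quotientE)

text \<open>The completion computes with \<open>rep\<close>; this is the link back to a given
  sequence. Each operation maps sequences that differ by a null sequence to such sequences, so its
  value on classes can be computed on any representatives.\<close>

lemma rep_rel: assumes "x \<in> hcauchy M" shows "(x, rep (cls x)) \<in> null_rel M"
proof -
  have "x \<in> cls x" using equiv_class_self[OF equiv_null_rel assms] .
  then have "rep (cls x) \<in> cls x"
    unfolding rep_def by (metis someI)
  then show ?thesis by simp
qed

lemma rep_cauchy: "x \<in> hcauchy M \<Longrightarrow> rep (cls x) \<in> hcauchy M"
  using rep_rel null_relD(2) by blast

lemma rep_tendsto: "x \<in> hcauchy M \<Longrightarrow> (\<lambda>n. hdist M (x n) (rep (cls x) n)) \<longlonglongrightarrow> 0"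
  using rep_rel null_relD(3) by blast

lemma completion_base: "hbase Mc = hbase M"
  by (simp add: completion_def)

lemma completion_zero: "hzero Mc = cls (\<lambda>_. hzero M)"
  by (simp add: completion_def)

lemma completion_add:
  assumes x: "x \<in> hcauchy M" and y: "y \<in> hcauchy M"
  shows "hadd Mc (cls x) (cls y) = cls (\<lambda>n. hadd M (x n) (y n))"
proof -
  have "((\<lambda>n. hadd M (x n) (y n)), (\<lambda>n. hadd M (rep (cls x) n) (rep (cls y) n))) \<in> null_rel M"
  proof (rule null_relI)
    show "(\<lambda>n. hdist M (x n) (rep (cls x) n) + hdist M (y n) (rep (cls y) n)) \<longlonglongrightarrow> 0"
      using tendsto_add[OF rep_tendsto[OF x] rep_tendsto[OF y]] by simp
  qed (use x y in \<open>auto intro!: hdist_add cauchy_add rep_cauchy simp: cauchy_carrier rep_cauchy\<close>)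
  then show ?thesis
    using equiv_class_eq[OF equiv_null_rel] by (simp add: completion_def)
qed

lemma completion_scale:
  assumes x: "x \<in> hcauchy M"
  shows "hscale Mc z (cls x) = cls (\<lambda>n. hscale M z (x n))"
proof -
  have "((\<lambda>n. hscale M z (x n)), (\<lambda>n. hscale M z (rep (cls x) n))) \<in> null_rel M"
  proof (rule null_relI)
    show "(\<lambda>n. cmod z * hdist M (x n) (rep (cls x) n)) \<longlonglongrightarrow> 0"
      using tendsto_mult_left[OF rep_tendsto[OF x], of "cmod z"] by simp
  qed (use x in \<open>auto intro!: hdist_scale cauchy_scale rep_cauchy simp: cauchy_carrier rep_cauchy\<close>)
  then show ?thesis
    using equiv_class_eq[OF equiv_null_rel] by (simp add: completion_def)
qed

lemma completion_act:
  assumes x: "x \<in> hcauchy M" and f: "f \<in> C_of (hbase M)"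
  shows "hact Mc (cls x) f = cls (\<lambda>n. hact M (x n) f)"
proof -
  obtain B where B: "\<And>c. cmod (f c) \<le> B"
    using C_of_bounded[OF base(1) f] by blast
  have "((\<lambda>n. hact M (x n) f), (\<lambda>n. hact M (rep (cls x) n) f)) \<in> null_rel M"
  proof (rule null_relI)
    show "(\<lambda>n. B * hdist M (x n) (rep (cls x) n)) \<longlonglongrightarrow> 0"
      using tendsto_mult_left[OF rep_tendsto[OF x], of B] by simp
  qed (use x f B in \<open>auto intro!: hdist_act cauchy_act rep_cauchy simp: cauchy_carrier rep_cauchy\<close>)
  then show ?thesis
    using equiv_class_eq[OF equiv_null_rel] by (simp add: completion_def)
qed

lemma completion_minus:
  assumes x: "x \<in> hcauchy M" and y: "y \<in> hcauchy M"
  shows "hminus Mc (cls x) (cls y) = cls (\<lambda>n. hminus M (x n) (y n))"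
  unfolding hminus_def using x y by (simp add: completion_scale completion_add cauchy_scale)

text \<open>The difference splits as <x, y - y'> + <x - x', y'>, and Cauchy-Schwarz bounds both
  terms. This is joint continuity of the inner product on bounded sets.\<close>

lemma ip_diff_le:
  assumes "x \<in> hcarrier M" "y \<in> hcarrier M" "x' \<in> hcarrier M" "y' \<in> hcarrier M"
  shows "cmod (hip M x y c - hip M x' y' c)
    \<le> hnorm M x * hdist M y y' + hdist M x x' * hnorm M y'"
proof -
  have "hip M x y c - hip M x' y' c = hip M x (hminus M y y') c + hip M (hminus M x x') y' c"
    using assms by (simp add: ip_expand)
  also have "cmod \<dots> \<le> cmod (hip M x (hminus M y y') c) + cmod (hip M (hminus M x x') y' c)"
    by (rule norm_triangle_ineq)
  also have "\<dots> \<le> hnorm M x * hdist M y y' + hdist M x x' * hnorm M y'"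
    using assms by (intro add_mono ip_le_hnorm closed)
  finally show ?thesis .
qed

text \<open>N does not depend on c, because norms and distances are suprema over the base. This
  uniformity makes the limit of the inner products continuous.\<close>

lemma cauchy_ip:
  assumes x: "x \<in> hcauchy M" and y: "y \<in> hcauchy M" and "\<epsilon> > 0"
  obtains N where "\<And>i j c. i \<ge> N \<Longrightarrow> j \<ge> N \<Longrightarrow> cmod (hip M (x i) (y i) c - hip M (x j) (y j) c) < \<epsilon>"
proof -
  obtain B where B: "B > 0" "\<And>n. hnorm M (x n) \<le> B" using cauchy_bounded[OF x] by blast
  obtain B' where B': "B' > 0" "\<And>n. hnorm M (y n) \<le> B'" using cauchy_bounded[OF y] by blast
  obtain N where N: "\<And>i j. i \<ge> N \<Longrightarrow> j \<ge> N \<Longrightarrow> hdist M (x i) (x j) < \<epsilon> / (2 * B')"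
    using cauchyD[OF x, of "\<epsilon> / (2 * B')"] \<open>\<epsilon> > 0\<close> B' by auto
  obtain N' where N': "\<And>i j. i \<ge> N' \<Longrightarrow> j \<ge> N' \<Longrightarrow> hdist M (y i) (y j) < \<epsilon> / (2 * B)"
    using cauchyD[OF y, of "\<epsilon> / (2 * B)"] \<open>\<epsilon> > 0\<close> B by auto
  have "cmod (hip M (x i) (y i) c - hip M (x j) (y j) c) < \<epsilon>"
    if ij: "i \<ge> max N N'" "j \<ge> max N N'" for i j c
  proof -
    have "cmod (hip M (x i) (y i) c - hip M (x j) (y j) c)
      \<le> hnorm M (x i) * hdist M (y i) (y j) + hdist M (x i) (x j) * hnorm M (y j)"
      by (intro ip_diff_le cauchy_carrier x y)
    also have "\<dots> \<le> B * hdist M (y i) (y j) + hdist M (x i) (x j) * B'"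
      using B B' by (intro add_mono mult_mono) (auto simp: x y cauchy_carrier intro!: hnorm_nonneg minus_closed)
    also have "\<dots> < B * (\<epsilon> / (2 * B)) + \<epsilon> / (2 * B') * B'"
      using N[of i j] N'[of i j] ij B(1) B'(1)
      by (intro add_strict_mono mult_strict_left_mono mult_strict_right_mono) auto
    also have "\<dots> = \<epsilon>" using B(1) B'(1) by (simp add: field_simps)
    finally show ?thesis .
  qed
  then show thesis using that by blast
qed

text \<open>By definition the limit is taken along the chosen representatives. Any others differ
  from them by null sequences, and since Cauchy sequences are bounded, the inner products then
  differ by a null sequence too.\<close>

lemma completion_ip_limit:
  assumes x: "x \<in> hcauchy M" and y: "y \<in> hcauchy M"
  shows "(\<lambda>n. hip M (x n) (y n) c) \<longlonglongrightarrow> hip Mc (cls x) (cls y) c"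
proof (cases "c \<in> topspace (hbase M)")
  case True
  let ?x = "rep (cls x)" and ?y = "rep (cls y)"
  have rc: "?x \<in> hcauchy M" "?y \<in> hcauchy M" by (simp_all add: rep_cauchy x y)
  obtain B where B: "B > 0" "\<And>n. hnorm M (x n) \<le> B" using cauchy_bounded[OF x] by blast
  obtain B' where B': "B' > 0" "\<And>n. hnorm M (?y n) \<le> B'" using cauchy_bounded[OF rc(2)] by blast
  have "Cauchy (\<lambda>n. hip M (?x n) (?y n) c)"
    unfolding Cauchy_altdef2 dist_norm
  proof (intro allI impI)
    fix \<epsilon> :: real assume "\<epsilon> > 0"
    then obtain N where "\<And>i j c. i \<ge> N \<Longrightarrow> j \<ge> N \<Longrightarrow> cmod (hip M (?x i) (?y i) c - hip M (?x j) (?y j) c) < \<epsilon>"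
      using cauchy_ip[OF rc] by blast
    then show "\<exists>N. \<forall>n\<ge>N. cmod (hip M (?x n) (?y n) c - hip M (?x N) (?y N) c) < \<epsilon>"
      by blast
  qed
  then have "(\<lambda>n. hip M (?x n) (?y n) c) \<longlonglongrightarrow> lim (\<lambda>n. hip M (?x n) (?y n) c)"
    using Cauchy_convergent_iff convergent_LIMSEQ_iff by blast
  then have lim: "(\<lambda>n. hip M (?x n) (?y n) c) \<longlonglongrightarrow> hip Mc (cls x) (cls y) c"
    using True by (simp add: completion_def)
  have b: "cmod (hip M (x n) (y n) c - hip M (?x n) (?y n) c)
      \<le> B * hdist M (y n) (?y n) + hdist M (x n) (?x n) * B'" for n
  proof -
    have "cmod (hip M (x n) (y n) c - hip M (?x n) (?y n) c)
        \<le> hnorm M (x n) * hdist M (y n) (?y n) + hdist M (x n) (?x n) * hnorm M (?y n)"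
      by (intro ip_diff_le cauchy_carrier x y rc)
    also have "\<dots> \<le> B * hdist M (y n) (?y n) + hdist M (x n) (?x n) * B'"
      using B B' by (intro add_mono mult_mono) (auto simp: x y rc cauchy_carrier intro!: hnorm_nonneg minus_closed)
    finally show ?thesis .
  qed
  have "(\<lambda>n. B * hdist M (y n) (?y n) + hdist M (x n) (?x n) * B') \<longlonglongrightarrow> 0"
    using tendsto_add[OF tendsto_mult_left[OF rep_tendsto[OF y], of B] tendsto_mult_right[OF rep_tendsto[OF x], of B']]
    by simp
  then have "(\<lambda>n. hip M (x n) (y n) c - hip M (?x n) (?y n) c) \<longlonglongrightarrow> 0"
    by (rule Lim_null_comparison[OF always_eventually, rotated]) (use b in simp)
  from tendsto_add[OF this lim] show ?thesis by simp
next
  case False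
  then show ?thesis
    using x y by (simp add: completion_def ip_outside cauchy_carrier)
qed

text \<open>Letting j tend to infinity in \<open>cauchy_ip\<close> weakens the strict bound to a
  non-strict one and keeps N independent of c.\<close>

lemma completion_ip_uniform:
  assumes x: "x \<in> hcauchy M" and y: "y \<in> hcauchy M" and "\<epsilon> > 0"
  obtains N where "\<And>i c. i \<ge> N \<Longrightarrow> cmod (hip M (x i) (y i) c - hip Mc (cls x) (cls y) c) \<le> \<epsilon>"
proof -
  obtain N where N: "\<And>i j c. i \<ge> N \<Longrightarrow> j \<ge> N \<Longrightarrow> cmod (hip M (x i) (y i) c - hip M (x j) (y j) c) < \<epsilon>"
    using cauchy_ip[OF assms] by blast
  have "cmod (hip M (x i) (y i) c - hip Mc (cls x) (cls y) c) \<le> \<epsilon>" if "i \<ge> N" for i c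
  proof (rule Lim_bounded)
    show "(\<lambda>j. cmod (hip M (x i) (y i) c - hip M (x j) (y j) c))
        \<longlonglongrightarrow> cmod (hip M (x i) (y i) c - hip Mc (cls x) (cls y) c)"
      by (intro tendsto_intros completion_ip_limit x y)
    show "\<forall>j\<ge>N. cmod (hip M (x i) (y i) c - hip M (x j) (y j) c) \<le> \<epsilon>"
      using N[OF that] less_imp_le by blast
  qed
  then show thesis using that by blast
qed

lemma completion_ip_closed:
  assumes x: "x \<in> hcauchy M" and y: "y \<in> hcauchy M"
  shows "hip Mc (cls x) (cls y) \<in> C_of (hbase M)"
proof (rule C_of_uniform_limit)
  show "hip M (x n) (y n) \<in> C_of (hbase M)" for n
    by (intro ip_closed cauchy_carrier x y)
  show "\<exists>N. \<forall>n\<ge>N. \<forall>c. cmod (hip M (x n) (y n) c - hip Mc (cls x) (cls y) c) \<le> \<epsilon>"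
    if "\<epsilon> > 0" for \<epsilon>
    using completion_ip_uniform[OF x y that] by meson
qed

lemma completion_ip_eqI:
  assumes "x \<in> hcauchy M" "y \<in> hcauchy M" "\<And>c. (\<lambda>n. hip M (x n) (y n) c) \<longlonglongrightarrow> f c"
  shows "hip Mc (cls x) (cls y) = f"
  using LIMSEQ_unique completion_ip_limit[OF assms(1,2)] assms(3) by blast

end

section \<open>The completion is a Hilbert module\<close>

context pre_hilbert_module
begin

lemma hilbert_moduleI:
  assumes "\<And>x. x \<in> hcarrier M \<Longrightarrow> hip M x x = (\<lambda>_. 0) \<Longrightarrow> x = hzero M"
    and "\<And>s. s \<in> hcauchy M \<Longrightarrow> \<exists>l\<in>hcarrier M. hconverges M s l"
  shows "hilbert_module M"
  by (rule hilbert_module.intro) (fact base(1), fact base(2), fact zero_closed, fact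
    add_closed, fact scale_closed, fact act_closed, fact add_assoc, fact
    add_commute, fact add_zero, fact minus_self, fact scale_one, fact scale_scale,
    fact scale_add, fact add_scale, fact act_one, fact act_act, fact act_add, fact
    add_act, fact scale_act, fact act_scale, fact ip_closed, fact ip_add, fact
    ip_scale, fact ip_act, fact ip_cnj, fact ip_nonneg, fact assms(1),
    fact assms(2))

text \<open>The algebraic laws hold term by term on representing sequences; those on inner products
  pass to the pointwise limit.\<close>

lemma pre_hilbert_completion: "pre_hilbert_module Mc"
proof (unfold_locales, unfold completion_base completion_zero)
  show "compact_space (hbase M)" "Hausdorff_space (hbase M)" by (fact base)+
  show "cls (\<lambda>_. hzero M) \<in> hcarrier Mc"
    by (intro cls_carrier cauchy_const zero_closed)
next
  fix x y assume "x \<in> hcarrier Mc" "y \<in> hcarrier Mc"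
  then show "hadd Mc x y \<in> hcarrier Mc"
    by (auto elim!: completion_cases simp: completion_add intro!: cls_carrier cauchy_add)
next
  fix x z assume "x \<in> hcarrier Mc"
  then show "hscale Mc z x \<in> hcarrier Mc"
    by (auto elim!: completion_cases simp: completion_scale intro!: cls_carrier cauchy_scale)
next
  fix x f assume "x \<in> hcarrier Mc" "f \<in> C_of (hbase M)"
  then show "hact Mc x f \<in> hcarrier Mc"
    by (auto elim!: completion_cases simp: completion_act intro!: cls_carrier cauchy_act)
next
  fix x y u assume "x \<in> hcarrier Mc" "y \<in> hcarrier Mc" "u \<in> hcarrier Mc"
  then show "hadd Mc (hadd Mc x y) u = hadd Mc x (hadd Mc y u)"
    by (auto elim!: completion_cases simp: completion_add cauchy_add add_assoc cauchy_carrier)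
next
  fix x y assume "x \<in> hcarrier Mc" "y \<in> hcarrier Mc"
  then show "hadd Mc x y = hadd Mc y x"
    by (auto elim!: completion_cases simp: completion_add add_commute cauchy_carrier)
next
  fix x assume "x \<in> hcarrier Mc"
  then show "hadd Mc x (cls (\<lambda>_. hzero M)) = x"
    by (elim completion_cases) (simp add: completion_add cauchy_const zero_closed add_zero[OF cauchy_carrier])
next
  fix x assume "x \<in> hcarrier Mc"
  then show "hminus Mc x x = cls (\<lambda>_. hzero M)"
    by (elim completion_cases) (simp add: completion_minus minus_self[OF cauchy_carrier])
next
  fix x assume "x \<in> hcarrier Mc"
  then show "hscale Mc 1 x = x"
    by (auto elim!: completion_cases simp: completion_scale scale_one cauchy_carrier)
next
  fix x z z' assume "x \<in> hcarrier Mc"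
  then show "hscale Mc z (hscale Mc z' x) = hscale Mc (z * z') x"
    by (auto elim!: completion_cases simp: completion_scale cauchy_scale scale_scale cauchy_carrier)
next
  fix x y z assume "x \<in> hcarrier Mc" "y \<in> hcarrier Mc"
  then show "hscale Mc z (hadd Mc x y)
      = hadd Mc (hscale Mc z x) (hscale Mc z y)"
    by (auto elim!: completion_cases
        simp: completion_scale completion_add cauchy_scale cauchy_add scale_add cauchy_carrier)
next
  fix x z z' assume "x \<in> hcarrier Mc"
  then show "hscale Mc (z + z') x = hadd Mc (hscale Mc z x) (hscale Mc z' x)"
    by (auto elim!: completion_cases
        simp: completion_scale completion_add cauchy_scale add_scale cauchy_carrier)
next
  fix x assume "x \<in> hcarrier Mc"
  then show "hact Mc x (one_C (hbase M)) = x"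
    by (auto elim!: completion_cases simp: completion_act C_of_one act_one cauchy_carrier)
next
  fix x f g assume "x \<in> hcarrier Mc" "f \<in> C_of (hbase M)" "g \<in> C_of (hbase M)"
  then show "hact Mc (hact Mc x f) g = hact Mc x (\<lambda>c. f c * g c)"
    by (auto elim!: completion_cases simp: completion_act cauchy_act C_of_mult act_act cauchy_carrier)
next
  fix x f g assume "x \<in> hcarrier Mc" "f \<in> C_of (hbase M)" "g \<in> C_of (hbase M)"
  then show "hact Mc x (\<lambda>c. f c + g c) = hadd Mc (hact Mc x f) (hact Mc x g)"
    by (auto elim!: completion_cases
        simp: completion_act completion_add cauchy_act C_of_add act_add cauchy_carrier)
next
  fix x y f assume "x \<in> hcarrier Mc" "y \<in> hcarrier Mc" "f \<in> C_of (hbase M)"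
  then show "hact Mc (hadd Mc x y) f = hadd Mc (hact Mc x f) (hact Mc y f)"
    by (auto elim!: completion_cases
        simp: completion_act completion_add cauchy_act cauchy_add add_act cauchy_carrier)
next
  fix x z f assume "x \<in> hcarrier Mc" "f \<in> C_of (hbase M)"
  then show "hact Mc (hscale Mc z x) f = hscale Mc z (hact Mc x f)"
    by (auto elim!: completion_cases
        simp: completion_act completion_scale cauchy_act cauchy_scale scale_act cauchy_carrier)
next
  fix x z f assume "x \<in> hcarrier Mc" "f \<in> C_of (hbase M)"
  then show "hact Mc x (\<lambda>c. z * f c) = hscale Mc z (hact Mc x f)"
    by (auto elim!: completion_cases
        simp: completion_act completion_scale cauchy_act C_of_scale act_scale cauchy_carrier)
next
  fix x y assume "x \<in> hcarrier Mc" "y \<in> hcarrier Mc"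
  then show "hip Mc x y \<in> C_of (hbase M)"
    by (auto elim!: completion_cases intro: completion_ip_closed)
next
  fix x y u assume "x \<in> hcarrier Mc" "y \<in> hcarrier Mc" "u \<in> hcarrier Mc"
  then obtain x' y' u' where r: "x = cls x'" "y = cls y'" "u = cls u'"
    and m: "x' \<in> hcauchy M" "y' \<in> hcauchy M" "u' \<in> hcauchy M"
    by (auto elim!: completion_cases)
  have "(\<lambda>n. hip M (x' n) (hadd M (y' n) (u' n)) c)
      \<longlonglongrightarrow> hip Mc x y c + hip Mc x u c" for c
    using m tendsto_add[OF completion_ip_limit[OF m(1,2)] completion_ip_limit[OF m(1,3)]]
    by (simp add: r ip_add cauchy_carrier)
  then show "hip Mc x (hadd Mc y u)
      = (\<lambda>c. hip Mc x y c + hip Mc x u c)"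
    using m by (simp add: r completion_add cauchy_add completion_ip_eqI)
next
  fix x y z assume "x \<in> hcarrier Mc" "y \<in> hcarrier Mc"
  then obtain x' y' where r: "x = cls x'" "y = cls y'" and m: "x' \<in> hcauchy M" "y' \<in> hcauchy M"
    by (auto elim!: completion_cases)
  have "(\<lambda>n. hip M (x' n) (hscale M z (y' n)) c) \<longlonglongrightarrow> z * hip Mc x y c" for c
    using m tendsto_mult_left[OF completion_ip_limit[OF m]]
    by (simp add: r ip_scale cauchy_carrier)
  then show "hip Mc x (hscale Mc z y) = (\<lambda>c. z * hip Mc x y c)"
    using m by (simp add: r completion_scale cauchy_scale completion_ip_eqI)
next
  fix x y f assume "x \<in> hcarrier Mc" "y \<in> hcarrier Mc" and f: "f \<in> C_of (hbase M)"
  then obtain x' y' where r: "x = cls x'" "y = cls y'" and m: "x' \<in> hcauchy M" "y' \<in> hcauchy M"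
    by (auto elim!: completion_cases)
  have "(\<lambda>n. hip M (x' n) (hact M (y' n) f) c) \<longlonglongrightarrow> hip Mc x y c * f c" for c
    using m f tendsto_mult_right[OF completion_ip_limit[OF m]]
    by (simp add: r ip_act cauchy_carrier)
  then show "hip Mc x (hact Mc y f) = (\<lambda>c. hip Mc x y c * f c)"
    using m f by (simp add: r completion_act cauchy_act completion_ip_eqI)
next
  fix x y assume "x \<in> hcarrier Mc" "y \<in> hcarrier Mc"
  then obtain x' y' where r: "x = cls x'" "y = cls y'" and m: "x' \<in> hcauchy M" "y' \<in> hcauchy M"
    by (auto elim!: completion_cases)
  have "(\<lambda>n. hip M (y' n) (x' n) c) \<longlonglongrightarrow> cnj (hip Mc x y c)" for c
    using tendsto_cnj[OF completion_ip_limit[OF m]] ip_cnj[of "x' _" "y' _"] m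
    by (simp add: r cauchy_carrier)
  then show "hip Mc y x = (\<lambda>c. cnj (hip Mc x y c))"
    using m by (simp add: r completion_ip_eqI)
next
  fix x c assume "x \<in> hcarrier Mc"
  then obtain x' where r: "x = cls x'" and m: "x' \<in> hcauchy M"
    by (auto elim!: completion_cases)
  show "hip Mc x x c \<in> \<real>\<^sub>\<ge>\<^sub>0"
    unfolding r
    by (rule closed_sequentially[OF closed_nonneg_Reals_complex _ completion_ip_limit[OF m m]])
      (intro ip_nonneg cauchy_carrier m)
qed

lemma to_completion_closed: "x \<in> hcarrier M \<Longrightarrow> to_completion M x \<in> hcarrier Mc"
  by (simp add: to_completion_def cls_carrier cauchy_const)

lemma to_completion_zero: "to_completion M (hzero M) = hzero Mc"
  by (simp add: to_completion_def completion_zero)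

lemma to_completion_add: "\<lbrakk>x \<in> hcarrier M; y \<in> hcarrier M\<rbrakk>
    \<Longrightarrow> hadd Mc (to_completion M x) (to_completion M y) = to_completion M (hadd M x y)"
  by (simp add: to_completion_def completion_add cauchy_const)

lemma to_completion_scale: "x \<in> hcarrier M
    \<Longrightarrow> hscale Mc z (to_completion M x) = to_completion M (hscale M z x)"
  by (simp add: to_completion_def completion_scale cauchy_const)

lemma to_completion_act: "\<lbrakk>x \<in> hcarrier M; f \<in> C_of (hbase M)\<rbrakk>
    \<Longrightarrow> hact Mc (to_completion M x) f = to_completion M (hact M x f)"
  by (simp add: to_completion_def completion_act cauchy_const)

lemma to_completion_minus: "\<lbrakk>x \<in> hcarrier M; y \<in> hcarrier M\<rbrakk>
    \<Longrightarrow> hminus Mc (to_completion M x) (to_completion M y) = to_completion M (hminus M x y)"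
  by (simp add: to_completion_def completion_minus cauchy_const)

lemma to_completion_ip: "\<lbrakk>x \<in> hcarrier M; y \<in> hcarrier M\<rbrakk>
    \<Longrightarrow> hip Mc (to_completion M x) (to_completion M y) = hip M x y"
  unfolding to_completion_def by (intro completion_ip_eqI cauchy_const tendsto_const)

lemma to_completion_norm: "x \<in> hcarrier M \<Longrightarrow> hnorm Mc (to_completion M x) = hnorm M x"
  by (simp add: hnorm_def to_completion_ip completion_base)

text \<open>The class minus the constant class of x i is the class of n \<mapsto> x n - x i. Its
  squared length at c is the limit of those of the terms, which are at most \<epsilon>^2 from N
  on.\<close>

lemma cls_approx:
  assumes x: "x \<in> hcauchy M" and "\<epsilon> > 0"
  obtains N where "\<And>i. i \<ge> N \<Longrightarrow> hdist Mc (cls x) (to_completion M (x i)) \<le> \<epsilon>"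
proof -
  interpret C: pre_hilbert_module "Mc" by (rule pre_hilbert_completion)
  obtain N where N: "\<And>i j. i \<ge> N \<Longrightarrow> j \<ge> N \<Longrightarrow> hdist M (x i) (x j) < \<epsilon>"
    using cauchyD[OF assms] by blast
  have "hdist Mc (cls x) (to_completion M (x i)) \<le> \<epsilon>" if i: "i \<ge> N" for i
  proof (rule C.hnorm_le)
    fix c
    let ?y = "\<lambda>n. hminus M (x n) (x i)"
    have y: "?y \<in> hcauchy M"
      using x by (intro cauchy_minus cauchy_const cauchy_carrier)
    have eq: "hminus Mc (cls x) (to_completion M (x i)) = cls ?y"
      unfolding to_completion_def using x by (simp add: completion_minus cauchy_const[OF cauchy_carrier])
    show "cmod (hip Mc (hminus Mc (cls x) (to_completion M (x i)))
        (hminus Mc (cls x) (to_completion M (x i))) c) \<le> \<epsilon>\<^sup>2"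
      unfolding eq
    proof (rule Lim_bounded)
      show "(\<lambda>n. cmod (hip M (?y n) (?y n) c)) \<longlonglongrightarrow> cmod (hip Mc (cls ?y) (cls ?y) c)"
        by (intro tendsto_norm completion_ip_limit y)
      show "\<forall>n\<ge>N. cmod (hip M (?y n) (?y n) c) \<le> \<epsilon>\<^sup>2"
      proof (intro allI impI)
        fix n assume n: "n \<ge> N"
        have "cmod (hip M (?y n) (?y n) c) \<le> (hnorm M (?y n))\<^sup>2"
          by (intro ip_le_hnorm_sq cauchy_carrier[OF y])
        also have "\<dots> \<le> \<epsilon>\<^sup>2"
          using N[OF n i] hnorm_nonneg[OF cauchy_carrier[OF y]] by (intro power_mono) auto
        finally show "cmod (hip M (?y n) (?y n) c) \<le> \<epsilon>\<^sup>2" .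
      qed
    qed
  qed (use \<open>\<epsilon> > 0\<close> in simp)
  then show thesis using that by blast
qed

lemma completion_approx:
  assumes "p \<in> hcarrier Mc" "\<epsilon> > 0"
  obtains x where "x \<in> hcarrier M" "hdist Mc p (to_completion M x) \<le> \<epsilon>"
proof -
  obtain x where x: "x \<in> hcauchy M" "p = cls x" using assms(1) by (rule completion_cases)
  obtain N where N: "\<And>i. i \<ge> N \<Longrightarrow> hdist Mc (cls x) (to_completion M (x i)) \<le> \<epsilon>"
    using cls_approx[OF x(1) assms(2)] by blast
  show thesis
    by (rule that[OF cauchy_carrier[OF x(1), of N]]) (use N[of N] x(2) in simp)
qed

text \<open>The inner products <x_i, x_i> converge to 0 uniformly on the base, so the norms of the
  terms tend to 0 and the representing sequence is null.\<close>

lemma completion_definite: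
  assumes "p \<in> hcarrier Mc" "hip Mc p p = (\<lambda>_. 0)"
  shows "p = hzero Mc"
proof -
  obtain x where x: "x \<in> hcauchy M" "p = cls x" using assms(1) by (rule completion_cases)
  have "(\<lambda>n. hdist M (x n) (hzero M)) \<longlonglongrightarrow> 0"
    unfolding LIMSEQ_iff
  proof (intro allI impI)
    fix r :: real assume r: "r > 0"
    \<comment> \<open>\<open>hnorm_le\<close> compares with a square; the half leaves room for the
      strict inequality.\<close>
    then have r2: "(r / 2)\<^sup>2 > 0" by simp
    obtain N where N: "\<And>i c. i \<ge> N \<Longrightarrow> cmod (hip M (x i) (x i) c - hip Mc (cls x) (cls x) c) \<le> (r / 2)\<^sup>2"
      using completion_ip_uniform[OF x(1) x(1) r2] by blast
    have "norm (hdist M (x n) (hzero M) - 0) < r" if "n \<ge> N" for n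
    proof -
      have "hdist M (x n) (hzero M) = hnorm M (x n)"
        using x(1) by (intro hnorm_cong) (simp add: ip_expand closed cauchy_carrier ip_zero ip_zero_left)
      also have "\<dots> \<le> r / 2"
        using N[OF that] r assms(2) x(2) by (intro hnorm_le) auto
      finally show ?thesis
        using r hnorm_nonneg[of "hminus M (x n) (hzero M)"] x(1) by (simp add: closed cauchy_carrier)
    qed
    then show "\<exists>N. \<forall>n\<ge>N. norm (hdist M (x n) (hzero M) - 0) < r" by blast
  qed
  then have "(x, \<lambda>_. hzero M) \<in> null_rel M"
    using x(1) cauchy_const[OF zero_closed] by (simp add: null_rel_def)
  then show ?thesis
    using x cauchy_const[OF zero_closed] by (simp add: completion_zero cls_eq_iff)
qed

text \<open>Approximating the n-th class within 1/(n+1) by a single vector turns a Cauchy sequence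
  of classes into a Cauchy sequence of vectors, whose class is the limit.\<close>

theorem hilbert_completion: "hilbert_module Mc"
proof -
  interpret C: pre_hilbert_module "Mc" by (rule pre_hilbert_completion)
  let ?d = "\<lambda>p q. hdist Mc p q"
  have complete: "\<exists>l\<in>hcarrier Mc. hconverges Mc s l"
    if s: "s \<in> hcauchy Mc" for s
  proof -
    have "\<exists>x. x \<in> hcarrier M \<and> ?d (s n) (to_completion M x) \<le> inverse (real (Suc n))" for n
      using completion_approx[OF C.cauchy_carrier[OF s], of "inverse (real (Suc n))"] by auto
    then obtain x where x: "\<And>n. x n \<in> hcarrier M"
      and d: "\<And>n. ?d (s n) (to_completion M (x n)) \<le> inverse (real (Suc n))"
      by metis
    have tx: "to_completion M (x n) \<in> hcarrier Mc" for n
      by (intro to_completion_closed x)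
    have sc: "s n \<in> hcarrier Mc" for n by (rule C.cauchy_carrier[OF s])
    have xc: "x \<in> hcauchy M"
      unfolding hcauchy_def mem_Collect_eq
    proof (intro conjI allI impI x)
      fix \<epsilon> :: real assume "\<epsilon> > 0"
      then have e: "\<epsilon> / 3 > 0" by simp
      obtain N where N: "\<And>i j. i \<ge> N \<Longrightarrow> j \<ge> N \<Longrightarrow> ?d (s i) (s j) < \<epsilon> / 3"
        using C.cauchyD[OF s e] by blast
      obtain N' where N': "inverse (real (Suc N')) < \<epsilon> / 3" using reals_Archimedean[OF e] by blast
      have small: "?d (s i) (to_completion M (x i)) < \<epsilon> / 3" if "i \<ge> N'" for i
      proof -
        have "inverse (real (Suc i)) \<le> inverse (real (Suc N'))" using that by simp
        then show ?thesis using d[of i] N' by linarith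
      qed
      show "\<exists>N. \<forall>i\<ge>N. \<forall>j\<ge>N. hdist M (x i) (x j) < \<epsilon>"
      proof (intro exI allI impI)
        fix i j assume ij: "i \<ge> max N N'" "j \<ge> max N N'"
        have "hdist M (x i) (x j) = ?d (to_completion M (x i)) (to_completion M (x j))"
          using x by (simp add: to_completion_minus to_completion_norm closed)
        also have "\<dots> \<le> ?d (to_completion M (x i)) (s i) + ?d (s i) (to_completion M (x j))"
          by (intro C.hdist_triangle tx sc)
        also have "\<dots> \<le> ?d (s i) (to_completion M (x i)) + (?d (s i) (s j) + ?d (s j) (to_completion M (x j)))"
          using C.hdist_triangle[OF sc sc tx, of i j j] C.hdist_sym[OF tx sc, of i i] by linarith
        also have "\<dots> < \<epsilon>"
          using small[of i] small[of j] N[of i j] ij by simp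
        finally show "hdist M (x i) (x j) < \<epsilon>" .
      qed
    qed
    have cl: "cls x \<in> hcarrier Mc" by (rule cls_carrier[OF xc])
    have "(\<lambda>n. ?d (s n) (cls x)) \<longlonglongrightarrow> 0"
      unfolding LIMSEQ_iff
    proof (intro allI impI)
      fix r :: real assume "r > 0"
      then have r: "r / 3 > 0" by simp
      obtain N where N: "\<And>i. i \<ge> N \<Longrightarrow> ?d (cls x) (to_completion M (x i)) \<le> r / 3"
        using cls_approx[OF xc r] by blast
      obtain N' where N': "inverse (real (Suc N')) < r / 3" using reals_Archimedean[OF r] by blast
      have "norm (?d (s n) (cls x) - 0) < r" if n: "n \<ge> max N N'" for n
      proof -
        have "inverse (real (Suc n)) \<le> inverse (real (Suc N'))" using n by simp
        then have "?d (s n) (to_completion M (x n)) < r / 3" using d[of n] N' by linarith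
        moreover have "?d (to_completion M (x n)) (cls x) \<le> r / 3"
          using N[of n] n C.hdist_sym[OF cl tx, of n] by simp
        ultimately have "?d (s n) (cls x) < r"
          using C.hdist_triangle[OF sc tx cl, of n n] \<open>r > 0\<close> by linarith
        then show ?thesis using C.hdist_nonneg[OF sc cl, of n] by simp
      qed
      then show "\<exists>N. \<forall>n\<ge>N. norm (?d (s n) (cls x) - 0) < r" by blast
    qed
    then show ?thesis using cl by (auto simp: hconverges_def)
  qed
  show ?thesis
    by (rule C.hilbert_moduleI[OF completion_definite complete])
qed

end

sublocale hilbert_module \<subseteq> pre_hilbert_module
  by (rule pre_hilbert_module.intro) (fact base(1), fact base(2), fact zero_closed, fact
    add_closed, fact scale_closed, fact act_closed, fact add_assoc, fact add_commute, fact
    add_zero, fact minus_self, fact scale_one, fact scale_scale, fact scale_add, fact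
    add_scale, fact act_one, fact act_act, fact act_add, fact add_act, fact scale_act, fact
    act_scale, fact ip_closed, fact ip_add, fact ip_scale, fact ip_act, fact ip_cnj, fact
    ip_nonneg)

subsection \<open>Isometries with dense range\<close>

text \<open>The setting in which a module map extends to an isomorphism of completions. Metric
  notions on the domain are read off the codomain through \<open>U\<close>, so the domain may carry
  operations on chosen representatives, as the algebraic limit does, while the codomain is a genuine
  pre-Hilbert module.\<close>

locale dense_isometry = N: pre_hilbert_module N
  for M :: "('x, 'm, 'y) hmod_scheme" and N :: "('x, 'n, 'z) hmod_scheme" +
  fixes U :: "'m \<Rightarrow> 'n"
  assumes base_eq: "hbase M = hbase N"
    and M_add_closed: "\<lbrakk>x \<in> hcarrier M; y \<in> hcarrier M\<rbrakk> \<Longrightarrow> hadd M x y \<in> hcarrier M"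
    and M_scale_closed: "x \<in> hcarrier M \<Longrightarrow> hscale M z x \<in> hcarrier M"
    and M_act_closed: "\<lbrakk>x \<in> hcarrier M; f \<in> C_of (hbase N)\<rbrakk> \<Longrightarrow> hact M x f \<in> hcarrier M"
    and U_closed: "x \<in> hcarrier M \<Longrightarrow> U x \<in> hcarrier N"
    and U_add: "\<lbrakk>x \<in> hcarrier M; y \<in> hcarrier M\<rbrakk> \<Longrightarrow> U (hadd M x y) = hadd N (U x) (U y)"
    and U_scale: "x \<in> hcarrier M \<Longrightarrow> U (hscale M z x) = hscale N z (U x)"
    and U_act: "\<lbrakk>x \<in> hcarrier M; f \<in> C_of (hbase N)\<rbrakk> \<Longrightarrow> U (hact M x f) = hact N (U x) f"
    and U_ip: "\<lbrakk>x \<in> hcarrier M; y \<in> hcarrier M\<rbrakk> \<Longrightarrow> hip M x y = hip N (U x) (U y)"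
    and U_dense: "\<lbrakk>v \<in> hcarrier N; \<epsilon> > 0\<rbrakk> \<Longrightarrow> \<exists>x\<in>hcarrier M. hdist N v (U x) < \<epsilon>"
begin

lemma M_minus: "\<lbrakk>x \<in> hcarrier M; y \<in> hcarrier M\<rbrakk> \<Longrightarrow> hminus M x y \<in> hcarrier M"
  by (simp add: hminus_def M_add_closed M_scale_closed)

lemma U_minus: "\<lbrakk>x \<in> hcarrier M; y \<in> hcarrier M\<rbrakk> \<Longrightarrow> U (hminus M x y) = hminus N (U x) (U y)"
  by (simp add: hminus_def M_scale_closed U_add U_scale)

lemma U_dist: "\<lbrakk>x \<in> hcarrier M; y \<in> hcarrier M\<rbrakk>
    \<Longrightarrow> hdist M x y = hdist N (U x) (U y)"
  by (simp add: hnorm_def U_ip M_minus U_minus base_eq)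

lemma M_cauchy: "x \<in> hcauchy M \<longleftrightarrow> (\<forall>n. x n \<in> hcarrier M) \<and> (\<lambda>n. U (x n)) \<in> hcauchy N"
  unfolding hcauchy_def by (simp add: U_dist U_closed cong: conj_cong)

lemma M_null_rel: "(x, y) \<in> null_rel M \<longleftrightarrow>
    x \<in> hcauchy M \<and> y \<in> hcauchy M \<and> (\<lambda>n. U (x n), \<lambda>n. U (y n)) \<in> null_rel N"
  unfolding null_rel_def by (simp add: M_cauchy U_dist cong: conj_cong)

lemma M_equiv: "equiv (hcauchy M) (null_rel M)"
proof -
  have e: "sym (null_rel N)" "trans (null_rel N)" "refl_on (hcauchy N) (null_rel N)"
    using N.equiv_null_rel by (auto simp: equiv_def)
  show ?thesis
  proof (rule equivI)
    show "null_rel M \<subseteq> hcauchy M \<times> hcauchy M" by (auto simp: null_rel_def)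
    show "refl_on (hcauchy M) (null_rel M)"
      using e(3) by (auto simp: refl_on_def M_null_rel M_cauchy)
    show "sym (null_rel M)"
      using e(1) by (auto simp: sym_def M_null_rel)
    show "trans (null_rel M)"
      using e(2) unfolding trans_def M_null_rel by blast
  qed
qed

text \<open>\<open>U\<close> is applied term by term to the chosen representative;
  \<open>extension_cls\<close> frees the result from that choice.\<close>

definition extension :: "(nat \<Rightarrow> 'm) set \<Rightarrow> (nat \<Rightarrow> 'n) set" where
  "extension p = N.cls (\<lambda>n. U (rep p n))"

abbreviation Mcls :: "(nat \<Rightarrow> 'm) \<Rightarrow> (nat \<Rightarrow> 'm) set" where
  "Mcls x \<equiv> null_rel M `` {x}"

lemma M_rep: assumes "x \<in> hcauchy M" shows "(x, rep (Mcls x)) \<in> null_rel M"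
proof -
  have "x \<in> Mcls x" using equiv_class_self[OF M_equiv assms] .
  then have "rep (Mcls x) \<in> Mcls x"
    unfolding rep_def by (metis someI)
  then show ?thesis by simp
qed

lemma M_cases:
  assumes "p \<in> hcarrier (completion M)"
  obtains x where "x \<in> hcauchy M" "p = Mcls x"
  using assms by (auto simp: completion_def elim: quotientE)

lemma M_rep_carrier:
  assumes "p \<in> hcarrier (completion M)"
  shows "rep p \<in> hcauchy M" "Mcls (rep p) = p"
proof -
  obtain x where x: "x \<in> hcauchy M" "p = Mcls x" using assms by (rule M_cases)
  show "rep p \<in> hcauchy M" using M_rep[OF x(1)] x(2) by (simp add: M_null_rel)
  show "Mcls (rep p) = p" using M_rep[OF x(1)] x(2) equiv_class_eq[OF M_equiv] by metis
qed

lemma U_cauchy: "x \<in> hcauchy M \<Longrightarrow> (\<lambda>n. U (x n)) \<in> hcauchy N"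
  by (simp add: M_cauchy)

lemma M_carrier: "x \<in> hcauchy M \<Longrightarrow> x n \<in> hcarrier M"
  by (simp add: hcauchy_def)

lemma extension_cls:
  assumes "x \<in> hcauchy M"
  shows "extension (Mcls x) = N.cls (\<lambda>n. U (x n))"
proof -
  have "(\<lambda>n. U (x n), \<lambda>n. U (rep (Mcls x) n)) \<in> null_rel N"
    using M_rep[OF assms] by (simp add: M_null_rel)
  then show ?thesis
    unfolding extension_def by (rule equiv_class_eq[OF N.equiv_null_rel, symmetric])
qed

lemma extension_to_completion:
  assumes "x \<in> hcarrier M"
  shows "extension (to_completion M x) = to_completion N (U x)"
proof -
  have "(\<lambda>_. x) \<in> hcauchy M"
    using assms by (simp add: M_cauchy N.cauchy_const U_closed)
  then show ?thesis by (simp add: to_completion_def extension_cls)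
qed

lemma extension_iso: "hilbert_iso (completion M) (completion N) extension"
proof -
  let ?C = "hcarrier (completion M)"
  have clsM: "hcarrier (completion M) = hcauchy M // null_rel M" by (simp add: completion_def)
  have closed: "extension p \<in> hcarrier (completion N)" if "p \<in> ?C" for p
    unfolding extension_def using M_rep_carrier(1)[OF that] by (intro N.cls_carrier U_cauchy)
  have inj: "inj_on extension ?C"
  proof (rule inj_onI)
    fix p q assume pq: "p \<in> ?C" "q \<in> ?C" "extension p = extension q"
    then have "(rep p, rep q) \<in> null_rel M"
      using M_rep_carrier(1) by (simp add: extension_def M_null_rel N.cls_eq_iff U_cauchy)
    then have "Mcls (rep p) = Mcls (rep q)"
      by (rule equiv_class_eq[OF M_equiv])
    then show "p = q" using M_rep_carrier(2) pq by simp
  qed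
  \<comment> \<open>The terms of a Cauchy sequence y are approximated within 1/(n+1) by
    \<open>U (x n)\<close>. The new sequence is equivalent to y and Cauchy, and isometry carries the
    Cauchy property back to x.\<close>
  have surj: "\<exists>p\<in>?C. extension p = q" if q: "q \<in> hcarrier (completion N)" for q
  proof -
    obtain y where y: "y \<in> hcauchy N" "q = N.cls y" using q by (rule N.completion_cases)
    have "\<exists>x\<in>hcarrier M. hdist N (y n) (U x) < inverse (real (Suc n))" for n
      using y(1) by (intro U_dense N.cauchy_carrier) auto
    then obtain x where x: "\<And>n. x n \<in> hcarrier M"
      and d: "\<And>n. hdist N (y n) (U (x n)) < inverse (real (Suc n))"
      by metis
    have lim: "(\<lambda>n. hdist N (y n) (U (x n))) \<longlonglongrightarrow> 0"
    proof (rule real_tendsto_sandwich[OF always_eventually always_eventually tendsto_const LIMSEQ_inverse_real_of_nat])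
      show "\<forall>n. 0 \<le> hdist N (y n) (U (x n))"
        using x y by (simp add: N.hdist_nonneg N.cauchy_carrier U_closed)
      show "\<forall>n. hdist N (y n) (U (x n)) \<le> inverse (real (Suc n))"
        using d less_imp_le by blast
    qed
    have Uc: "(\<lambda>n. U (x n)) \<in> hcauchy N"
      unfolding hcauchy_def mem_Collect_eq
    proof (intro conjI allI impI)
      fix \<epsilon> :: real assume "\<epsilon> > 0"
      then have e: "\<epsilon> / 3 > 0" by simp
      obtain K where K: "\<And>i j. i \<ge> K \<Longrightarrow> j \<ge> K \<Longrightarrow> hdist N (y i) (y j) < \<epsilon> / 3"
        using N.cauchyD[OF y(1) e] by blast
      obtain K' where K': "inverse (real (Suc K')) < \<epsilon> / 3" using reals_Archimedean[OF e] by blast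
      have small: "hdist N (y i) (U (x i)) < \<epsilon> / 3" if "i \<ge> K'" for i
      proof -
        have "inverse (real (Suc i)) \<le> inverse (real (Suc K'))" using that by simp
        then show ?thesis using d[of i] K' by linarith
      qed
      show "\<exists>K. \<forall>i\<ge>K. \<forall>j\<ge>K. hdist N (U (x i)) (U (x j)) < \<epsilon>"
      proof (intro exI allI impI)
        fix i j assume ij: "i \<ge> max K K'" "j \<ge> max K K'"
        have u: "U (x n) \<in> hcarrier N" and v: "y n \<in> hcarrier N" for n
          using x y by (simp_all add: U_closed N.cauchy_carrier)
        show "hdist N (U (x i)) (U (x j)) < \<epsilon>"
          using N.hdist_triangle[OF u v u, of i j i] N.hdist_triangle[OF v v u, of i j j]
            N.hdist_sym[OF u v, of i i] small[of i] small[of j] K[of i j] ij by simp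
      qed
    qed (use x in \<open>simp add: U_closed\<close>)
    have xc: "x \<in> hcauchy M" using x Uc by (simp add: M_cauchy)
    have "(y, \<lambda>n. U (x n)) \<in> null_rel N" using y(1) Uc lim by (simp add: null_rel_def)
    then have "extension (Mcls x) = q"
      unfolding extension_cls[OF xc] y(2) by (rule equiv_class_eq[OF N.equiv_null_rel, symmetric])
    moreover have "Mcls x \<in> ?C" using xc by (simp add: clsM quotientI)
    ultimately show ?thesis by blast
  qed
  have bij: "bij_betw extension ?C (hcarrier (completion N))"
    unfolding bij_betw_def using inj closed surj by blast
  have r: "rep p \<in> hcauchy M" if "p \<in> ?C" for p by (rule M_rep_carrier(1)[OF that])
  have add: "extension (hadd (completion M) p q) = hadd (completion N) (extension p) (extension q)"
    if "p \<in> ?C" "q \<in> ?C" for p q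
  proof -
    have c: "(\<lambda>n. hadd M (rep p n) (rep q n)) \<in> hcauchy M"
      using r[OF that(1)] r[OF that(2)] N.cauchy_add[OF U_cauchy U_cauchy]
      by (simp add: M_cauchy[of "\<lambda>n. hadd M (rep p n) (rep q n)"] M_carrier M_add_closed U_add)
    have "extension (hadd (completion M) p q) = extension (Mcls (\<lambda>n. hadd M (rep p n) (rep q n)))"
      by (simp add: completion_def)
    also have "\<dots> = N.cls (\<lambda>n. hadd N (U (rep p n)) (U (rep q n)))"
      using r[OF that(1)] r[OF that(2)] by (simp add: extension_cls c U_add M_carrier)
    finally show ?thesis
      using r[OF that(1)] r[OF that(2)] by (simp add: extension_def N.completion_add U_cauchy)
  qed
  have scale: "extension (hscale (completion M) z p) = hscale (completion N) z (extension p)"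
    if "p \<in> ?C" for p z
  proof -
    have c: "(\<lambda>n. hscale M z (rep p n)) \<in> hcauchy M"
      using r[OF that] N.cauchy_scale[OF U_cauchy]
      by (simp add: M_cauchy[of "\<lambda>n. hscale M z (rep p n)"] M_carrier M_scale_closed U_scale)
    have "extension (hscale (completion M) z p) = extension (Mcls (\<lambda>n. hscale M z (rep p n)))"
      by (simp add: completion_def)
    also have "\<dots> = N.cls (\<lambda>n. hscale N z (U (rep p n)))"
      using r[OF that] by (simp add: extension_cls c U_scale M_carrier)
    finally show ?thesis
      using r[OF that] by (simp add: extension_def N.completion_scale U_cauchy)
  qed
  have act: "extension (hact (completion M) p f) = hact (completion N) (extension p) f"
    if "p \<in> ?C" and f: "f \<in> C_of (hbase N)" for p f
  proof -
    have c: "(\<lambda>n. hact M (rep p n) f) \<in> hcauchy M"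
      using r[OF that(1)] N.cauchy_act[OF U_cauchy f]
      by (simp add: M_cauchy[of "\<lambda>n. hact M (rep p n) f"] M_carrier M_act_closed U_act f)
    have "extension (hact (completion M) p f) = extension (Mcls (\<lambda>n. hact M (rep p n) f))"
      by (simp add: completion_def)
    also have "\<dots> = N.cls (\<lambda>n. hact N (U (rep p n)) f)"
      using r[OF that(1)] by (simp add: extension_cls c U_act M_carrier f)
    finally show ?thesis
      using r[OF that(1)] f by (simp add: extension_def N.completion_act U_cauchy)
  qed
  have ip: "hip (completion N) (extension p) (extension q) = hip (completion M) p q"
    if "p \<in> ?C" "q \<in> ?C" for p q
  proof
    fix c
    have l: "(\<lambda>n. hip M (rep p n) (rep q n) c) \<longlonglongrightarrow> hip (completion N) (extension p) (extension q) c"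
      using N.completion_ip_limit[OF U_cauchy[OF r[OF that(1)]] U_cauchy[OF r[OF that(2)]], of c]
        r[OF that(1)] r[OF that(2)] by (simp add: extension_def U_ip M_carrier)
    show "hip (completion N) (extension p) (extension q) c = hip (completion M) p q c"
    proof (cases "c \<in> topspace (hbase M)")
      case True
      then show ?thesis using limI[OF l] by (simp add: completion_def)
    next
      \<comment> \<open>Off the base the left side vanishes as an element of
        C(\<open>hbase N\<close>), the right side by the definition of the completion.\<close>
      case False
      then have "hip (completion N) (extension p) (extension q) c = 0"
        using N.completion_ip_closed[OF U_cauchy[OF r[OF that(1)]] U_cauchy[OF r[OF that(2)]]]
        by (simp add: extension_def base_eq C_of_outside)
      then show ?thesis using False by (simp add: completion_def)
    qed
  qed
  show ?thesis
    unfolding hilbert_iso_def linear_iso_def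
    using bij add scale act ip by (simp add: completion_def base_eq)
qed

end

subsection \<open>Complemented submodules\<close>

context hilbert_module
begin

lemma definiteI: "x \<in> hcarrier M \<Longrightarrow> (\<And>c. hip M x x c = 0) \<Longrightarrow> x = hzero M"
  by (rule ip_definite) auto

text \<open>Definiteness turned into a method: an equation in a Hilbert module is checked by
  computing that the difference has length zero.\<close>

lemma eqI_minus:
  assumes "x \<in> hcarrier M" "y \<in> hcarrier M" "hip M (hminus M x y) (hminus M x y) = (\<lambda>_. 0)"
  shows "x = y"
proof -
  have "hminus M x y = hzero M" using assms by (intro ip_definite closed)
  then have "hadd M (hminus M x y) y = y"
    using assms by (simp add: add_commute[of "hzero M"] closed add_zero)
  moreover have "hadd M (hminus M x y) y = x"
  proof -
    have "hadd M (hscale M (-1) y) y = hzero M"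
      using assms minus_self[of y] add_commute[of "hscale M (-1) y" y] by (simp add: hminus_def closed)
    then show ?thesis
      using assms add_assoc[of x "hscale M (-1) y" y] by (simp add: hminus_def closed add_zero)
  qed
  ultimately show ?thesis by simp
qed

text \<open>The decomposition of every vector carries the whole content; closedness of N and the
  isometric bijection follow from it. The ambient S is a parameter so that the lemma serves both for
  the full module and for a single V_(k+1).\<close>

lemma complementedI:
  assumes S: "S \<subseteq> hcarrier M"
      "\<And>x y. x \<in> S \<Longrightarrow> y \<in> S \<Longrightarrow> hadd M x y \<in> S" "\<And>z x. x \<in> S \<Longrightarrow> hscale M z x \<in> S"
    and N: "N \<subseteq> S" "hzero M \<in> N" "\<And>x y. x \<in> N \<Longrightarrow> y \<in> N \<Longrightarrow> hadd M x y \<in> N"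
      "\<And>z x. x \<in> N \<Longrightarrow> hscale M z x \<in> N"
      "\<And>x a. x \<in> N \<Longrightarrow> a \<in> C_of (hbase M) \<Longrightarrow> hact M x a \<in> N"
    and split: "\<And>x. x \<in> S \<Longrightarrow> \<exists>p\<in>N. \<exists>q\<in>orth_compl M N. x = hadd M p q"
  shows "complemented (hsubmod M S) N"
proof -
  have NM: "x \<in> hcarrier M" if "x \<in> N" for x using that S(1) N(1) by blast
  have orth: "orth_compl (hsubmod M S) N = orth_compl M N \<inter> S"
    using S(1) by (auto simp: orth_compl_def hsubmod_def)
  have oM: "q \<in> hcarrier M" and o0: "y \<in> N \<Longrightarrow> hip M q y = (\<lambda>_. 0)" if "q \<in> orth_compl M N" for q y
    using that by (auto simp: orth_compl_def)
  have o0': "hip M y q = (\<lambda>_. 0)" if "q \<in> orth_compl M N" "y \<in> N" for q y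
    using o0[OF that] ip_cnj[OF oM[OF that(1)] NM[OF that(2)]] by simp
  have hm: "hminus (hsubmod M S) = hminus M" "hnorm (hsubmod M S) = hnorm M"
    by (auto simp: hminus_def hsubmod_def hnorm_def fun_eq_iff)
  \<comment> \<open>Closedness from the splitting: if l = p + q is the limit of x n in N, then <x n
    - l, q> = -<q, q> by orthogonality. The left side tends to 0, hence q = 0 and l = p.\<close>
  have cl: "l \<in> N" if x: "\<And>n. x n \<in> N" and l: "l \<in> S" and lim: "(\<lambda>n. hdist M (x n) l) \<longlonglongrightarrow> 0" for x l
  proof -
    obtain p q where pq: "p \<in> N" "q \<in> orth_compl M N" "l = hadd M p q" using split[OF l] by blast
    have lM: "l \<in> hcarrier M" and qM: "q \<in> hcarrier M" and pM: "p \<in> hcarrier M"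
      using l S(1) oM[OF pq(2)] NM[OF pq(1)] by auto
    have "hip M q q c = 0" for c
    proof -
      have *: "hip M (hminus M (x n) l) q c = - hip M q q c" for n
        using x[of n] NM pq lM qM pM o0'[OF pq(2)] by (simp add: ip_minus_left ip_add_left pq(3))
      have "cmod (hip M q q c) \<le> hdist M (x n) l * hnorm M q" for n
        using ip_le_hnorm[of "hminus M (x n) l" q c] x[of n] NM lM qM by (simp add: * closed)
      moreover have "(\<lambda>n. hdist M (x n) l * hnorm M q) \<longlonglongrightarrow> 0"
        using tendsto_mult_right[OF lim, of "hnorm M q"] by simp
      ultimately have "cmod (hip M q q c) \<le> 0"
        by (intro LIMSEQ_le_const) auto
      then show ?thesis by simp
    qed
    then have "q = hzero M" by (rule definiteI[OF qM])
    then show ?thesis using pq NM by (simp add: add_zero)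
  qed
  have closedN: "closed_submodule (hsubmod M S) N"
    unfolding closed_submodule_def hconverges_def hm
    using N cl by (simp add: hsubmod_def) blast
  let ?H = "hsum (hsubmod (hsubmod M S) N) (hsubmod (hsubmod M S) (orth_compl M N \<inter> S))"
  have inj: "inj_on (\<lambda>(p, n). hadd M p n) (N \<times> (orth_compl M N \<inter> S))"
  proof (rule inj_onI, clarify)
    fix p q p' q' assume pq: "p \<in> N" "q \<in> orth_compl M N" "p' \<in> N" "q' \<in> orth_compl M N"
      and eq: "hadd M p q = hadd M p' q'"
    note m = NM[OF pq(1)] oM[OF pq(2)] NM[OF pq(3)] oM[OF pq(4)]
    have h: "hip M u p c + hip M u q c = hip M u p' c + hip M u q' c" if "u \<in> hcarrier M" for u c
      using arg_cong[OF eq, of "\<lambda>x. hip M u x c"] m that by (simp add: ip_add)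
    \<comment> \<open>p - p' lies in N and is orthogonal to N, hence to itself.\<close>
    have "hip M u (hminus M p p') c = 0" if "u \<in> N" for u c
      using h[OF NM[OF that], of c] that pq m NM by (simp add: ip_minus o0')
    moreover have "hminus M p p' \<in> N" using pq N by (simp add: hminus_def)
    ultimately have p: "p = p'" using m by (intro eqI_minus) auto
    have "hip M u (hminus M q q') c = 0" if "u \<in> hcarrier M" for u c
      using h[OF that, of c] that m by (simp add: ip_minus p)
    then have "q = q'" using m by (intro eqI_minus) (auto simp: closed)
    with p show "p = p' \<and> q = q'" by simp
  qed
  have surj: "\<exists>p\<in>N. \<exists>q\<in>orth_compl M N \<inter> S. x = hadd M p q" if xS: "x \<in> S" for x
  proof -
    obtain p q where pq: "p \<in> N" "q \<in> orth_compl M N" "x = hadd M p q" using split[OF xS] by blast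
    have m: "p \<in> hcarrier M" "q \<in> hcarrier M" using NM oM pq by auto
    \<comment> \<open>q = x - p stays in S because p lies in N, which is contained in S.\<close>
    have "q = hminus M x p"
      using m by (intro eqI_minus) (auto simp: closed pq(3) ip_expand fun_eq_iff)
    also have "\<dots> \<in> S" unfolding hminus_def using xS pq(1) N(1) S by blast
    finally show ?thesis using pq by blast
  qed
  have bij: "bij_betw (\<lambda>(p, n). hadd M p n) (N \<times> (orth_compl M N \<inter> S)) S"
    unfolding bij_betw_def
  proof (intro conjI inj equalityI subsetI)
    fix x assume "x \<in> S"
    then show "x \<in> (\<lambda>(p, n). hadd M p n) ` (N \<times> (orth_compl M N \<inter> S))"
      using surj by force
  next
    fix x assume "x \<in> (\<lambda>(p, n). hadd M p n) ` (N \<times> (orth_compl M N \<inter> S))"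
    then obtain p q where "p \<in> N" "q \<in> S" "x = hadd M p q" by auto
    then show "x \<in> S" using S(2)[of p q] N(1) by auto
  qed
  have add4: "hadd M (hadd M p p') (hadd M q q') = hadd M (hadd M p q) (hadd M p' q')"
    if "p \<in> hcarrier M" "p' \<in> hcarrier M" "q \<in> hcarrier M" "q' \<in> hcarrier M" for p p' q q'
    using that by (metis add_assoc add_commute add_closed)
  have "hilbert_iso ?H (hsubmod M S) (\<lambda>(p, n). hadd M p n)"
    unfolding hilbert_iso_def linear_iso_def
    using bij by (auto simp: hsum_def hsubmod_def NM oM add4 scale_add add_act ip_expand closed
        o0 o0' fun_eq_iff)
  then show ?thesis
    using closedN unfolding complemented_def orth by (simp add: hsubmod_def)
qed

lemma hsubmod_self: "hsubmod M (hcarrier M) = M"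
  by (simp add: hsubmod_def)

end

section \<open>Path spaces\<close>

lemma topspace_path_space_iff:
  "c \<in> topspace (path_space G I) \<longleftrightarrow> (\<forall>i\<in>I. c i \<in> arcs G) \<and> (\<forall>i. i \<notin> I \<longrightarrow> c i = undefined) \<and>
    (\<forall>i. i \<in> I \<and> i + 1 \<in> I \<longrightarrow> tail G (c i) = head G (c (i + 1)))"
  by (auto simp: path_space_def PiE_iff extensional_def)

text \<open>The arcs carry the discrete topology, so a basic open set constrains finitely many
  coordinates, and pinning those to the values of c stays inside it. All continuity arguments on
  path spaces reduce to this.\<close>

lemma openin_path_space:
  "openin (path_space G I) U \<longleftrightarrow> U \<subseteq> topspace (path_space G I) \<and>
    (\<forall>c\<in>U. \<exists>J. finite J \<and> J \<subseteq> I \<and> (\<forall>d\<in>topspace (path_space G I). (\<forall>i\<in>J. d i = c i) \<longrightarrow> d \<in> U))"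
  (is "?L \<longleftrightarrow> ?R")
proof
  let ?X = "product_topology (\<lambda>_. discrete_topology (arcs G)) I"
  assume L: ?L
  then obtain T where T: "openin ?X T"
    and U: "U = T \<inter> {c. \<forall>i. i \<in> I \<and> i + 1 \<in> I \<longrightarrow> tail G (c i) = head G (c (i + 1))}"
    unfolding path_space_def openin_subtopology by blast
  show ?R
  proof (intro conjI ballI)
    show "U \<subseteq> topspace (path_space G I)" using L by (rule openin_subset)
    fix c assume c: "c \<in> U"
    then obtain V where V: "finite {i \<in> I. V i \<noteq> arcs G}" "c \<in> Pi\<^sub>E I V" "Pi\<^sub>E I V \<subseteq> T"
      using T unfolding U openin_product_topology_alt by auto
    have "d \<in> U" if d: "d \<in> topspace (path_space G I)" and eq: "\<forall>i\<in>{i \<in> I. V i \<noteq> arcs G}. d i = c i" for d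
    proof -
      have "d \<in> Pi\<^sub>E I V"
      proof (rule PiE_I)
        fix i assume i: "i \<in> I"
        show "d i \<in> V i"
        proof (cases "V i = arcs G")
          case True then show ?thesis using d i by (simp add: topspace_path_space_iff)
        next
          case False
          then have "d i = c i" using eq i by simp
          then show ?thesis using V(2) i by (simp add: PiE_mem)
        qed
      qed (use d in \<open>simp add: topspace_path_space_iff\<close>)
      then show ?thesis using d V(3) by (auto simp: U topspace_path_space_iff)
    qed
    then show "\<exists>J. finite J \<and> J \<subseteq> I \<and> (\<forall>d\<in>topspace (path_space G I). (\<forall>i\<in>J. d i = c i) \<longrightarrow> d \<in> U)"
      using V(1) by (intro exI[of _ "{i \<in> I. V i \<noteq> arcs G}"]) auto
  qed
next
  let ?X = "product_topology (\<lambda>_. discrete_topology (arcs G)) I"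
  assume R: ?R
  show ?L
  proof (subst openin_subopen, rule ballI)
    fix c assume c: "c \<in> U"
    then obtain J where J: "finite J" "J \<subseteq> I"
      "\<And>d. d \<in> topspace (path_space G I) \<Longrightarrow> \<forall>i\<in>J. d i = c i \<Longrightarrow> d \<in> U"
      using R by meson
    have cT: "c \<in> topspace (path_space G I)" using R c by blast
    define V where "V = (\<lambda>i. if i \<in> J then {c i} else arcs G)"
    let ?W = "Pi\<^sub>E I V \<inter> {c. \<forall>i. i \<in> I \<and> i + 1 \<in> I \<longrightarrow> tail G (c i) = head G (c (i + 1))}"
    have "openin ?X (Pi\<^sub>E I V)"
    proof (rule product_topology_basis)
      show "openin (discrete_topology (arcs G)) (V i)" for i
        using cT J(2) by (auto simp: V_def topspace_path_space_iff)
      show "finite {i. V i \<noteq> topspace (discrete_topology (arcs G))}"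
        by (rule finite_subset[OF _ J(1)]) (auto simp: V_def)
    qed
    then have "openin (path_space G I) ?W"
      unfolding path_space_def openin_subtopology by blast
    moreover have "c \<in> ?W"
      using cT by (auto simp: topspace_path_space_iff V_def PiE_iff extensional_def)
    moreover have "?W \<subseteq> U"
    proof
      fix d assume d: "d \<in> ?W"
      then have "d \<in> Pi\<^sub>E I V" by simp
      have "d i = c i" if "i \<in> J" for i
        using PiE_mem[OF \<open>d \<in> Pi\<^sub>E I V\<close>, of i] J(2) that by (auto simp: V_def)
      moreover have "d i \<in> arcs G" if "i \<in> I" for i
        using PiE_mem[OF \<open>d \<in> Pi\<^sub>E I V\<close> that] cT that by (auto simp: V_def topspace_path_space_iff split: if_splits)
      moreover have "d i = undefined" if "i \<notin> I" for i
        using PiE_arb[OF \<open>d \<in> Pi\<^sub>E I V\<close> that] .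
      ultimately show "d \<in> U" using d J(3)[of d] by (simp add: topspace_path_space_iff)
    qed
    ultimately show "\<exists>T. openin (path_space G I) T \<and> c \<in> T \<and> T \<subseteq> U" by blast
  qed
qed

lemma openin_cylinder:
  assumes "finite J" "J \<subseteq> I"
  shows "openin (path_space G I) {d \<in> topspace (path_space G I). \<forall>i\<in>J. d i = c i}"
  unfolding openin_path_space using assms by auto

lemma continuous_map_path_space:
  fixes f :: "_ \<Rightarrow> 'b::metric_space"
  shows "continuous_map (path_space G I) euclidean f \<longleftrightarrow>
    (\<forall>c\<in>topspace (path_space G I). \<forall>\<epsilon>>0. \<exists>J. finite J \<and> J \<subseteq> I \<and>
       (\<forall>d\<in>topspace (path_space G I). (\<forall>i\<in>J. d i = c i) \<longrightarrow> dist (f d) (f c) < \<epsilon>))"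
  (is "?L \<longleftrightarrow> ?R")
proof
  assume L: ?L
  show ?R
  proof (intro ballI allI impI)
    fix c and \<epsilon> :: real assume c: "c \<in> topspace (path_space G I)" and "\<epsilon> > 0"
    have "openin (path_space G I) {d \<in> topspace (path_space G I). f d \<in> ball (f c) \<epsilon>}"
      by (rule openin_continuous_map_preimage[OF L]) (simp del: mem_ball)
    moreover have "c \<in> {d \<in> topspace (path_space G I). f d \<in> ball (f c) \<epsilon>}"
      using c \<open>\<epsilon> > 0\<close> by simp
    ultimately show "\<exists>J. finite J \<and> J \<subseteq> I \<and>
       (\<forall>d\<in>topspace (path_space G I). (\<forall>i\<in>J. d i = c i) \<longrightarrow> dist (f d) (f c) < \<epsilon>)"
      unfolding openin_path_space by (simp add: dist_commute)
  qed
next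
  assume R: ?R
  show ?L
    unfolding continuous_map_def
  proof (intro conjI allI impI)
    fix V :: "'b set" assume V: "openin euclidean V"
    show "openin (path_space G I) {c \<in> topspace (path_space G I). f c \<in> V}"
      unfolding openin_path_space
    proof (intro conjI ballI)
      fix c assume "c \<in> {c \<in> topspace (path_space G I). f c \<in> V}"
      then have c: "c \<in> topspace (path_space G I)" "f c \<in> V" by auto
      then obtain \<epsilon> where "\<epsilon> > 0" and e: "ball (f c) \<epsilon> \<subseteq> V"
        using V open_contains_ball by (metis open_openin)
      then obtain J where J: "finite J" "J \<subseteq> I"
        "\<forall>d\<in>topspace (path_space G I). (\<forall>i\<in>J. d i = c i) \<longrightarrow> dist (f d) (f c) < \<epsilon>"
        using R c by meson
      have *: "\<forall>d\<in>topspace (path_space G I). (\<forall>i\<in>J. d i = c i) \<longrightarrow> d \<in> {c \<in> topspace (path_space G I). f c \<in> V}"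
        using J(3) e by (auto simp: subset_iff dist_commute)
      show "\<exists>J. finite J \<and> J \<subseteq> I \<and> (\<forall>d\<in>topspace (path_space G I).
          (\<forall>i\<in>J. d i = c i) \<longrightarrow> d \<in> {c \<in> topspace (path_space G I). f c \<in> V})"
        by (intro exI[of _ J] conjI J(1) J(2) *)
    qed auto
  qed auto
qed

text \<open>Tychonoff, together with closedness of the paths in the product: a broken junction at i
  is visible on the coordinates i and i + 1 alone, hence an open condition.\<close>

lemma compact_path_space:
  assumes "finite (arcs G)"
  shows "compact_space (path_space G I)"
proof -
  let ?X = "product_topology (\<lambda>_. discrete_topology (arcs G)) I"
  let ?S = "{c. \<forall>i. i \<in> I \<and> i + 1 \<in> I \<longrightarrow> tail G (c i) = head G (c (i + 1))}"
  have cX: "compact_space ?X"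
    using assms by (simp add: compact_space_product_topology compact_space_discrete_topology)
  have "openin ?X (topspace ?X - topspace ?X \<inter> ?S)"
    unfolding openin_product_topology_alt
  proof (intro ballI)
    fix c assume c: "c \<in> topspace ?X - topspace ?X \<inter> ?S"
    then obtain i where i: "i \<in> I" "i + 1 \<in> I" "tail G (c i) \<noteq> head G (c (i + 1))" by auto
    have cE: "c \<in> I \<rightarrow>\<^sub>E arcs G" using c by simp
    define V where "V = (\<lambda>j. if j \<in> {i, i + 1} then {c j} else arcs G)"
    have "Pi\<^sub>E I V \<subseteq> topspace ?X - topspace ?X \<inter> ?S"
    proof
      fix d assume d: "d \<in> Pi\<^sub>E I V"
      have "d i = c i" "d (i + 1) = c (i + 1)"
        using PiE_mem[OF d i(1)] PiE_mem[OF d i(2)] by (auto simp: V_def)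
      moreover have "d \<in> I \<rightarrow>\<^sub>E arcs G"
        using d cE by (auto simp: PiE_iff V_def split: if_splits)
      ultimately show "d \<in> topspace ?X - topspace ?X \<inter> ?S" using i by auto
    qed
    moreover have "finite {j \<in> I. V j \<noteq> topspace (discrete_topology (arcs G))}"
      by (rule finite_subset[of _ "{i, i + 1}"]) (auto simp: V_def)
    moreover have "\<forall>j\<in>I. openin (discrete_topology (arcs G)) (V j)"
      using cE by (auto simp: V_def PiE_iff)
    moreover have "c \<in> Pi\<^sub>E I V" using cE by (auto simp: V_def PiE_iff)
    ultimately show "\<exists>U. finite {j \<in> I. U j \<noteq> topspace (discrete_topology (arcs G))} \<and>
        (\<forall>j\<in>I. openin (discrete_topology (arcs G)) (U j)) \<and> c \<in> Pi\<^sub>E I U \<and>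
        Pi\<^sub>E I U \<subseteq> topspace ?X - topspace ?X \<inter> ?S" by blast
  qed
  then have "closedin ?X (topspace ?X \<inter> ?S)"
    by (auto simp: closedin_def)
  then have "compactin ?X (topspace ?X \<inter> ?S)"
    by (rule closedin_compact_space[OF cX])
  then have "compact_space (subtopology ?X (topspace ?X \<inter> ?S))"
    by (rule compact_space_subtopology)
  then show ?thesis
    unfolding path_space_def using subtopology_restrict[of ?X ?S] by simp
qed

lemma Hausdorff_path_space: "Hausdorff_space (path_space G I)"
  unfolding path_space_def
  by (intro Hausdorff_space_subtopology) (simp add: Hausdorff_space_product_topology)

text \<open>Compactness takes the place of a metric: finitely many cylinders, on each of which f
  stays within \<epsilon>/2 of its value at the centre, cover the space, and the union of their
  coordinate sets works for all pairs of points.\<close>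

lemma C_of_uniformly_continuous:
  assumes fin: "finite (arcs G)" and f: "f \<in> C_of (path_space G I)" and "\<epsilon> > 0"
  obtains J where "finite J" "J \<subseteq> I"
    "\<And>c d. c \<in> topspace (path_space G I) \<Longrightarrow> d \<in> topspace (path_space G I) \<Longrightarrow>
      \<forall>i\<in>J. c i = d i \<Longrightarrow> cmod (f c - f d) < \<epsilon>"
proof -
  let ?T = "topspace (path_space G I)"
  have e2: "\<epsilon> / 2 > 0" using \<open>\<epsilon> > 0\<close> by simp
  have "\<forall>c\<in>?T. \<exists>J. finite J \<and> J \<subseteq> I \<and> (\<forall>d\<in>?T. (\<forall>i\<in>J. d i = c i) \<longrightarrow> dist (f d) (f c) < \<epsilon> / 2)"
    using C_of_continuous[OF f] e2 unfolding continuous_map_path_space by blast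
  then obtain J where J: "\<And>c. c \<in> ?T \<Longrightarrow> finite (J c) \<and> J c \<subseteq> I \<and>
      (\<forall>d\<in>?T. (\<forall>i\<in>J c. d i = c i) \<longrightarrow> dist (f d) (f c) < \<epsilon> / 2)"
    by metis
  define W where "W = (\<lambda>c. {d \<in> ?T. \<forall>i\<in>J c. d i = c i})"
  have "compactin (path_space G I) ?T"
    using compact_path_space[OF fin] by (simp add: compact_space_def)
  moreover have "\<And>V. V \<in> W ` ?T \<Longrightarrow> openin (path_space G I) V"
    using J by (auto simp: W_def intro!: openin_cylinder)
  moreover have "?T \<subseteq> \<Union> (W ` ?T)" by (auto simp: W_def)
  ultimately obtain \<F> where F: "finite \<F>" "\<F> \<subseteq> W ` ?T" "?T \<subseteq> \<Union> \<F>"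
    unfolding compactin_def by metis
  then obtain F where F': "F \<subseteq> ?T" "finite F" "\<F> = W ` F"
    by (metis finite_subset_image)
  show thesis
  proof (rule that)
    show "finite (\<Union> (J ` F))" "\<Union> (J ` F) \<subseteq> I" using F' J by auto
    fix c d assume cd: "c \<in> ?T" "d \<in> ?T" and eq: "\<forall>i\<in>\<Union> (J ` F). c i = d i"
    obtain b where b: "b \<in> F" "c \<in> W b" using F(3) cd(1) F'(3) by blast
    then have "\<forall>i\<in>J b. c i = b i" by (simp add: W_def)
    moreover have "\<forall>i\<in>J b. d i = b i" using calculation eq b(1) by force
    ultimately have "dist (f c) (f b) < \<epsilon> / 2" "dist (f d) (f b) < \<epsilon> / 2"
      using J[of b] b(1) F'(1) cd by auto
    then have "dist (f c) (f d) < \<epsilon>" by (rule dist_triangle_half_l)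
    then show "cmod (f c - f d) < \<epsilon>" by (simp add: dist_norm)
  qed
qed

lemma C_of_pathI:
  assumes "\<And>c. c \<notin> topspace (path_space G I) \<Longrightarrow> f c = 0"
    and "\<And>c \<epsilon>. c \<in> topspace (path_space G I) \<Longrightarrow> \<epsilon> > 0 \<Longrightarrow> \<exists>J. finite J \<and> J \<subseteq> I \<and>
       (\<forall>d\<in>topspace (path_space G I). (\<forall>i\<in>J. d i = c i) \<longrightarrow> cmod (f d - f c) < \<epsilon>)"
  shows "f \<in> C_of (path_space G I)"
  using assms by (auto intro!: C_ofI simp: continuous_map_path_space dist_norm)

lemma C_of_locally_constantI:
  assumes "\<And>c. c \<notin> topspace (path_space G I) \<Longrightarrow> f c = 0" and J: "finite J" "J \<subseteq> I"
    and "\<And>c d. c \<in> topspace (path_space G I) \<Longrightarrow> d \<in> topspace (path_space G I) \<Longrightarrow>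
       (\<And>i. i \<in> J \<Longrightarrow> d i = c i) \<Longrightarrow> f d = f c"
  shows "f \<in> C_of (path_space G I)"
proof (rule C_of_pathI)
  fix c and \<epsilon> :: real assume c: "c \<in> topspace (path_space G I)" and "\<epsilon> > 0"
  have *: "\<forall>d\<in>topspace (path_space G I). (\<forall>i\<in>J. d i = c i) \<longrightarrow> cmod (f d - f c) < \<epsilon>"
  proof (intro ballI impI)
    fix d assume "d \<in> topspace (path_space G I)" "\<forall>i\<in>J. d i = c i"
    then have "f d = f c" by (intro assms(4)[OF c]) auto
    then show "cmod (f d - f c) < \<epsilon>" using \<open>\<epsilon> > 0\<close> by simp
  qed
  show "\<exists>J. finite J \<and> J \<subseteq> I \<and>
      (\<forall>d\<in>topspace (path_space G I). (\<forall>i\<in>J. d i = c i) \<longrightarrow> cmod (f d - f c) < \<epsilon>)"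
    by (intro exI[of _ J] conjI J(1) J(2) *)
qed (use assms(1) in auto)

text \<open>Continuity of p is put coordinatewise: each coordinate of p c is decided by finitely
  many coordinates of c. Shifts, truncations and prolongations into the past are all of this
  kind.\<close>

lemma C_of_precompose:
  assumes f: "f \<in> C_of (path_space G I)"
    and p: "\<And>c. c \<in> topspace (path_space G K) \<Longrightarrow> p c \<in> topspace (path_space G I)"
    and J: "\<And>i. i \<in> I \<Longrightarrow> finite (J i) \<and> J i \<subseteq> K"
    and dep: "\<And>i c d. i \<in> I \<Longrightarrow> c \<in> topspace (path_space G K) \<Longrightarrow> d \<in> topspace (path_space G K) \<Longrightarrow>
       (\<forall>j\<in>J i. d j = c j) \<Longrightarrow> p d i = p c i"
  shows "(\<lambda>c. if c \<in> topspace (path_space G K) then f (p c) else 0) \<in> C_of (path_space G K)"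
proof (rule C_of_pathI)
  fix c and \<epsilon> :: real assume c: "c \<in> topspace (path_space G K)" and "\<epsilon> > 0"
  then obtain L where L: "finite L" "L \<subseteq> I"
    "\<And>d. d \<in> topspace (path_space G I) \<Longrightarrow> \<forall>i\<in>L. d i = p c i \<Longrightarrow> dist (f d) (f (p c)) < \<epsilon>"
    using C_of_continuous[OF f] p[OF c] unfolding continuous_map_path_space by meson
  have "cmod (f (p d) - f (p c)) < \<epsilon>"
    if d: "d \<in> topspace (path_space G K)" and eq: "\<forall>j\<in>\<Union> (J ` L). d j = c j" for d
  proof -
    have "\<forall>i\<in>L. p d i = p c i" using dep[OF _ c d] L(2) eq by blast
    then show ?thesis using L(3)[OF p[OF d]] by (simp add: dist_norm)
  qed
  moreover have "finite (\<Union> (J ` L))" "\<Union> (J ` L) \<subseteq> K"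
    using L(1,2) J by blast+
  ultimately show "\<exists>J. finite J \<and> J \<subseteq> K \<and> (\<forall>d\<in>topspace (path_space G K). (\<forall>i\<in>J. d i = c i) \<longrightarrow>
      cmod ((if d \<in> topspace (path_space G K) then f (p d) else 0) -
        (if c \<in> topspace (path_space G K) then f (p c) else 0)) < \<epsilon>)"
    using c by (intro exI[of _ "\<Union> (J ` L)"]) simp
qed auto

section \<open>The transfer operator\<close>

text \<open>Every vertex emits an arc: L averages over \<open>out_arcs\<close>, and the chain into
  the past needs a next arc at each vertex.\<close>

locale no_sink_digraph = fin_digraph G for G :: "('v, 'e) pre_digraph" +
  assumes no_sinks: "v \<in> verts G \<Longrightarrow> out_arcs G v \<noteq> {}"
begin

abbreviation "paths \<equiv> topspace (E_inf G)"
abbreviation "two_paths \<equiv> topspace (E_two G)"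
abbreviation "C_inf \<equiv> C_of (E_inf G)"
abbreviation "C_two \<equiv> C_of (E_two G)"

lemma E_infD:
  assumes "c \<in> paths"
  shows "i \<ge> 0 \<Longrightarrow> c i \<in> arcs G" "i < 0 \<Longrightarrow> c i = undefined"
    "i \<ge> 0 \<Longrightarrow> tail G (c i) = head G (c (i + 1))"
  using assms by (auto simp: topspace_path_space_iff)

lemma path_range_verts: "c \<in> paths \<Longrightarrow> path_range G c \<in> verts G"
  by (simp add: path_range_def E_infD)

lemma finite_out_arcs: "finite (out_arcs G v)"
  by (rule finite_subset[OF _ finite_arcs]) (auto simp: out_arcs_def)

lemma card_out_arcs: "c \<in> paths \<Longrightarrow> card (out_arcs G (path_range G c)) > 0"
  using no_sinks[OF path_range_verts] finite_out_arcs by (simp add: card_gt_0_iff)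

lemma path_cons_closed:
  assumes "c \<in> paths" "e \<in> out_arcs G (path_range G c)"
  shows "path_cons e c \<in> paths"
  using assms E_infD[OF assms(1)] unfolding topspace_path_space_iff path_cons_def path_range_def
  by (auto simp: out_arcs_def)

lemma path_shift_closed: "c \<in> paths \<Longrightarrow> path_shift c \<in> paths"
  unfolding topspace_path_space_iff path_shift_def by auto

lemma path_shift_cons: "c \<in> paths \<Longrightarrow> path_shift (path_cons e c) = c"
  using E_infD(2)[of c] by (auto simp: path_shift_def path_cons_def fun_eq_iff)

lemma path_cons_shift: "c \<in> paths \<Longrightarrow> path_cons (c 0) (path_shift c) = c"
  using E_infD(2)[of c] by (auto simp: path_shift_def path_cons_def fun_eq_iff)

lemma head_arc_out: "c \<in> paths \<Longrightarrow> c 0 \<in> out_arcs G (path_range G (path_shift c))"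
  using E_infD(1)[of c 0] E_infD(3)[of c 0] by (simp add: out_arcs_def path_range_def path_shift_def)

lemma path_cons_0: "path_cons e c 0 = e"
  by (simp add: path_cons_def)

lemma shift_endo_closed:
  assumes "f \<in> C_inf" shows "shift_endo G f \<in> C_inf"
  unfolding shift_endo_def
  by (rule C_of_precompose[OF assms path_shift_closed, where J = "\<lambda>i. {i + 1}"]) (auto simp: path_shift_def)

lemma shift_endo_funpow_closed: "f \<in> C_inf \<Longrightarrow> (shift_endo G ^^ k) f \<in> C_inf"
  by (induction k) (auto simp: shift_endo_closed)

lemma average_le:
  assumes c: "c \<in> paths"
    and b: "\<And>e. e \<in> out_arcs G (path_range G c) \<Longrightarrow> cmod (f e) \<le> B"
  shows "cmod (1 / of_nat (card (out_arcs G (path_range G c))) * (\<Sum>e\<in>out_arcs G (path_range G c). f e)) \<le> B"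
proof -
  let ?n = "card (out_arcs G (path_range G c))"
  have "cmod (\<Sum>e\<in>out_arcs G (path_range G c). f e) \<le> real ?n * B"
    using sum_norm_le[of "out_arcs G (path_range G c)" f "\<lambda>_. B"] b by simp
  then have "cmod (\<Sum>e\<in>out_arcs G (path_range G c). f e) / real ?n \<le> B"
    using card_out_arcs[OF c] by (simp add: field_simps)
  then show ?thesis by (simp add: norm_mult norm_divide)
qed

lemma transfer_bound:
  assumes "\<And>c. cmod (f c) \<le> B"
  shows "cmod (transfer G f c) \<le> B"
proof (cases "c \<in> paths")
  case True
  then show ?thesis using average_le[OF True, of "\<lambda>e. f (path_cons e c)" B] assms by (simp add: transfer_def)
next
  case False
  then show ?thesis using order.trans[OF norm_ge_zero assms] by (simp add: transfer_def)
qed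

lemma transfer_closed:
  assumes f: "f \<in> C_inf" shows "transfer G f \<in> C_inf"
proof (rule C_of_pathI)
  fix c and \<epsilon> :: real assume c: "c \<in> paths" and "\<epsilon> > 0"
  then obtain J where J: "finite J" "J \<subseteq> {0..}"
    "\<And>c d. c \<in> paths \<Longrightarrow> d \<in> paths \<Longrightarrow>
      \<forall>i\<in>J. c i = d i \<Longrightarrow> cmod (f c - f d) < \<epsilon> / 2"
    using C_of_uniformly_continuous[OF finite_arcs f, of "\<epsilon> / 2"] by (metis half_gt_zero)
  \<comment> \<open>Coordinate 0 of c fixes r(c) and with it the arcs averaged over. Prolonging
    moves coordinate i - 1 to i, while coordinate 0 of the prolonged path is e for both c and
    d.\<close>
  define K where "K = insert 0 ((\<lambda>i. i - 1) ` (J - {0}))"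
  have "cmod (transfer G f d - transfer G f c) < \<epsilon>"
    if d: "d \<in> paths" and eq: "\<forall>i\<in>K. d i = c i" for d
  proof -
    have r: "path_range G d = path_range G c"
      using eq by (simp add: K_def path_range_def)
    have "cmod (f (path_cons e d) - f (path_cons e c)) \<le> \<epsilon> / 2" if e: "e \<in> out_arcs G (path_range G c)" for e
    proof (rule less_imp_le, rule J(3))
      show "path_cons e d \<in> paths" "path_cons e c \<in> paths"
        using c d e r by (auto intro: path_cons_closed)
      show "\<forall>i\<in>J. path_cons e d i = path_cons e c i"
        using eq by (auto simp: path_cons_def K_def)
    qed
    from average_le[OF c this]
    have "cmod (transfer G f d - transfer G f c) \<le> \<epsilon> / 2"
      using c d r by (simp add: transfer_def sum_subtractf right_diff_distrib)
    then show ?thesis using \<open>\<epsilon> > 0\<close> by simp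
  qed
  moreover have "finite K" "K \<subseteq> {0..}" using J by (auto simp: K_def)
  ultimately show "\<exists>J. finite J \<and> J \<subseteq> {0..} \<and> (\<forall>d\<in>paths. (\<forall>i\<in>J. d i = c i) \<longrightarrow>
      cmod (transfer G f d - transfer G f c) < \<epsilon>)" by blast
qed (simp add: transfer_def)

lemma transfer_add: "transfer G (\<lambda>c. f c + g c) = (\<lambda>c. transfer G f c + transfer G g c)"
  by (auto simp: transfer_def sum.distrib distrib_left fun_eq_iff)

lemma transfer_scale: "transfer G (\<lambda>c. z * f c) = (\<lambda>c. z * transfer G f c)"
  by (auto simp: transfer_def sum_distrib_left fun_eq_iff intro!: sum.cong)

lemma transfer_cnj: "transfer G (\<lambda>c. cnj (f c)) = (\<lambda>c. cnj (transfer G f c))"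
  by (auto simp: transfer_def fun_eq_iff)

lemma transfer_zero: "transfer G (\<lambda>_. 0) = (\<lambda>_. 0)"
  by (simp add: transfer_def fun_eq_iff)

text \<open>\<sigma>(ec) = c, so \<alpha>(g) is constant on the paths averaged at c. The identity
  makes the twisted inner product linear for the twisted action.\<close>

lemma transfer_shift_mult:
  "transfer G (\<lambda>c. f c * shift_endo G g c) = (\<lambda>c. transfer G f c * g c)"
proof
  fix c
  show "transfer G (\<lambda>c. f c * shift_endo G g c) c = transfer G f c * g c"
  proof (cases "c \<in> paths")
    case True
    have "f (path_cons e c) * shift_endo G g (path_cons e c) = f (path_cons e c) * g c"
      if "e \<in> out_arcs G (path_range G c)" for e
      using path_cons_closed[OF True that] path_shift_cons[OF True] by (simp add: shift_endo_def)
    then have "(\<Sum>e\<in>out_arcs G (path_range G c). f (path_cons e c) * shift_endo G g (path_cons e c))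
        = (\<Sum>e\<in>out_arcs G (path_range G c). f (path_cons e c) * g c)"
      by (intro sum.cong refl)
    then show ?thesis using True by (simp add: transfer_def flip: sum_distrib_right)
  qed (simp add: transfer_def)
qed

lemma transfer_nonneg:
  assumes "\<And>c. f c \<in> \<real>\<^sub>\<ge>\<^sub>0"
  shows "transfer G f c \<in> \<real>\<^sub>\<ge>\<^sub>0"
proof -
  have "(\<Sum>e\<in>out_arcs G (path_range G c). f (path_cons e c)) \<in> \<real>\<^sub>\<ge>\<^sub>0"
    using assms by (induction rule: infinite_finite_induct[where A = "out_arcs G (path_range G c)"])
      (auto intro: nonneg_Reals_add_I)
  then show ?thesis by (auto simp: transfer_def intro: nonneg_Reals_mult_I)
qed

text \<open>c is itself one of the paths averaged at \<sigma>(c), the terms are nonnegative, and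
  there are at most |E^1| of them. This is what bounds the original norm by the twisted one.\<close>

lemma transfer_lower_bound:
  assumes nn: "\<And>c. f c \<in> \<real>\<^sub>\<ge>\<^sub>0" and c: "c \<in> paths"
  shows "cmod (f c) \<le> real (card (arcs G)) * cmod (transfer G f (path_shift c))"
proof -
  let ?d = "path_shift c"
  let ?O = "out_arcs G (path_range G ?d)"
  have d: "?d \<in> paths" by (rule path_shift_closed[OF c])
  have f: "f x = of_real (cmod (f x))" for x using nn[of x] by (auto simp: nonneg_Reals_def)
  have "cmod (f c) = cmod (f (path_cons (c 0) ?d))" by (simp add: path_cons_shift[OF c])
  also have "\<dots> \<le> (\<Sum>e\<in>?O. cmod (f (path_cons e ?d)))"
    using head_arc_out[OF c] finite_out_arcs by (intro member_le_sum) auto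
  also have "\<dots> = cmod (\<Sum>e\<in>?O. f (path_cons e ?d))"
  proof -
    have "(\<Sum>e\<in>?O. f (path_cons e ?d)) = of_real (\<Sum>e\<in>?O. cmod (f (path_cons e ?d)))"
      unfolding of_real_sum by (intro sum.cong refl f)
    then show ?thesis
      by (simp only: norm_of_real) (simp add: sum_nonneg)
  qed
  also have "\<dots> = real (card ?O) * cmod (transfer G f ?d)"
    using card_out_arcs[OF d] d by (simp add: transfer_def norm_mult norm_divide)
  also have "\<dots> \<le> real (card (arcs G)) * cmod (transfer G f ?d)"
    by (intro mult_right_mono) (auto intro!: card_mono simp: out_arcs_def)
  finally show ?thesis .
qed

subsection \<open>Twisting a Hilbert module by the transfer operator\<close>

lemma shift_endo_mult: "shift_endo G (\<lambda>c. f c * g c) = (\<lambda>c. shift_endo G f c * shift_endo G g c)"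
  and shift_endo_add: "shift_endo G (\<lambda>c. f c + g c) = (\<lambda>c. shift_endo G f c + shift_endo G g c)"
  and shift_endo_scale: "shift_endo G (\<lambda>c. z * f c) = (\<lambda>c. z * shift_endo G f c)"
  by (auto simp: shift_endo_def fun_eq_iff)

lemma shift_endo_one: "shift_endo G (one_C (E_inf G)) = one_C (E_inf G)"
  using path_shift_closed by (auto simp: shift_endo_def one_C_def fun_eq_iff)

lemma twist_L_simps:
  "hbase (twist_L G X) = hbase X" "hcarrier (twist_L G X) = hcarrier X" "hzero (twist_L G X) = hzero X"
  "hadd (twist_L G X) = hadd X" "hscale (twist_L G X) = hscale X" "hminus (twist_L G X) = hminus X"
  "hact (twist_L G X) x a = hact X x (shift_endo G a)"
  "hip (twist_L G X) x y = transfer G (hip X x y)"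
  by (auto simp: twist_L_def hminus_def fun_eq_iff)

lemma pre_hilbert_twist:
  assumes "pre_hilbert_module X" and B: "hbase X = E_inf G"
  shows "pre_hilbert_module (twist_L G X)"
proof -
  interpret X: pre_hilbert_module X by fact
  note cl = X.closed
  show ?thesis
  proof (rule pre_hilbert_module.intro, unfold twist_L_simps)
    show "compact_space (hbase X)" "Hausdorff_space (hbase X)" by (fact X.base)+
    show "hact X x (shift_endo G (one_C (hbase X))) = x" if "x \<in> hcarrier X" for x
      using X.act_one[OF that] by (simp add: B shift_endo_one)
    show "transfer G (hip X x (hact X y (shift_endo G f))) = (\<lambda>c. transfer G (hip X x y) c * f c)"
      if "x \<in> hcarrier X" "y \<in> hcarrier X" "f \<in> C_of (hbase X)" for x y f
      using that by (simp add: B X.ip_act shift_endo_closed transfer_shift_mult)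
    show "transfer G (hip X x x) c \<in> \<real>\<^sub>\<ge>\<^sub>0" if "x \<in> hcarrier X" for x c
      by (rule transfer_nonneg) (rule X.ip_nonneg[OF that])
    show "hadd X x y = hadd X y x" if "x \<in> hcarrier X" "y \<in> hcarrier X" for x y
      by (rule X.add_commute[OF that])
    show "hact X x (shift_endo G (\<lambda>c. z * f c)) = hscale X z (hact X x (shift_endo G f))"
      if "x \<in> hcarrier X" "f \<in> C_of (hbase X)" for x z f
      using that unfolding shift_endo_scale B by (simp add: X.act_scale B shift_endo_closed)
    show "transfer G (hip X y x) = (\<lambda>c. cnj (transfer G (hip X x y) c))"
      if "x \<in> hcarrier X" "y \<in> hcarrier X" for x y
      using X.ip_cnj[OF that] by (simp add: transfer_cnj)
  qed (simp_all add: B cl shift_endo_closed transfer_closed X.add_assoc X.add_zero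
      X.minus_self X.scale_one X.scale_scale X.scale_add X.add_scale shift_endo_mult X.act_act
      shift_endo_add X.act_add X.add_act X.scale_act X.ip_closed[unfolded B]
      X.ip_add X.ip_scale transfer_add transfer_scale)
qed

section \<open>Equivalence of the twisted norm with the original one\<close>

context
  fixes X :: "(int \<Rightarrow> 'e, 'm, 'z) hmod_scheme"
  assumes X: "pre_hilbert_module X" and B: "hbase X = E_inf G"
begin

interpretation X: pre_hilbert_module X by (fact X)

interpretation T: pre_hilbert_module "twist_L G X" by (rule pre_hilbert_twist[OF X B])

lemma twist_norm_le: "x \<in> hcarrier X \<Longrightarrow> hnorm (twist_L G X) x \<le> hnorm X x"
  by (rule T.hnorm_le) (auto simp: twist_L_simps X.hnorm_nonneg intro!: transfer_bound X.ip_le_hnorm_sq)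

lemma norm_le_twist:
  assumes x: "x \<in> hcarrier X"
  shows "hnorm X x \<le> sqrt (real (card (arcs G))) * hnorm (twist_L G X) x"
proof (rule X.hnorm_le)
  show "0 \<le> sqrt (real (card (arcs G))) * hnorm (twist_L G X) x"
    using T.hnorm_nonneg[of x] x by (simp add: twist_L_simps)
  fix c assume c: "c \<in> topspace (hbase X)"
  have "cmod (hip X x x c) \<le> real (card (arcs G)) * cmod (transfer G (hip X x x) (path_shift c))"
    using c x X.ip_nonneg by (intro transfer_lower_bound) (auto simp: B)
  also have "\<dots> \<le> real (card (arcs G)) * (hnorm (twist_L G X) x)\<^sup>2"
    using T.ip_le_hnorm_sq[of x] x by (intro mult_left_mono) (auto simp: twist_L_simps)
  finally show "cmod (hip X x x c) \<le> (sqrt (real (card (arcs G))) * hnorm (twist_L G X) x)\<^sup>2"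
    by (simp add: power_mult_distrib)
qed

lemma twist_cauchy: "hcauchy (twist_L G X) = hcauchy X"
proof (intro equalityI subsetI)
  fix x assume x: "x \<in> hcauchy X"
  have xc: "x n \<in> hcarrier X" for n by (rule X.cauchy_carrier[OF x])
  show "x \<in> hcauchy (twist_L G X)"
    unfolding hcauchy_def mem_Collect_eq twist_L_simps
  proof (intro conjI allI impI xc)
    fix \<epsilon> :: real assume "\<epsilon> > 0"
    then obtain N where N: "\<And>i j. i \<ge> N \<Longrightarrow> j \<ge> N \<Longrightarrow> hdist X (x i) (x j) < \<epsilon>"
      using X.cauchyD[OF x] by blast
    have "hnorm (twist_L G X) (hminus X (x i) (x j)) < \<epsilon>" if "i \<ge> N" "j \<ge> N" for i j
      using N[OF that] twist_norm_le[OF X.minus_closed[OF xc xc], of i j] by simp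
    then show "\<exists>N. \<forall>i\<ge>N. \<forall>j\<ge>N. hnorm (twist_L G X) (hminus X (x i) (x j)) < \<epsilon>" by blast
  qed
next
  fix x assume x: "x \<in> hcauchy (twist_L G X)"
  have xc: "x n \<in> hcarrier X" for n using T.cauchy_carrier[OF x] by (simp add: twist_L_simps)
  show "x \<in> hcauchy X"
    unfolding hcauchy_def mem_Collect_eq
  proof (intro conjI allI impI xc)
    fix \<epsilon> :: real assume e: "\<epsilon> > 0"
    \<comment> \<open>The summand 1 keeps the divisor positive, also for an empty arc set.\<close>
    let ?K = "sqrt (real (card (arcs G))) + 1"
    have K: "?K > 0" by (simp add: add_nonneg_pos)
    obtain N where N: "\<And>i j. i \<ge> N \<Longrightarrow> j \<ge> N \<Longrightarrow> hnorm (twist_L G X) (hminus X (x i) (x j)) < \<epsilon> / ?K"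
      using T.cauchyD[OF x divide_pos_pos[OF e K]] unfolding twist_L_simps by blast
    have "hdist X (x i) (x j) < \<epsilon>" if "i \<ge> N" "j \<ge> N" for i j
    proof -
      let ?u = "hminus X (x i) (x j)"
      have u: "?u \<in> hcarrier X" by (intro X.minus_closed xc)
      have "hnorm X ?u \<le> sqrt (real (card (arcs G))) * hnorm (twist_L G X) ?u"
        by (rule norm_le_twist[OF u])
      also have "\<dots> \<le> ?K * hnorm (twist_L G X) ?u"
        using T.hnorm_nonneg[of ?u] u by (intro mult_right_mono) (auto simp: twist_L_simps)
      also have "\<dots> < ?K * (\<epsilon> / ?K)"
        using N[OF that] K by (intro mult_strict_left_mono)
      also have "\<dots> = \<epsilon>" using K by simp
      finally show ?thesis .
    qed
    then show "\<exists>N. \<forall>i\<ge>N. \<forall>j\<ge>N. hdist X (x i) (x j) < \<epsilon>" by blast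
  qed
qed

lemma twist_tendsto_zero:
  assumes u: "\<And>n. u n \<in> hcarrier X"
  shows "(\<lambda>n. hnorm (twist_L G X) (u n)) \<longlonglongrightarrow> 0 \<longleftrightarrow> (\<lambda>n. hnorm X (u n)) \<longlonglongrightarrow> 0"
proof
  assume l: "(\<lambda>n. hnorm (twist_L G X) (u n)) \<longlonglongrightarrow> 0"
  have "(\<lambda>n. sqrt (real (card (arcs G))) * hnorm (twist_L G X) (u n)) \<longlonglongrightarrow> 0"
    using tendsto_mult_left[OF l] by simp
  from real_tendsto_sandwich[OF _ _ tendsto_const this]
  show "(\<lambda>n. hnorm X (u n)) \<longlonglongrightarrow> 0"
    by (simp_all add: always_eventually norm_le_twist u X.hnorm_nonneg)
next
  assume l: "(\<lambda>n. hnorm X (u n)) \<longlonglongrightarrow> 0"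
  have "0 \<le> hnorm (twist_L G X) (u n)" for n
    using T.hnorm_nonneg[of "u n"] u by (simp add: twist_L_simps)
  then show "(\<lambda>n. hnorm (twist_L G X) (u n)) \<longlonglongrightarrow> 0"
    by (intro real_tendsto_sandwich[OF _ _ tendsto_const l])
      (simp_all add: always_eventually twist_norm_le u)
qed

lemma twist_null_rel: "null_rel (twist_L G X) = null_rel X"
proof -
  have "(\<lambda>n. hnorm (twist_L G X) (hminus X (x n) (y n))) \<longlonglongrightarrow> 0 \<longleftrightarrow> (\<lambda>n. hdist X (x n) (y n)) \<longlonglongrightarrow> 0"
    if "x \<in> hcauchy X" "y \<in> hcauchy X" for x y
    using that by (intro twist_tendsto_zero X.minus_closed X.cauchy_carrier)
  then show ?thesis
    unfolding null_rel_def twist_cauchy twist_L_simps by (simp cong: conj_cong)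
qed

end

lemma hilbert_twist:
  fixes X :: "(int \<Rightarrow> 'e, 'm, 'z) hmod_scheme"
  assumes "hilbert_module X" and B: "hbase X = E_inf G"
  shows "hilbert_module (twist_L G X)"
proof -
  interpret X: hilbert_module X by fact
  interpret T: pre_hilbert_module "twist_L G X" by (rule pre_hilbert_twist[OF X.pre_hilbert_module_axioms B])
  have definite: "x = hzero (twist_L G X)"
    if x: "x \<in> hcarrier (twist_L G X)" and z: "hip (twist_L G X) x x = (\<lambda>_. 0)" for x
  proof -
    have xX: "x \<in> hcarrier X" using x by (simp add: twist_L_simps)
    have "hip X x x c = 0" for c
    proof (cases "c \<in> paths")
      case True
      have "cmod (hip X x x c) \<le> real (card (arcs G)) * cmod (transfer G (hip X x x) (path_shift c))"
        by (intro transfer_lower_bound X.ip_nonneg xX True)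
      then show ?thesis using z by (simp add: twist_L_simps)
    qed (use X.ip_outside[OF xX xX] B in simp)
    then show ?thesis using X.definiteI[OF xX] by (simp add: twist_L_simps)
  qed
  have complete: "\<exists>l\<in>hcarrier (twist_L G X). hconverges (twist_L G X) s l"
    if s: "s \<in> hcauchy (twist_L G X)" for s
  proof -
    have s': "s \<in> hcauchy X" using s twist_cauchy[OF X.pre_hilbert_module_axioms B] by simp
    then obtain l where l: "l \<in> hcarrier X" "hconverges X s l" using X.complete by blast
    then have "hconverges (twist_L G X) s l"
      using twist_tendsto_zero[OF X.pre_hilbert_module_axioms B, of "\<lambda>n. hminus X (s n) l"] s'
      by (simp add: hconverges_def twist_L_simps X.minus_closed X.cauchy_carrier)
    then show ?thesis using l by (auto simp: twist_L_simps)
  qed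
  show ?thesis
    by (rule T.hilbert_moduleI[OF definite complete])
qed

text \<open>Cauchy and null sequences agree before and after twisting, hence the classes and their
  operations coincide literally. The inner products agree because L is a finite average at each c
  and commutes with pointwise limits.\<close>

lemma twist_completion:
  fixes X :: "(int \<Rightarrow> 'e, 'm) hmod"
  assumes X: "pre_hilbert_module X" and B: "hbase X = E_inf G"
  assumes iso: "hilbert_iso N (completion (twist_L G X)) f"
  shows "hilbert_iso N (twist_L G (completion X)) f"
proof -
  interpret X: pre_hilbert_module X by fact
  interpret T: pre_hilbert_module "twist_L G X" by (rule pre_hilbert_twist[OF X B])
  note nr = twist_null_rel[OF X B] and hc = twist_cauchy[OF X B]
  have ip: "hip (twist_L G (completion X)) p q = hip (completion (twist_L G X)) p q"
    if p: "p \<in> hcarrier (completion X)" and q: "q \<in> hcarrier (completion X)" for p q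
  proof -
    obtain x where x: "x \<in> hcauchy X" "p = X.cls x" using p by (rule X.completion_cases)
    obtain y where y: "y \<in> hcauchy X" "q = X.cls y" using q by (rule X.completion_cases)
    have "hip (completion (twist_L G X)) (T.cls x) (T.cls y) = transfer G (hip (completion X) p q)"
    proof (rule T.completion_ip_eqI)
      show "x \<in> hcauchy (twist_L G X)" "y \<in> hcauchy (twist_L G X)" using x y hc by auto
      fix c
      show "(\<lambda>n. hip (twist_L G X) (x n) (y n) c) \<longlonglongrightarrow> transfer G (hip (completion X) p q) c"
        unfolding twist_L_simps transfer_def x(2) y(2)
        using card_out_arcs[of c] by (cases "c \<in> paths") (auto intro!: tendsto_intros X.completion_ip_limit x y)
    qed
    then show ?thesis by (simp add: twist_L_simps x(2) y(2) nr)
  qed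
  have c: "hcarrier (completion (twist_L G X)) = hcarrier (completion X)"
    by (simp add: completion_def nr hc)
  have ops: "hbase (completion (twist_L G X)) = hbase (twist_L G (completion X))"
    "hcarrier (completion (twist_L G X)) = hcarrier (twist_L G (completion X))"
    "hadd (completion (twist_L G X)) = hadd (twist_L G (completion X))"
    "hscale (completion (twist_L G X)) = hscale (twist_L G (completion X))"
    "hact (completion (twist_L G X)) = hact (twist_L G (completion X))"
    by (simp_all add: completion_def twist_L_simps nr hc fun_eq_iff)
  have mem: "f x \<in> hcarrier (completion X)" if "x \<in> hcarrier N" for x
    using iso that c unfolding hilbert_iso_def linear_iso_def by (metis bij_betwE)
  show ?thesis
    using iso unfolding hilbert_iso_def linear_iso_def ops by (simp add: ip mem)
qed

subsection \<open>The correspondence \<open>M\<^sub>L\<close>\<close>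

text \<open>For A as a module over itself \<open>hnorm\<close> is the supremum norm, so completeness
  is that of uniform convergence.\<close>

lemma hilbert_M_pow_0: "hilbert_module (M_pow G 0)"
proof -
  let ?A = "M_pow G 0 :: (int \<Rightarrow> 'e, (int \<Rightarrow> 'e) \<Rightarrow> complex) corr"
  have minus: "hminus ?A f g = (\<lambda>c. f c - g c)" for f g
    by (simp add: hminus_def M_pow_def)
  interpret A: pre_hilbert_module ?A
  proof (rule pre_hilbert_module.intro, unfold minus)
    show "compact_space (hbase ?A)" "Hausdorff_space (hbase ?A)"
      by (simp_all add: M_pow_def compact_path_space Hausdorff_path_space)
    show "hip ?A x x c \<in> \<real>\<^sub>\<ge>\<^sub>0" for x c
      by (simp add: M_pow_def complex_nonneg_Reals_iff)
    show "hact ?A x (one_C (hbase ?A)) = x" if "x \<in> hcarrier ?A" for x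
      using that C_of_outside by (fastforce simp: M_pow_def one_C_def fun_eq_iff indicator_def)
  qed (auto simp: M_pow_def C_of_zero C_of_add C_of_scale C_of_mult C_of_cnj algebra_simps fun_eq_iff)
  have le: "cmod (f c) \<le> hnorm ?A f" if "f \<in> C_inf" for f c
  proof -
    have "cmod (hip ?A f f c) \<le> (hnorm ?A f)\<^sup>2"
      using that by (intro A.ip_le_hnorm_sq) (simp add: M_pow_def)
    then have "(cmod (f c))\<^sup>2 \<le> (hnorm ?A f)\<^sup>2"
      by (simp add: M_pow_def norm_mult power2_eq_square)
    then show ?thesis using A.hnorm_nonneg[of f] that by (simp add: M_pow_def abs_le_square_iff)
  qed
  have definite: "x = hzero ?A" if "x \<in> hcarrier ?A" "hip ?A x x = (\<lambda>_. 0)" for x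
    using that by (simp add: M_pow_def fun_eq_iff)
  have complete: "\<exists>l\<in>hcarrier ?A. hconverges ?A s l" if s: "s \<in> hcauchy ?A" for s
  proof -
    have sc: "s n \<in> C_inf" for n using A.cauchy_carrier[OF s] by (simp add: M_pow_def)
    have d: "cmod (s i c - s j c) \<le> hdist ?A (s i) (s j)" for i j c
    proof -
      have "hminus ?A (s i) (s j) \<in> C_inf"
        using A.minus_closed[OF A.cauchy_carrier[OF s] A.cauchy_carrier[OF s], of i j]
        by (simp add: M_pow_def)
      from le[OF this, of c] show ?thesis by (simp add: minus)
    qed
    define l where "l = (\<lambda>c. lim (\<lambda>n. s n c))"
    have lim: "(\<lambda>n. s n c) \<longlonglongrightarrow> l c" for c
    proof -
      have "Cauchy (\<lambda>n. s n c)"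
        unfolding Cauchy_altdef2 dist_norm
      proof (intro allI impI)
        fix \<epsilon> :: real assume "\<epsilon> > 0"
        then obtain N where N: "\<And>i j. i \<ge> N \<Longrightarrow> j \<ge> N \<Longrightarrow> hdist ?A (s i) (s j) < \<epsilon>"
          using A.cauchyD[OF s] by blast
        have "cmod (s n c - s N c) < \<epsilon>" if "n \<ge> N" for n
          using d[of n c N] N[OF that order_refl] by simp
        then show "\<exists>N. \<forall>n\<ge>N. cmod (s n c - s N c) < \<epsilon>" by blast
      qed
      then show ?thesis unfolding l_def using Cauchy_convergent_iff convergent_LIMSEQ_iff by blast
    qed
    have unif: "\<exists>N. \<forall>n\<ge>N. \<forall>c. cmod (s n c - l c) \<le> \<epsilon>" if e: "\<epsilon> > 0" for \<epsilon>
    proof -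
      obtain N where N: "\<And>i j. i \<ge> N \<Longrightarrow> j \<ge> N \<Longrightarrow> hdist ?A (s i) (s j) < \<epsilon>"
        using A.cauchyD[OF s e] by blast
      have "cmod (s n c - l c) \<le> \<epsilon>" if n: "n \<ge> N" for n c
      proof (rule Lim_bounded)
        show "(\<lambda>j. cmod (s n c - s j c)) \<longlonglongrightarrow> cmod (s n c - l c)"
          by (intro tendsto_intros lim)
        show "\<forall>j\<ge>N. cmod (s n c - s j c) \<le> \<epsilon>"
          using d[of n c] N[OF n] by (intro allI impI) (rule order.trans[OF _ less_imp_le])
      qed
      then show ?thesis by blast
    qed
    have lC: "l \<in> C_inf"
      by (rule C_of_uniform_limit[of s, OF sc unif])
    have "(\<lambda>n. hdist ?A (s n) l) \<longlonglongrightarrow> 0"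
      unfolding LIMSEQ_iff
    proof (intro allI impI)
      fix r :: real assume r: "r > 0"
      then obtain N where N: "\<forall>n\<ge>N. \<forall>c. cmod (s n c - l c) \<le> r / 2" using unif[of "r / 2"] by auto
      have "norm (hdist ?A (s n) l - 0) < r" if "n \<ge> N" for n
      proof -
        have "hdist ?A (s n) l \<le> r / 2"
        proof (rule A.hnorm_le)
          fix c
          have "(cmod (s n c - l c))\<^sup>2 \<le> (r / 2)\<^sup>2" using N that by (intro power_mono) auto
          then show "cmod (hip ?A (hminus ?A (s n) l) (hminus ?A (s n) l) c) \<le> (r / 2)\<^sup>2"
            unfolding minus by (simp add: M_pow_def norm_mult power2_eq_square flip: complex_cnj_diff)
        qed (use r in simp)
        moreover have "0 \<le> hdist ?A (s n) l"
          using sc lC by (intro A.hdist_nonneg) (auto simp: M_pow_def)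
        ultimately show ?thesis using r by simp
      qed
      then show "\<exists>N. \<forall>n\<ge>N. norm (hdist ?A (s n) l - 0) < r" by blast
    qed
    then show ?thesis using lC by (auto simp: hconverges_def M_pow_def)
  qed
  show ?thesis by (rule A.hilbert_moduleI[OF definite complete])
qed

lemma M_pow_1: "M_pow G 1 = twist_L G (M_pow G 0)"
  by (simp add: M_pow_def twist_L_def)

text \<open>M_L is A twisted by L, and twisting preserves completeness because the norms are
  equivalent; this is why C(E^\<infinity>) itself can be the underlying space.\<close>

lemma correspondence_M_pow_1: "correspondence (M_pow G 1)"
proof (rule correspondence.intro)
  show "hilbert_module (M_pow G 1)"
    unfolding M_pow_1 by (rule hilbert_twist[OF hilbert_M_pow_0]) (simp add: M_pow_def)
  show "correspondence_axioms (M_pow G 1)"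
    by (rule correspondence_axioms.intro) (auto simp: M_pow_def C_of_mult algebra_simps)
qed

end

section \<open>The fibre measures\<close>

lemma (in prob_space) stream_space_eq_distr_Stream:
  "stream_space M = distr (M \<Otimes>\<^sub>M stream_space M) (stream_space M) (\<lambda>(x, X). x ## X)" (is "_ = ?D")
proof (rule measure_eqI)
  interpret S: prob_space "stream_space M" by (rule prob_space_stream_space)
  fix A assume A [measurable]: "A \<in> sets (stream_space M)"
  have "emeasure (stream_space M) A = (\<integral>\<^sup>+X. indicator A X \<partial>stream_space M)"
    by simp
  also have "\<dots> = (\<integral>\<^sup>+x. \<integral>\<^sup>+X. indicator A (x ## X) \<partial>stream_space M \<partial>M)"
    by (rule nn_integral_stream_space) simp
  also have "\<dots> = (\<integral>\<^sup>+z. indicator A (fst z ## snd z) \<partial>(M \<Otimes>\<^sub>M stream_space M))"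
    by (subst S.nn_integral_fst[symmetric]) simp_all
  also have "\<dots> = (\<integral>\<^sup>+X. indicator A X \<partial>?D)"
    by (subst nn_integral_distr) (auto simp: case_prod_beta)
  also have "\<dots> = emeasure ?D A"
    by simp
  finally show "emeasure (stream_space M) A = emeasure ?D A" .
qed simp

text \<open>Fubini for the first entry and the tail; the bound B provides integrability.\<close>

lemma (in prob_space) integral_stream_space:
  fixes f :: "'a stream \<Rightarrow> 'b::{banach, second_countable_topology}"
  assumes f [measurable]: "f \<in> borel_measurable (stream_space M)" and B: "\<And>X. norm (f X) \<le> B"
  shows "(LINT X|stream_space M. f X) = (LINT x|M. LINT X|stream_space M. f (x ## X))"
proof -
  interpret S: prob_space "stream_space M" by (rule prob_space_stream_space)
  interpret P: pair_prob_space M "stream_space M" ..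
  have int: "integrable (M \<Otimes>\<^sub>M stream_space M) (\<lambda>(x, X). f (x ## X))"
    by (rule P.integrable_const_bound[where B = B]) (auto simp: B)
  have "(LINT X|stream_space M. f X) = (LINT X|distr (M \<Otimes>\<^sub>M stream_space M) (stream_space M) (\<lambda>(x, X). x ## X). f X)"
    by (simp flip: stream_space_eq_distr_Stream)
  also have "\<dots> = (LINT z|(M \<Otimes>\<^sub>M stream_space M). (case z of (x, X) \<Rightarrow> f (x ## X)))"
    by (subst integral_distr) (auto simp: case_prod_unfold)
  also have "\<dots> = (LINT x|M. LINT X|stream_space M. f (x ## X))"
    using P.integral_fst'[OF int] by simp
  finally show ?thesis .
qed

locale weighted_digraph = no_sink_digraph G for G :: "('v, 'e) pre_digraph" +
  fixes w :: "'e \<Rightarrow> complex"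
  assumes nonzero: "e \<in> arcs G \<Longrightarrow> w e \<noteq> 0"
    and normalized: "v \<in> verts G \<Longrightarrow> (\<Sum>e\<in>out_arcs G v. (cmod (w e))\<^sup>2) = real (card (out_arcs G v))"
begin

text \<open>The fibre measure is the law of a Markov chain running into the past: from the vertex \<open>v\<close> the
  arc \<open>e\<close> is taken with probability \<open>arc_prob v e\<close>. The chain is driven by an independent sequence of
  random maps from vertices to arcs, which makes the first step easy to split off.\<close>

definition arc_prob :: "'v \<Rightarrow> 'e \<Rightarrow> real" where
  "arc_prob v e = (if e \<in> out_arcs G v then (cmod (w e))\<^sup>2 / real (card (out_arcs G v)) else 0)"

definition arc_pmf :: "'v \<Rightarrow> 'e pmf" where
  "arc_pmf v = embed_pmf (arc_prob v)"

definition choice_pmf :: "('v \<Rightarrow> 'e) pmf" where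
  "choice_pmf = Pi_pmf (verts G) undefined arc_pmf"

abbreviation choices :: "('v \<Rightarrow> 'e) stream measure" where
  "choices \<equiv> stream_space (measure_pmf choice_pmf)"

text \<open>A value that is not an arc out of v is replaced by a fixed arc that is. At a vertex v
  this changes nothing almost surely, but it makes \<open>past\<close> a genuine path for every
  sequence of choices, not merely for almost all.\<close>

definition clip :: "'v \<Rightarrow> 'e \<Rightarrow> 'e" where
  "clip v e = (if e \<in> out_arcs G v then e else SOME e. e \<in> out_arcs G v)"

primrec past :: "('v \<Rightarrow> 'e) stream \<Rightarrow> 'v \<Rightarrow> nat \<Rightarrow> 'e" where
  "past \<omega> v 0 = clip v (shd \<omega> v)"
| "past \<omega> v (Suc n) = past (stl \<omega>) (head G (clip v (shd \<omega> v))) n"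

text \<open>Step n of the past sits at coordinate -n-1. The sequence \<omega> is independent of c,
  so paths that agree at coordinate 0 receive the same past.\<close>

definition join :: "(int \<Rightarrow> 'e) \<Rightarrow> ('v \<Rightarrow> 'e) stream \<Rightarrow> int \<Rightarrow> 'e" where
  "join c \<omega> = (\<lambda>i. if i \<ge> 0 then c i else past \<omega> (path_range G c) (nat (- i - 1)))"

lemma arc_prob_sum: assumes "v \<in> verts G" shows "(\<Sum>e\<in>out_arcs G v. arc_prob v e) = 1"
proof -
  have "(\<Sum>e\<in>out_arcs G v. arc_prob v e) = (\<Sum>e\<in>out_arcs G v. (cmod (w e))\<^sup>2) / real (card (out_arcs G v))"
    by (simp add: arc_prob_def sum_divide_distrib)
  also have "\<dots> = 1"
    using no_sinks[OF assms] finite_out_arcs by (simp add: normalized[OF assms] card_gt_0_iff)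
  finally show ?thesis .
qed

lemma pmf_arc_pmf: assumes "v \<in> verts G" shows "pmf (arc_pmf v) e = arc_prob v e"
  unfolding arc_pmf_def
proof (rule pmf_embed_pmf)
  show "0 \<le> arc_prob v x" for x by (simp add: arc_prob_def)
  have "(\<integral>\<^sup>+x. ennreal (arc_prob v x) \<partial>count_space UNIV) = (\<Sum>x\<in>out_arcs G v. ennreal (arc_prob v x))"
    by (rule nn_integral_count_space') (auto simp: finite_out_arcs arc_prob_def)
  also have "\<dots> = ennreal (\<Sum>x\<in>out_arcs G v. arc_prob v x)"
    by (rule sum_ennreal) (simp add: arc_prob_def)
  finally show "(\<integral>\<^sup>+x. ennreal (arc_prob v x) \<partial>count_space UNIV) = 1"
    by (simp add: arc_prob_sum[OF assms])
qed

lemma integral_choice_pmf: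
  fixes F :: "'e \<Rightarrow> complex"
  assumes v: "v \<in> verts G"
  shows "(LINT f|measure_pmf choice_pmf. F (clip v (f v))) = (\<Sum>e\<in>out_arcs G v. of_real (arc_prob v e) * F e)"
proof -
  have m: "map_pmf (\<lambda>f. f v) choice_pmf = arc_pmf v"
    unfolding choice_pmf_def using v by (simp add: Pi_pmf_component)
  have s: "e \<in> out_arcs G v" if "e \<in> set_pmf (arc_pmf v)" for e
    using that pmf_arc_pmf[OF v, of e] by (auto simp: set_pmf_iff arc_prob_def split: if_splits)
  have "(LINT f|measure_pmf choice_pmf. F (clip v (f v))) = (LINT e|measure_pmf (arc_pmf v). F (clip v e))"
    unfolding m[symmetric] by simp
  also have "\<dots> = (\<Sum>e\<in>out_arcs G v. pmf (arc_pmf v) e *\<^sub>R F (clip v e))"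
    using s by (intro integral_measure_pmf finite_out_arcs) auto
  also have "\<dots> = (\<Sum>e\<in>out_arcs G v. of_real (arc_prob v e) * F e)"
    by (intro sum.cong refl) (simp add: pmf_arc_pmf[OF v] clip_def scaleR_conv_of_real)
  finally show ?thesis .
qed

lemma clip_out: assumes "v \<in> verts G" shows "clip v e \<in> out_arcs G v"
  using no_sinks[OF assms] some_in_eq[of "out_arcs G v"] by (simp add: clip_def)

lemma clip_arc: "v \<in> verts G \<Longrightarrow> clip v e \<in> arcs G" and tail_clip: "v \<in> verts G \<Longrightarrow> tail G (clip v e) = v"
  using clip_out by (auto simp: out_arcs_def)

lemma past_arc: "v \<in> verts G \<Longrightarrow> past \<omega> v n \<in> arcs G"
  by (induction n arbitrary: \<omega> v) (auto simp: clip_arc)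

lemma past_tail: "v \<in> verts G \<Longrightarrow> tail G (past \<omega> v (Suc n)) = head G (past \<omega> v n)"
  by (induction n arbitrary: \<omega> v) (auto simp: tail_clip clip_arc)

lemma trunc_join: "c \<in> paths \<Longrightarrow> trunc 0 (join c \<omega>) = c"
  using E_infD(2)[of c] by (auto simp: trunc_def join_def fun_eq_iff)

lemma join_closed:
  assumes c: "c \<in> paths"
  shows "join c \<omega> \<in> two_paths"
  unfolding topspace_path_space_iff
proof (intro conjI ballI allI impI)
  note v = path_range_verts[OF c]
  fix i :: int
  show "join c \<omega> i \<in> arcs G"
    using E_infD(1)[OF c, of i] past_arc[OF v] by (simp add: join_def)
  consider "i \<ge> 0" | "i = -1" | "i < -1" by linarith
  then show "tail G (join c \<omega> i) = head G (join c \<omega> (i + 1))"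
  proof cases
    case 3
    then have "nat (- i - 1) = Suc (nat (- (i + 1) - 1))" by simp
    then show ?thesis using 3 past_tail[OF v] by (simp add: join_def del: past.simps)
  qed (use E_infD(3)[OF c, of i] v in \<open>auto simp: join_def tail_clip path_range_def\<close>)
qed auto

lemma join_fibre: "c \<in> paths \<Longrightarrow> join c \<omega> \<in> fibre G c"
  by (simp add: fibre_def join_closed trunc_join)

text \<open>The first choice prolongs c by one arc, the remaining choices prolong the result, and h
  moves the new arc from coordinate 0 to -1. This is the recursion behind
  \<open>mean_markov\<close>.\<close>

lemma join_Stream:
  "join c (f ## \<omega>) = two_shift (join (path_cons (clip (path_range G c) (f (path_range G c))) c) \<omega>)"
proof
  fix i :: int
  let ?e = "clip (path_range G c) (f (path_range G c))"
  have r: "path_range G (path_cons ?e c) = head G ?e" by (simp add: path_range_def path_cons_def)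
  consider "i \<ge> 0" | "i = -1" | "i < -1" by linarith
  then show "join c (f ## \<omega>) i = two_shift (join (path_cons ?e c) \<omega>) i"
  proof cases
    case 3
    then have "nat (- i - 1) = Suc (nat (- (i + 1) - 1))" by simp
    then show ?thesis using 3 by (simp add: join_def two_shift_def r)
  qed (auto simp: join_def two_shift_def path_cons_def)
qed

section \<open>Measurability of the random past\<close>

lemma space_choices [simp]: "space choices = UNIV"
  by (simp add: space_stream_space streams_UNIV)

text \<open>Distinguishing the finitely many possible first arcs a leaves, for each, one condition
  on the head and one on the tail of the sequence.\<close>

lemma past_eq_sets:
  assumes "v \<in> verts G"
  shows "{\<omega>. past \<omega> v n = e} \<in> sets choices"
  using assms
proof (induction n arbitrary: v)
  case 0
  have "shd -` {f. clip v (f v) = e} \<inter> space choices \<in> sets choices"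
    by (rule measurable_sets[OF measurable_shd]) simp
  then show ?case by (simp add: vimage_def)
next
  case (Suc n)
  have "{\<omega>. past \<omega> v (Suc n) = e}
      = (\<Union>a\<in>arcs G. shd -` {f. clip v (f v) = a} \<inter> stl -` {\<omega>. past \<omega> (head G a) n = e})"
    using clip_arc[OF Suc.prems] by auto
  moreover have "shd -` {f. clip v (f v) = a} \<inter> stl -` {\<omega>. past \<omega> (head G a) n = e} \<in> sets choices"
    if "a \<in> arcs G" for a
  proof -
    have "shd -` {f. clip v (f v) = a} \<inter> space choices \<in> sets choices"
      by (rule measurable_sets[OF measurable_shd]) simp
    moreover have "stl -` {\<omega>. past \<omega> (head G a) n = e} \<inter> space choices \<in> sets choices"
      using that by (intro measurable_sets[OF measurable_stl] Suc.IH) simp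
    ultimately show ?thesis using sets.Int by fastforce
  qed
  ultimately show ?case by (simp add: sets.finite_UN)
qed

text \<open>The first n steps take finitely many values, so such an event is a finite union of
  finite intersections of the events in \<open>past_eq_sets\<close>.\<close>

lemma past_dependent_sets:
  assumes v: "v \<in> verts G"
    and Q: "\<And>\<omega> \<omega>'. (\<And>j. j < n \<Longrightarrow> past \<omega> v j = past \<omega>' v j) \<Longrightarrow> Q \<omega> \<Longrightarrow> Q \<omega>'"
  shows "{\<omega>. Q \<omega>} \<in> sets choices"
proof -
  define L where "L = (\<lambda>\<omega>. restrict (past \<omega> v) {..<n}) ` {\<omega>. Q \<omega>}"
  have "L \<subseteq> {..<n} \<rightarrow>\<^sub>E arcs G" unfolding L_def by (intro image_subsetI) (simp add: PiE_iff past_arc[OF v])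
  then have finL: "finite L" by (rule finite_subset) (simp add: finite_PiE)
  have "{\<omega>. Q \<omega>} = (\<Union>l\<in>L. \<Inter>j\<in>{..<n}. {\<omega>. past \<omega> v j = l j})" (is "_ = ?R")
  proof (intro equalityI subsetI)
    fix \<omega> assume "\<omega> \<in> {\<omega>. Q \<omega>}"
    then show "\<omega> \<in> ?R" by (auto simp: L_def)
  next
    fix \<omega> assume "\<omega> \<in> ?R"
    then obtain \<omega>' where "Q \<omega>'" "\<And>j. j < n \<Longrightarrow> past \<omega> v j = past \<omega>' v j"
      by (auto simp: L_def)
    then show "\<omega> \<in> {\<omega>. Q \<omega>}" using Q[of \<omega>' \<omega>] by auto
  qed
  also have "?R \<in> sets choices"
  proof (intro sets.finite_UN finL)
    fix l assume "l \<in> L"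
    show "(\<Inter>j\<in>{..<n}. {\<omega>. past \<omega> v j = l j}) \<in> sets choices"
    proof (cases "n = 0")
      case True
      then show ?thesis using sets.top[of choices] by simp
    next
      case False
      then show ?thesis by (intro sets.finite_INT past_eq_sets v) auto
    qed
  qed
  finally show ?thesis .
qed

text \<open>The part of U recognised at depth n: whatever lies in the fibre and shares the
  coordinates -n to -1 is also in U. For open U these sets increase to U, which reduces
  measurability and uniqueness to events of finite depth.\<close>

definition decided :: "(int \<Rightarrow> 'e) \<Rightarrow> (int \<Rightarrow> 'e) set \<Rightarrow> nat \<Rightarrow> (int \<Rightarrow> 'e) set" where
  "decided c U n = {d \<in> fibre G c. \<forall>d'\<in>fibre G c. (\<forall>i. - int n \<le> i \<and> i < 0 \<longrightarrow> d' i = d i) \<longrightarrow> d' \<in> U}"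

abbreviation fibre_topology :: "(int \<Rightarrow> 'e) \<Rightarrow> (int \<Rightarrow> 'e) topology" where
  "fibre_topology c \<equiv> subtopology (E_two G) (fibre G c)"

lemma fibre_nonneg: "d \<in> fibre G c \<Longrightarrow> i \<ge> 0 \<Longrightarrow> d i = c i"
  by (auto simp: fibre_def trunc_def)

text \<open>On a fibre the coordinates from 0 on are those of c, so only negative ones vary, and
  finitely many of them lie between -n and -1 for some n.\<close>

lemma openin_fibre:
  "openin (fibre_topology c) U \<longleftrightarrow> U \<subseteq> fibre G c \<and>
    (\<forall>d\<in>U. \<exists>n. \<forall>d'\<in>fibre G c. (\<forall>i. - int n \<le> i \<and> i < 0 \<longrightarrow> d' i = d i) \<longrightarrow> d' \<in> U)"
  (is "?L \<longleftrightarrow> ?R")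
proof
  assume ?L
  then obtain T where T: "openin (E_two G) T" and U: "U = T \<inter> fibre G c"
    by (auto simp: openin_subtopology)
  show ?R
  proof (intro conjI ballI)
    fix d assume "d \<in> U"
    then have "d \<in> T" by (simp add: U)
    from bspec[OF conjunct2[OF T[unfolded openin_path_space]] this]
    obtain J where J: "finite J" "\<And>d'. d' \<in> two_paths \<Longrightarrow> \<forall>i\<in>J. d' i = d i \<Longrightarrow> d' \<in> T"
      by blast
    obtain n where n: "\<And>i. i \<in> J \<Longrightarrow> \<bar>i\<bar> \<le> int n"
    proof
      fix i assume "i \<in> J"
      then have "nat \<bar>i\<bar> \<le> Max ((\<lambda>i. nat \<bar>i\<bar>) ` J)" using J(1) by (intro Max_ge) auto
      then show "\<bar>i\<bar> \<le> int (Max ((\<lambda>i. nat \<bar>i\<bar>) ` J))" by simp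
    qed
    have "d' \<in> U" if d': "d' \<in> fibre G c" and eq: "\<forall>i. - int n \<le> i \<and> i < 0 \<longrightarrow> d' i = d i" for d'
    proof -
      have "d' i = d i" if "i \<in> J" for i
      proof (cases "i \<ge> 0")
        case True
        then show ?thesis using \<open>d \<in> U\<close> d' fibre_nonneg[of d c i] fibre_nonneg[of d' c i] by (simp add: U)
      next
        case False
        then show ?thesis using eq n[OF that] by auto
      qed
      then show ?thesis using J(2) d' by (auto simp: U fibre_def)
    qed
    then show "\<exists>n. \<forall>d'\<in>fibre G c. (\<forall>i. - int n \<le> i \<and> i < 0 \<longrightarrow> d' i = d i) \<longrightarrow> d' \<in> U" by blast
  next
    show "U \<subseteq> fibre G c" by (simp add: U)
  qed
next
  assume R: ?R
  from bchoice[OF conjunct2[OF R]] obtain N where N: "\<And>d d'. d \<in> U \<Longrightarrow> d' \<in> fibre G c \<Longrightarrow>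
      \<forall>i. - int (N d) \<le> i \<and> i < 0 \<longrightarrow> d' i = d i \<Longrightarrow> d' \<in> U" by blast
  let ?T = "\<Union>d\<in>U. {d' \<in> two_paths. \<forall>i\<in>{- int (N d)..-1}. d' i = d i}"
  have "openin (E_two G) ?T"
    by (intro openin_Union) (auto intro!: openin_cylinder)
  moreover have "U = ?T \<inter> fibre G c"
  proof (intro equalityI subsetI)
    fix d assume d: "d \<in> U"
    then have "d \<in> fibre G c" using R by blast
    then have "d \<in> two_paths" by (simp add: fibre_def)
    with d \<open>d \<in> fibre G c\<close> show "d \<in> ?T \<inter> fibre G c" by auto
  next
    fix d' assume "d' \<in> ?T \<inter> fibre G c"
    then obtain d where "d \<in> U" "d' \<in> fibre G c" "\<forall>i\<in>{- int (N d)..-1}. d' i = d i" by auto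
    then show "d' \<in> U" by (intro N[of d d']) auto
  qed
  ultimately show ?L unfolding openin_subtopology by blast
qed

lemma openin_decided: "openin (fibre_topology c) (decided c U n)"
  unfolding openin_fibre decided_def by (auto intro!: exI[of _ n])

lemma decided_Union:
  assumes "openin (fibre_topology c) U"
  shows "(\<Union>n. decided c U n) = U"
proof (intro equalityI subsetI)
  fix d assume "d \<in> U"
  then show "d \<in> (\<Union>n. decided c U n)"
    using assms unfolding openin_fibre decided_def by blast
qed (auto simp: decided_def)

lemma decided_mono: "decided c U n \<subseteq> decided c U (Suc n)"
  unfolding decided_def by (auto 0 3)

definition fibre_algebra :: "(int \<Rightarrow> 'e) \<Rightarrow> (int \<Rightarrow> 'e) measure" where
  "fibre_algebra c = sigma (fibre G c) {U. openin (fibre_topology c) U}"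

lemma fibre_opens: "{U. openin (fibre_topology c) U} \<subseteq> Pow (fibre G c)"
  by (auto simp: openin_fibre)

lemma space_fibre_algebra: "space (fibre_algebra c) = fibre G c"
  by (simp add: fibre_algebra_def fibre_opens)

lemma sets_fibre_algebra:
  "sets (fibre_algebra c) = sigma_sets (fibre G c) {U. openin (fibre_topology c) U}"
  by (simp add: fibre_algebra_def fibre_opens)

text \<open>Open sets suffice. Such a U is the countable union of the sets
  \<open>decided c U n\<close>, and the preimage of each depends only on the first n steps of the
  past.\<close>

lemma join_measurable:
  assumes c: "c \<in> paths"
  shows "join c \<in> measurable choices (fibre_algebra c)"
  unfolding fibre_algebra_def
proof (rule measurable_measure_of[OF fibre_opens])
  show "join c \<in> space choices \<rightarrow> fibre G c" using join_fibre[OF c] by auto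
  fix U assume "U \<in> {U. openin (fibre_topology c) U}"
  then have U: "(\<Union>n. decided c U n) = U" by (simp add: decided_Union)
  have "join c -` decided c U n \<in> sets choices" for n
  proof -
    have "{\<omega>. join c \<omega> \<in> decided c U n} \<in> sets choices"
    proof (rule past_dependent_sets[OF path_range_verts[OF c], of n])
      fix \<omega> \<omega>' assume eq: "\<And>j. j < n \<Longrightarrow> past \<omega> (path_range G c) j = past \<omega>' (path_range G c) j"
        and mem: "join c \<omega> \<in> decided c U n"
      have e: "join c \<omega> i = join c \<omega>' i" if "- int n \<le> i" "i < 0" for i
        using that eq[of "nat (- i - 1)"] by (simp add: join_def)
      show "join c \<omega>' \<in> decided c U n"
        using mem e join_fibre[OF c] unfolding decided_def by auto
    qed
    then show ?thesis by (simp add: vimage_def)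
  qed
  then have "(\<Union>n. join c -` decided c U n) \<in> sets choices" by blast
  then have "join c -` (\<Union>n. decided c U n) \<in> sets choices" by (simp add: vimage_UN)
  then show "join c -` U \<inter> space choices \<in> sets choices" by (simp add: U)
qed

lemma C_of_fibre_measurable:
  assumes x: "x \<in> C_two"
  shows "x \<in> borel_measurable (fibre_algebra c)"
proof (rule borel_measurableI)
  fix S :: "complex set" assume S: "open S"
  have "openin (E_two G) {d \<in> two_paths. x d \<in> S}"
    by (rule openin_continuous_map_preimage[OF C_of_continuous[OF x]]) (use S in simp)
  then have "openin (fibre_topology c) ({d \<in> two_paths. x d \<in> S} \<inter> fibre G c)"
    unfolding openin_subtopology by blast
  moreover have "x -` S \<inter> space (fibre_algebra c) = {d \<in> two_paths. x d \<in> S} \<inter> fibre G c"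
    by (auto simp: space_fibre_algebra fibre_def)
  ultimately show "x -` S \<inter> space (fibre_algebra c) \<in> sets (fibre_algebra c)"
    by (simp add: sets_fibre_algebra sigma_sets.Basic)
qed

section \<open>Integration over the fibres\<close>

lemma prob_space_choices: "prob_space choices"
  by (rule prob_space.prob_space_stream_space[OF measure_pmf.prob_space_axioms])

text \<open>Integration over the fibre of c, written on the space of choices, which is the same for
  all c; \<open>integral_fibre_measure\<close> identifies it with the integral against the fibre
  measure.\<close>

definition mean :: "(int \<Rightarrow> 'e) \<Rightarrow> ((int \<Rightarrow> 'e) \<Rightarrow> complex) \<Rightarrow> complex" where
  "mean c x = (LINT \<omega>|choices. x (join c \<omega>))"

lemma C_of_join_measurable:
  "c \<in> paths \<Longrightarrow> x \<in> C_two \<Longrightarrow> (\<lambda>\<omega>. x (join c \<omega>)) \<in> borel_measurable choices"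
  by (rule measurable_compose[OF join_measurable C_of_fibre_measurable])

lemma C_of_E_two_bounded:
  assumes "x \<in> C_two" obtains B where "B \<ge> 0" "\<And>d. cmod (x d) \<le> B"
  using C_of_bounded[OF compact_path_space[OF finite_arcs] assms] by blast

lemma C_of_join_integrable:
  assumes c: "c \<in> paths" and x: "x \<in> C_two"
  shows "integrable choices (\<lambda>\<omega>. x (join c \<omega>))"
proof -
  interpret prob_space choices by (rule prob_space_choices)
  obtain B where "\<And>d. cmod (x d) \<le> B" using C_of_E_two_bounded[OF x] by blast
  then show ?thesis
    by (intro integrable_const_bound[where B = B] C_of_join_measurable c x) auto
qed

lemma two_shift_closed: "d \<in> two_paths \<Longrightarrow> two_shift d \<in> two_paths"
  by (simp add: topspace_path_space_iff two_shift_def)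

lemma two_shift_iff: "two_shift d \<in> two_paths \<longleftrightarrow> d \<in> two_paths"
proof
  assume d: "two_shift d \<in> two_paths"
  have "d i \<in> arcs G \<and> tail G (d i) = head G (d (i + 1))" for i
  proof -
    have "\<forall>i. d (i + 1) \<in> arcs G \<and> tail G (d (i + 1)) = head G (d (i + 1 + 1))"
      using d by (simp add: topspace_path_space_iff two_shift_def)
    from spec[OF this, of "i - 1"] show ?thesis by simp
  qed
  then show "d \<in> two_paths" by (simp add: topspace_path_space_iff)
qed (rule two_shift_closed)

lemma two_shift_C_of:
  assumes "x \<in> C_two" shows "(\<lambda>d. x (two_shift d)) \<in> C_two"
proof -
  have "(\<lambda>d. if d \<in> two_paths then x (two_shift d) else 0) \<in> C_two"
    by (rule C_of_precompose[OF assms two_shift_closed, where J = "\<lambda>i. {i + 1}"]) (auto simp: two_shift_def)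
  also have "(\<lambda>d. if d \<in> two_paths then x (two_shift d) else 0) = (\<lambda>d. x (two_shift d))"
    using C_of_outside[OF assms] by (auto simp: fun_eq_iff two_shift_iff)
  finally show ?thesis .
qed

text \<open>Fubini isolates the first choice, which picks the arc e with probability
  \<open>arc_prob\<close>; by \<open>join_Stream\<close> the remaining choices run from the path ec,
  seen through h.\<close>

lemma mean_markov:
  assumes c: "c \<in> paths" and x: "x \<in> C_two"
  shows "mean c x = (\<Sum>e\<in>out_arcs G (path_range G c).
    of_real (arc_prob (path_range G c) e) * mean (path_cons e c) (\<lambda>d. x (two_shift d)))"
proof -
  obtain B where B: "\<And>d. cmod (x d) \<le> B" using C_of_E_two_bounded[OF x] by blast
  have "mean c x = (LINT f|measure_pmf choice_pmf. LINT \<omega>|choices. x (join c (f ## \<omega>)))"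
    unfolding mean_def
    by (rule measure_pmf.integral_stream_space[OF C_of_join_measurable[OF c x], where B = B]) (rule B)
  also have "\<dots> = (LINT f|measure_pmf choice_pmf. mean (path_cons (clip (path_range G c) (f (path_range G c))) c) (\<lambda>d. x (two_shift d)))"
    by (simp add: mean_def join_Stream)
  also have "\<dots> = (\<Sum>e\<in>out_arcs G (path_range G c).
      of_real (arc_prob (path_range G c) e) * mean (path_cons e c) (\<lambda>d. x (two_shift d)))"
    by (rule integral_choice_pmf[OF path_range_verts[OF c],
          where F = "\<lambda>e. mean (path_cons e c) (\<lambda>d. x (two_shift d))"])
  finally show ?thesis .
qed

text \<open>If c and c' agree at 0 and on the nonnegative part of J, their prolongations by the same
  choices agree on all of J, negative coordinates included. The integrands are then close for every
  \<omega>, and so are the integrals.\<close>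

lemma mean_continuous:
  assumes x: "x \<in> C_two"
  shows "(\<lambda>c. if c \<in> paths then mean c x else 0) \<in> C_inf"
proof (rule C_of_pathI)
  interpret prob_space choices by (rule prob_space_choices)
  fix c and \<epsilon> :: real assume c: "c \<in> paths" and "\<epsilon> > 0"
  then have e: "\<epsilon> / 2 > 0" by simp
  obtain J where J: "finite J" "J \<subseteq> UNIV" "\<And>d d'. d \<in> two_paths \<Longrightarrow> d' \<in> two_paths \<Longrightarrow>
      \<forall>i\<in>J. d i = d' i \<Longrightarrow> cmod (x d - x d') < \<epsilon> / 2"
    using C_of_uniformly_continuous[OF finite_arcs x e] by blast
  let ?K = "insert 0 (J \<inter> {0..})"
  have "cmod (mean c' x - mean c x) < \<epsilon>" if c': "c' \<in> paths" and eq: "\<forall>i\<in>?K. c' i = c i" for c'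
  proof -
    have "join c' \<omega> i = join c \<omega> i" if "i \<in> J" for \<omega> i
      using eq that by (auto simp: join_def path_range_def)
    then have *: "cmod (x (join c' \<omega>) - x (join c \<omega>)) \<le> \<epsilon> / 2" for \<omega>
      by (intro less_imp_le J(3) join_closed c c' ballI)
    have "mean c' x - mean c x = (LINT \<omega>|choices. x (join c' \<omega>) - x (join c \<omega>))"
      unfolding mean_def by (intro Bochner_Integration.integral_diff[symmetric] C_of_join_integrable c c' x)
    also have "cmod \<dots> \<le> (LINT \<omega>|choices. cmod (x (join c' \<omega>) - x (join c \<omega>)))"
      by (rule integral_norm_bound)
    also have "\<dots> \<le> (LINT \<omega>|choices. \<epsilon> / 2)"
      by (rule integral_mono) (use * in \<open>auto intro!: integrable_norm Bochner_Integration.integrable_diff C_of_join_integrable c c' x\<close>)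
    also have "\<dots> = \<epsilon> / 2" by (simp add: prob_space[unfolded space_choices])
    finally show ?thesis using \<open>\<epsilon> > 0\<close> by simp
  qed
  then have "\<forall>d\<in>paths. (\<forall>i\<in>?K. d i = c i) \<longrightarrow>
      cmod ((if d \<in> paths then mean d x else 0) - (if c \<in> paths then mean c x else 0)) < \<epsilon>"
    using c by simp
  moreover have "finite ?K" "?K \<subseteq> {0..}" using J(1) by auto
  ultimately show "\<exists>J. finite J \<and> J \<subseteq> {0..} \<and> (\<forall>d\<in>paths. (\<forall>i\<in>J. d i = c i) \<longrightarrow>
      cmod ((if d \<in> paths then mean d x else 0) - (if c \<in> paths then mean c x else 0)) < \<epsilon>)"
    by blast
qed simp

subsection \<open>The characterisation of the fibre measures\<close>

definition extensions :: "nat \<Rightarrow> (int \<Rightarrow> 'e) \<Rightarrow> (int \<Rightarrow> 'e) set" where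
  "extensions k c = {d \<in> topspace (E_from G k). drop_neg d = c}"

text \<open>The origin moves one step: a path from -k on becomes one from -(k+1) on, with its old
  coordinate 0 now at -1. Together with \<open>shift_in\<close> this matches pasts of ec of depth k
  with pasts of c of depth k + 1.\<close>

definition shift_out :: "nat \<Rightarrow> (int \<Rightarrow> 'e) \<Rightarrow> int \<Rightarrow> 'e" where
  "shift_out k d = restrict (\<lambda>i. d (i + 1)) {- int (Suc k)..}"

definition shift_in :: "nat \<Rightarrow> (int \<Rightarrow> 'e) \<Rightarrow> int \<Rightarrow> 'e" where
  "shift_in k d = restrict (\<lambda>i. d (i - 1)) {- int k..}"

lemma shift_out_closed: "d \<in> topspace (E_from G k) \<Longrightarrow> shift_out k d \<in> topspace (E_from G (Suc k))"
  unfolding topspace_path_space_iff shift_out_def by auto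

lemma shift_in_closed: "d \<in> topspace (E_from G (Suc k)) \<Longrightarrow> shift_in k d \<in> topspace (E_from G k)"
  unfolding topspace_path_space_iff shift_in_def
  by (auto dest: spec[of _ "_ - 1"])

lemma shift_in_out: "d \<in> topspace (E_from G k) \<Longrightarrow> shift_in k (shift_out k d) = d"
  by (auto simp: topspace_path_space_iff shift_in_def shift_out_def fun_eq_iff)

lemma shift_out_in: "d \<in> topspace (E_from G (Suc k)) \<Longrightarrow> shift_out k (shift_in k d) = d"
  by (auto simp: topspace_path_space_iff shift_in_def shift_out_def fun_eq_iff)

lemma extensions_shift_in:
  assumes "d \<in> extensions (Suc k) c"
  shows "d (-1) \<in> out_arcs G (path_range G c)" "shift_in k d \<in> extensions k (path_cons (d (-1)) c)"
proof -
  have d: "d \<in> topspace (E_from G (Suc k))" and c: "c = drop_neg d" using assms by (auto simp: extensions_def)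
  have "d (-1) \<in> arcs G" "tail G (d (-1)) = head G (d 0)"
    using d unfolding topspace_path_space_iff by (auto dest: spec[of _ "-1::int"])
  then show "d (-1) \<in> out_arcs G (path_range G c)"
    by (simp add: out_arcs_def path_range_def c drop_neg_def)
  have "drop_neg (shift_in k d) = path_cons (d (-1)) c"
    by (auto simp: drop_neg_def shift_in_def path_cons_def c fun_eq_iff)
  then show "shift_in k d \<in> extensions k (path_cons (d (-1)) c)"
    using shift_in_closed[OF d] by (simp add: extensions_def)
qed

lemma extensions_shift_out:
  assumes c: "c \<in> paths" and d: "d \<in> extensions k (path_cons e c)"
  shows "shift_out k d \<in> extensions (Suc k) c" "shift_out k d (-1) = e"
proof -
  have dk: "d \<in> topspace (E_from G k)" and dn: "drop_neg d = path_cons e c"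
    using d by (auto simp: extensions_def)
  have v: "d i = path_cons e c i" if "i \<ge> 0" for i
    using fun_cong[OF dn, of i] that by (simp add: drop_neg_def)
  have "drop_neg (shift_out k d) = c"
    using v E_infD(2)[OF c] by (auto simp: drop_neg_def shift_out_def path_cons_def fun_eq_iff)
  then show "shift_out k d \<in> extensions (Suc k) c"
    using shift_out_closed[OF dk] by (simp add: extensions_def)
  show "shift_out k d (-1) = e" using v[of 0] by (simp add: shift_out_def path_cons_def)
qed

lemma extensions_0: "c \<in> paths \<Longrightarrow> extensions 0 c = {c}"
proof -
  assume c: "c \<in> paths"
  have "drop_neg d = d" if "d \<in> paths" for d :: "int \<Rightarrow> 'e"
    using E_infD(2)[OF that] by (auto simp: drop_neg_def fun_eq_iff)
  then show ?thesis using c by (auto simp: extensions_def)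
qed

lemma finite_extensions: "c \<in> paths \<Longrightarrow> finite (extensions k c)"
proof (induction k arbitrary: c)
  case 0
  then show ?case by (simp add: extensions_0)
next
  case (Suc k)
  have "extensions (Suc k) c \<subseteq> (\<Union>e\<in>out_arcs G (path_range G c). shift_out k ` extensions k (path_cons e c))"
  proof
    fix d assume d: "d \<in> extensions (Suc k) c"
    then have "d = shift_out k (shift_in k d)" by (simp add: extensions_def shift_out_in)
    then show "d \<in> (\<Union>e\<in>out_arcs G (path_range G c). shift_out k ` extensions k (path_cons e c))"
      using extensions_shift_in[OF d] by blast
  qed
  then show ?case
    by (rule finite_subset) (auto intro!: finite_out_arcs Suc.IH path_cons_closed Suc.prems)
qed

text \<open>The new factor of the weight is that of e, now at coordinate -1. Squaring its modulus
  turns the power -1/2 into 1/|s^(-1)(v)|, which gives the transition probability.\<close>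

lemma path_weight_shift_out:
  assumes d: "d \<in> extensions k (path_cons e c)" and e: "e \<in> out_arcs G v"
  shows "(cmod (path_weight G w (Suc k) (shift_out k d)))\<^sup>2 = arc_prob v e * (cmod (path_weight G w k d))\<^sup>2"
proof -
  define g where "g = (\<lambda>a. w a * of_real (real (card (out_arcs G (tail G a))) powr (-1/2)))"
  have d0: "d 0 = e"
  proof -
    have "drop_neg d 0 = path_cons e c 0" using d by (simp add: extensions_def)
    then show ?thesis by (simp add: drop_neg_def path_cons_def)
  qed
  have "path_weight G w (Suc k) (shift_out k d) = (\<Prod>j\<in>{- int (Suc k)..-1}. g (d (j + 1)))"
    unfolding path_weight_def g_def by (intro prod.cong) (auto simp: shift_out_def)
  also have "\<dots> = (\<Prod>j\<in>{- int k..0}. g (d j))"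
    by (rule prod.reindex_bij_witness[of _ "\<lambda>j. j - 1" "\<lambda>j. j + 1"]) auto
  also have "{- int k..0} = insert 0 {- int k..-1}" by auto
  also have "(\<Prod>j\<in>insert 0 {- int k..-1}. g (d j)) = g e * path_weight G w k d"
    by (simp add: d0 path_weight_def g_def)
  finally have p: "path_weight G w (Suc k) (shift_out k d) = g e * path_weight G w k d" .
  have t: "tail G e = v" using e by (simp add: out_arcs_def)
  have n: "real (card (out_arcs G v)) > 0"
    using e finite_out_arcs[of v] by (auto simp: card_gt_0_iff)
  have "(real (card (out_arcs G v)) powr (-1/2))\<^sup>2 = 1 / real (card (out_arcs G v))"
    using n by (simp add: power2_eq_square powr_minus_divide flip: powr_add)
  then have "(cmod (g e))\<^sup>2 = arc_prob v e"
    using e by (simp add: g_def t arc_prob_def norm_mult power_mult_distrib)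
  then show ?thesis by (simp add: p norm_mult power_mult_distrib)
qed

lemma trunc_closed: "d \<in> two_paths \<Longrightarrow> trunc k d \<in> topspace (E_from G k)"
  by (auto simp: topspace_path_space_iff trunc_def)

lemma trunc_C_of:
  assumes "x \<in> C_of (E_from G k)"
  shows "(\<lambda>d. if d \<in> two_paths then x (trunc k d) else 0) \<in> C_two"
  by (rule C_of_precompose[OF assms trunc_closed, where J = "\<lambda>i. {i}"]) (auto simp: trunc_def)

text \<open>Induction on the depth: \<open>mean_markov\<close> removes the arc e at coordinate -1,
  the hypothesis applies to ec, and the sums over e and over the pasts of ec together run over the
  pasts of c.\<close>

lemma mean_trunc:
  assumes "c \<in> paths" "x \<in> C_of (E_from G k)"
  shows "mean c (\<lambda>d. if d \<in> two_paths then x (trunc k d) else 0)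
    = (\<Sum>d\<in>extensions k c. x d * of_real ((cmod (path_weight G w k d))\<^sup>2))"
  using assms
proof (induction k arbitrary: c x)
  case 0
  interpret prob_space choices by (rule prob_space_choices)
  have "mean c (\<lambda>d. if d \<in> two_paths then x (trunc 0 d) else 0) = (LINT \<omega>|choices. x c)"
    using 0 unfolding mean_def by (simp add: join_closed trunc_join)
  then show ?case using 0 by (simp add: prob_space[unfolded space_choices] extensions_0 path_weight_def)
next
  case (Suc k)
  note c = Suc.prems(1)
  let ?v = "path_range G c"
  let ?x = "\<lambda>d. if d \<in> two_paths then x (trunc (Suc k) d) else 0"
  \<comment> \<open>The function of the path from -k on that x becomes after composition with
    h.\<close>
  define y where "y = (\<lambda>d. if d \<in> topspace (E_from G k) then x (shift_out k d) else 0)"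
  have yC: "y \<in> C_of (E_from G k)"
    unfolding y_def
    by (rule C_of_precompose[OF Suc.prems(2) shift_out_closed, where J = "\<lambda>i. {i + 1}"]) (auto simp: shift_out_def)
  have tr: "?x (two_shift d) = (if d \<in> two_paths then y (trunc k d) else 0)"
    if "d \<in> two_paths" for d
  proof -
    have "trunc (Suc k) (two_shift d) = shift_out k (trunc k d)"
      by (auto simp: trunc_def two_shift_def shift_out_def fun_eq_iff)
    then show ?thesis using that two_shift_closed[OF that] trunc_closed[OF that, of k] by (simp add: y_def)
  qed
  have "mean c ?x = (\<Sum>e\<in>out_arcs G ?v. of_real (arc_prob ?v e) * mean (path_cons e c) (\<lambda>d. ?x (two_shift d)))"
    by (rule mean_markov[OF c trunc_C_of[OF Suc.prems(2)]])
  also have "\<dots> = (\<Sum>e\<in>out_arcs G ?v. of_real (arc_prob ?v e) *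
      (\<Sum>d\<in>extensions k (path_cons e c). y d * of_real ((cmod (path_weight G w k d))\<^sup>2)))"
  proof (intro sum.cong refl arg_cong2[where f = "(*)"])
    fix e assume e: "e \<in> out_arcs G ?v"
    have "mean (path_cons e c) (\<lambda>d. ?x (two_shift d))
        = mean (path_cons e c) (\<lambda>d. if d \<in> two_paths then y (trunc k d) else 0)"
      unfolding mean_def
      by (intro Bochner_Integration.integral_cong refl tr join_closed path_cons_closed c e)
    also have "\<dots> = (\<Sum>d\<in>extensions k (path_cons e c). y d * of_real ((cmod (path_weight G w k d))\<^sup>2))"
      by (rule Suc.IH[OF path_cons_closed[OF c e] yC])
    finally show "mean (path_cons e c) (\<lambda>d. ?x (two_shift d)) = \<dots>" .
  qed
  also have "\<dots> = (\<Sum>e\<in>out_arcs G ?v. \<Sum>d\<in>extensions k (path_cons e c).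
      x (shift_out k d) * of_real ((cmod (path_weight G w (Suc k) (shift_out k d)))\<^sup>2))"
    unfolding sum_distrib_left
  proof (intro sum.cong refl)
    fix e d assume e: "e \<in> out_arcs G ?v" and d: "d \<in> extensions k (path_cons e c)"
    have "y d = x (shift_out k d)" using d by (simp add: y_def extensions_def)
    then show "of_real (arc_prob ?v e) * (y d * of_real ((cmod (path_weight G w k d))\<^sup>2))
        = x (shift_out k d) * of_real ((cmod (path_weight G w (Suc k) (shift_out k d)))\<^sup>2)"
      unfolding path_weight_shift_out[OF d e] by simp
  qed
  also have "\<dots> = (\<Sum>(e, d)\<in>Sigma (out_arcs G ?v) (\<lambda>e. extensions k (path_cons e c)).
      x (shift_out k d) * of_real ((cmod (path_weight G w (Suc k) (shift_out k d)))\<^sup>2))"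
    by (intro sum.Sigma finite_out_arcs ballI finite_extensions path_cons_closed c)
  also have "\<dots> = (\<Sum>d\<in>extensions (Suc k) c. x d * of_real ((cmod (path_weight G w (Suc k) d))\<^sup>2))"
  proof (rule sum.reindex_bij_witness[of _ "\<lambda>d. (d (-1), shift_in k d)" "\<lambda>(e, d). shift_out k d"])
    fix p assume "p \<in> Sigma (out_arcs G ?v) (\<lambda>e. extensions k (path_cons e c))"
    then obtain e d where p: "p = (e, d)" and e: "e \<in> out_arcs G ?v" and d: "d \<in> extensions k (path_cons e c)"
      by auto
    show "((case p of (e, d) \<Rightarrow> shift_out k d) (-1), shift_in k (case p of (e, d) \<Rightarrow> shift_out k d)) = p"
      using extensions_shift_out(2)[OF c d] d by (simp add: p shift_in_out extensions_def)
    show "(case p of (e, d) \<Rightarrow> shift_out k d) \<in> extensions (Suc k) c"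
      using extensions_shift_out(1)[OF c d] by (simp add: p)
  next
    fix d assume d: "d \<in> extensions (Suc k) c"
    show "(case (d (-1), shift_in k d) of (e, d) \<Rightarrow> shift_out k d) = d"
      using d by (simp add: extensions_def shift_out_in)
    show "(d (-1), shift_in k d) \<in> Sigma (out_arcs G ?v) (\<lambda>e. extensions k (path_cons e c))"
      using extensions_shift_in[OF d] by simp
  qed auto
  finally show ?case .
qed

section \<open>Existence and uniqueness of the fibre measure\<close>

definition past_law :: "(int \<Rightarrow> 'e) \<Rightarrow> (int \<Rightarrow> 'e) measure" where
  "past_law c = distr choices (fibre_algebra c) (join c)"

lemma integral_past_law:
  assumes "c \<in> paths" "x \<in> C_two"
  shows "(LINT d|past_law c. x d) = mean c x"
  unfolding past_law_def mean_def using assms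
  by (intro integral_distr join_measurable C_of_fibre_measurable)

abbreviation is_fibre_measure :: "(int \<Rightarrow> 'e) \<Rightarrow> (int \<Rightarrow> 'e) measure \<Rightarrow> bool" where
  "is_fibre_measure c \<mu> \<equiv> prob_space \<mu> \<and> space \<mu> = fibre G c \<and>
     sets \<mu> = sigma_sets (fibre G c) {U. openin (fibre_topology c) U} \<and>
     (\<forall>k. \<forall>x\<in>C_of (E_from G k). (LINT d|\<mu>. x (trunc k d)) =
       (\<Sum>d | d \<in> topspace (E_from G k) \<and> drop_neg d = c.
          x d * of_real ((cmod (path_weight G w k d))\<^sup>2)))"

lemma past_law_is_fibre_measure:
  assumes c: "c \<in> paths"
  shows "is_fibre_measure c (past_law c)"
proof (intro conjI allI ballI)
  interpret prob_space choices by (rule prob_space_choices)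
  show "prob_space (past_law c)"
    unfolding past_law_def by (rule prob_space_distr[OF join_measurable[OF c]])
  show sp: "space (past_law c) = fibre G c"
    by (simp add: past_law_def space_fibre_algebra)
  show "sets (past_law c) = sigma_sets (fibre G c) {U. openin (fibre_topology c) U}"
    by (simp add: past_law_def sets_fibre_algebra)
  fix k x assume x: "x \<in> C_of (E_from G k)"
  have "(LINT d|past_law c. x (trunc k d))
      = (LINT d|past_law c. (if d \<in> two_paths then x (trunc k d) else 0))"
    by (intro Bochner_Integration.integral_cong refl) (simp add: sp fibre_def)
  also have "\<dots> = mean c (\<lambda>d. if d \<in> two_paths then x (trunc k d) else 0)"
    by (rule integral_past_law[OF c trunc_C_of[OF x]])
  also have "\<dots> = (\<Sum>d\<in>extensions k c. x d * of_real ((cmod (path_weight G w k d))\<^sup>2))"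
    by (rule mean_trunc[OF c x])
  finally show "(LINT d|past_law c. x (trunc k d)) =
      (\<Sum>d | d \<in> topspace (E_from G k) \<and> drop_neg d = c. x d * of_real ((cmod (path_weight G w k d))\<^sup>2))"
    by (simp add: extensions_def)
qed

text \<open>The open sets generate the sigma-algebra and are stable under intersection. Each is an
  increasing union of sets of finite depth, whose mass is determined by the prescribed integrals
  because their indicators are continuous functions of a truncation.\<close>

lemma fibre_measure_unique:
  assumes \<mu>: "is_fibre_measure c \<mu>" and \<nu>: "is_fibre_measure c \<nu>"
  shows "\<mu> = \<nu>"
proof (rule measure_eqI_generator_eq)
  interpret \<mu>: prob_space \<mu> using \<mu> by blast
  interpret \<nu>: prob_space \<nu> using \<nu> by blast
  let ?E = "{U. openin (fibre_topology c) U}"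
  show "Int_stable ?E" by (auto simp: Int_stable_def)
  show "?E \<subseteq> Pow (fibre G c)" by (rule fibre_opens)
  show s: "sets \<mu> = sigma_sets (fibre G c) ?E" "sets \<nu> = sigma_sets (fibre G c) ?E"
    using \<mu> \<nu> by blast+
  have top: "openin (fibre_topology c) (fibre G c)" by (auto simp: openin_fibre)
  show "range (\<lambda>_. fibre G c) \<subseteq> ?E" using top by auto
  show "(\<Union>i::nat. fibre G c) = fibre G c" by simp
  show "emeasure \<mu> (fibre G c) \<noteq> \<infinity>" for i :: nat by simp
  have opens: "U \<in> sets \<mu>" "U \<in> sets \<nu>" if "openin (fibre_topology c) U" for U
    using that by (auto simp: s intro: sigma_sets.Basic)
  fix U assume "U \<in> ?E"
  then have U: "openin (fibre_topology c) U" by simp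
  have "measure \<mu> (decided c U n) = measure \<nu> (decided c U n)" for n
  proof -
    let ?D = "decided c U n"
    \<comment> \<open>The indicator of the depth n set as a function on the truncated paths; looking
      only at the coordinates -n to -1, it is locally constant, hence an admissible test
      function.\<close>
    define x :: "(int \<Rightarrow> 'e) \<Rightarrow> complex" where
      "x = (\<lambda>d. if d \<in> topspace (E_from G n) \<and> (\<exists>d'\<in>?D. \<forall>i\<in>{- int n..-1}. d' i = d i) then 1 else 0)"
    have xC: "x \<in> C_of (E_from G n)"
    proof (rule C_of_locally_constantI[of _ _ _ "{- int n..-1}"])
      fix a b assume ab: "a \<in> topspace (E_from G n)" "b \<in> topspace (E_from G n)"
        and eq: "\<And>i. i \<in> {- int n..-1} \<Longrightarrow> b i = a i"
      have "(\<forall>i\<in>{- int n..-1}. d' i = b i) \<longleftrightarrow> (\<forall>i\<in>{- int n..-1}. d' i = a i)" for d'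
        using eq by simp
      then show "x b = x a" using ab by (simp add: x_def)
    qed (auto simp: x_def)
    have x: "x (trunc n d) = indicator ?D d" if d: "d \<in> fibre G c" for d
    proof -
      have "(\<exists>d'\<in>?D. \<forall>i\<in>{- int n..-1}. d' i = trunc n d i) \<longleftrightarrow> d \<in> ?D"
      proof
        assume "\<exists>d'\<in>?D. \<forall>i\<in>{- int n..-1}. d' i = trunc n d i"
        then obtain d' where d': "d' \<in> ?D" and eq: "\<And>i. - int n \<le> i \<Longrightarrow> i < 0 \<Longrightarrow> d' i = d i"
          by (auto simp: trunc_def)
        show "d \<in> ?D"
          using d d' eq unfolding decided_def by auto
      next
        assume "d \<in> ?D"
        then show "\<exists>d'\<in>?D. \<forall>i\<in>{- int n..-1}. d' i = trunc n d i"
          by (intro bexI[of _ d]) (auto simp: trunc_def)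
      qed
      moreover have "trunc n d \<in> topspace (E_from G n)"
        using d by (simp add: fibre_def trunc_closed)
      ultimately show ?thesis by (simp add: x_def indicator_def)
    qed
    have *: "complex_of_real (measure \<rho> ?D) = (LINT d|\<rho>. x (trunc n d))"
      if "is_fibre_measure c \<rho>" for \<rho>
    proof -
      interpret prob_space \<rho> using that by blast
      have sp: "space \<rho> = fibre G c" using that by blast
      have D: "?D \<in> sets \<rho>" using that openin_decided[of c U n] by (auto intro: sigma_sets.Basic)
      have "(LINT d|\<rho>. x (trunc n d)) = (LINT d|\<rho>. complex_of_real (indicator ?D d))"
        by (intro Bochner_Integration.integral_cong refl) (simp add: sp x indicator_def)
      also have "\<dots> = complex_of_real (LINT d|\<rho>. indicator ?D d)"
        by (rule integral_complex_of_real)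
      also have "\<dots> = complex_of_real (measure \<rho> ?D)"
        using D sets.sets_into_space[OF D] by (simp add: Int_absorb2)
      finally show ?thesis by simp
    qed
    have "(LINT d|\<mu>. x (trunc n d)) = (LINT d|\<nu>. x (trunc n d))"
      using \<mu> \<nu> xC by simp
    then show ?thesis using *[OF \<mu>] *[OF \<nu>] of_real_eq_iff by metis
  qed
  then have eq: "emeasure \<mu> (decided c U n) = emeasure \<nu> (decided c U n)" for n
    by (simp add: \<mu>.emeasure_eq_measure \<nu>.emeasure_eq_measure)
  have inc: "incseq (decided c U)" by (rule incseq_SucI) (rule decided_mono)
  have "emeasure \<mu> U = (SUP n. emeasure \<mu> (decided c U n))"
    using SUP_emeasure_incseq[of "decided c U" \<mu>] opens(1)[OF openin_decided] inc
    by (simp add: decided_Union[OF U] image_subset_iff)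
  also have "\<dots> = emeasure \<nu> U"
    using SUP_emeasure_incseq[of "decided c U" \<nu>] opens(2)[OF openin_decided] inc
    by (simp add: decided_Union[OF U] image_subset_iff eq)
  finally show "emeasure \<mu> U = emeasure \<nu> U" .
qed

lemma fibre_measure_eq:
  assumes c: "c \<in> paths"
  shows "fibre_measure G w c = past_law c"
  unfolding fibre_measure_def
proof (rule the_equality)
  show "is_fibre_measure c (past_law c)" by (rule past_law_is_fibre_measure[OF c])
  show "\<mu> = past_law c" if "is_fibre_measure c \<mu>" for \<mu>
    by (rule fibre_measure_unique[OF that past_law_is_fibre_measure[OF c]])
qed

lemma integral_fibre_measure:
  "c \<in> paths \<Longrightarrow> x \<in> C_two \<Longrightarrow> (LINT d|fibre_measure G w c. x d) = mean c x"
  by (simp add: fibre_measure_eq integral_past_law)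

end

section \<open>The module \<open>X\<^sub>\<infinity>(E)\<close> and the dilation\<close>

context weighted_digraph
begin

abbreviation "m \<equiv> filter_of G w"
abbreviation "XP \<equiv> X_pre G w"
abbreviation "dil \<equiv> dilation_pre G w"

lemma C_of_E_two_mult: "x \<in> C_two \<Longrightarrow> y \<in> C_two \<Longrightarrow> (\<lambda>d. cnj (x d) * y d) \<in> C_two"
  by (intro C_of_mult C_of_cnj)

lemma mean_add:
  assumes "c \<in> paths" "x \<in> C_two" "y \<in> C_two"
  shows "mean c (\<lambda>d. x d + y d) = mean c x + mean c y"
  unfolding mean_def using assms
  by (intro Bochner_Integration.integral_add C_of_join_integrable)

lemma mean_scale: "mean c (\<lambda>d. z * x d) = z * mean c x"
  by (simp add: mean_def)

lemma mean_cnj: "mean c (\<lambda>d. cnj (x d)) = cnj (mean c x)"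
  unfolding mean_def by (rule Bochner_Integration.integral_cnj)

lemma mean_cong:
  assumes "c \<in> paths"
    and "\<And>d. d \<in> two_paths \<Longrightarrow> trunc 0 d = c \<Longrightarrow> x d = y d"
  shows "mean c x = mean c y"
  unfolding mean_def
  by (intro Bochner_Integration.integral_cong refl assms(2) join_closed trunc_join assms(1))

lemma mean_const:
  assumes c: "c \<in> paths"
    and x: "\<And>d. d \<in> two_paths \<Longrightarrow> trunc 0 d = c \<Longrightarrow> x d = z"
  shows "mean c x = z"
proof -
  interpret prob_space choices by (rule prob_space_choices)
  have "mean c x = mean c (\<lambda>_. z)" by (rule mean_cong[OF c x])
  then show ?thesis by (simp add: mean_def prob_space[unfolded space_choices])
qed

lemma mean_norm_le:
  assumes c: "c \<in> paths" and x: "x \<in> C_two" and B: "\<And>d. cmod (x d) \<le> B"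
  shows "cmod (mean c x) \<le> B"
proof -
  interpret prob_space choices by (rule prob_space_choices)
  have "cmod (mean c x) \<le> (LINT \<omega>|choices. cmod (x (join c \<omega>)))"
    unfolding mean_def by (rule integral_norm_bound)
  also have "\<dots> \<le> (LINT \<omega>|choices. B)"
    by (rule integral_mono) (auto intro!: integrable_norm C_of_join_integrable c x B)
  also have "\<dots> = B" by (simp add: prob_space[unfolded space_choices])
  finally show ?thesis .
qed

lemma mean_nonneg:
  assumes "\<And>d. x d = of_real (r d)" "\<And>d. r d \<ge> 0"
  shows "mean c x \<in> \<real>\<^sub>\<ge>\<^sub>0"
proof -
  have "mean c x = of_real (LINT \<omega>|choices. r (join c \<omega>))"
    unfolding mean_def assms(1) by (rule integral_complex_of_real)
  moreover have "(LINT \<omega>|choices. r (join c \<omega>)) \<ge> 0" by (simp add: assms(2))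
  ultimately show ?thesis by simp
qed

text \<open>The isometric embedding of \<open>A = C(E\<^sup>\<infinity>)\<close> onto \<open>V\<^sub>0\<close>.\<close>

definition pull :: "((int \<Rightarrow> 'e) \<Rightarrow> complex) \<Rightarrow> (int \<Rightarrow> 'e) \<Rightarrow> complex" where
  "pull f = (\<lambda>d. if d \<in> two_paths then f (trunc 0 d) else 0)"

lemma trunc_0_closed: "d \<in> two_paths \<Longrightarrow> trunc 0 d \<in> paths"
  using trunc_closed[of d 0] by simp

lemma pull_closed: "f \<in> C_inf \<Longrightarrow> pull f \<in> C_two"
  using trunc_C_of[of f 0] by (simp add: pull_def)

lemma pull_add: "pull (\<lambda>c. f c + g c) = (\<lambda>d. pull f d + pull g d)"
  and pull_scale: "pull (\<lambda>c. z * f c) = (\<lambda>d. z * pull f d)"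
  and pull_zero: "pull (\<lambda>_. 0) = (\<lambda>_. 0)"
  by (auto simp: pull_def fun_eq_iff)

lemma pull_mult: "pull (\<lambda>c. f c * g c) = (\<lambda>d. pull f d * g (trunc 0 d))"
  by (auto simp: pull_def fun_eq_iff)

lemma act_eq_pull: "x \<in> C_two \<Longrightarrow> x d * f (trunc 0 d) = x d * pull f d"
  by (auto simp: pull_def C_of_outside)

lemma act_C_of:
  "x \<in> C_two \<Longrightarrow> f \<in> C_inf \<Longrightarrow> (\<lambda>d. x d * f (trunc 0 d)) \<in> C_two"
  by (simp add: act_eq_pull C_of_mult pull_closed)

lemma X_pre_simps:
  "hbase XP = E_inf G" "hcarrier XP = C_two" "hzero XP = (\<lambda>_. 0)"
  "hadd XP = (\<lambda>x y d. x d + y d)" "hscale XP = (\<lambda>z x d. z * x d)"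
  "hact XP = (\<lambda>x f d. x d * f (trunc 0 d))"
  "hminus XP = (\<lambda>x y d. x d - y d)"
  by (auto simp: X_pre_def hminus_def fun_eq_iff)

lemma X_pre_ip:
  assumes "x \<in> C_two" "y \<in> C_two"
  shows "hip XP x y = (\<lambda>c. if c \<in> paths then mean c (\<lambda>d. cnj (x d) * y d) else 0)"
  using integral_fibre_measure[OF _ C_of_E_two_mult[OF assms]] by (auto simp: X_pre_def fun_eq_iff)

lemma pre_hilbert_X_pre: "pre_hilbert_module XP"
proof (rule pre_hilbert_module.intro, unfold X_pre_simps)
  show "compact_space (E_inf G)" "Hausdorff_space (E_inf G)"
    by (simp_all add: compact_path_space Hausdorff_path_space)
  show "(\<lambda>d. x d * one_C (E_inf G) (trunc 0 d)) = x" if "x \<in> C_two" for x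
    using C_of_outside[OF that] trunc_0_closed by (auto simp: fun_eq_iff one_C_def indicator_def)
  show "hip XP x y \<in> C_inf" if "x \<in> C_two" "y \<in> C_two" for x y
    unfolding X_pre_ip[OF that] by (rule mean_continuous[OF C_of_E_two_mult[OF that]])
  show "hip XP x (\<lambda>d. y d + u d) = (\<lambda>c. hip XP x y c + hip XP x u c)"
    if "x \<in> C_two" "y \<in> C_two" "u \<in> C_two" for x y u
    using that by (auto simp: X_pre_ip C_of_add distrib_left mean_add C_of_E_two_mult fun_eq_iff)
  show "hip XP x (\<lambda>d. z * y d) = (\<lambda>c. z * hip XP x y c)"
    if "x \<in> C_two" "y \<in> C_two" for x y z
    using that by (auto simp: X_pre_ip C_of_scale fun_eq_iff mult.left_commute[of _ z] mean_scale)
  show "hip XP x (\<lambda>d. y d * f (trunc 0 d)) = (\<lambda>c. hip XP x y c * f c)"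
    if "x \<in> C_two" "y \<in> C_two" "f \<in> C_inf" for x y f
  proof
    fix c
    \<comment> \<open>Over the fibre of c, f(\<pi>_0(d)) is the constant f(c).\<close>
    have "mean c (\<lambda>d. cnj (x d) * (y d * f (trunc 0 d))) = mean c (\<lambda>d. f c * (cnj (x d) * y d))"
      if "c \<in> paths" by (rule mean_cong[OF that]) auto
    then show "hip XP x (\<lambda>d. y d * f (trunc 0 d)) c = hip XP x y c * f c"
      using that by (simp add: X_pre_ip act_C_of mean_scale)
  qed
  show "hip XP y x = (\<lambda>c. cnj (hip XP x y c))"
    if "x \<in> C_two" "y \<in> C_two" for x y
    using that by (auto simp: X_pre_ip fun_eq_iff mult.commute simp flip: mean_cnj)
  show "hip XP x x c \<in> \<real>\<^sub>\<ge>\<^sub>0" if "x \<in> C_two" for x c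
  proof -
    have "cnj (x d) * x d = of_real ((cmod (x d))\<^sup>2)" for d
      by (simp only: complex_norm_square mult.commute)
    then have "mean c (\<lambda>d. cnj (x d) * x d) \<in> \<real>\<^sub>\<ge>\<^sub>0"
      by (rule mean_nonneg) simp
    then show ?thesis using that by (simp add: X_pre_ip)
  qed
qed (auto simp: C_of_zero C_of_add C_of_scale act_C_of algebra_simps fun_eq_iff)

interpretation X: pre_hilbert_module "XP" by (rule pre_hilbert_X_pre)

interpretation XC: hilbert_module "completion XP" by (rule X.hilbert_completion)

lemma filter_of_eq: "m c = (if c \<in> paths then w (c 0) else 0)"
proof (cases "c \<in> paths")
  case True
  have "m c = (\<Sum>e\<in>arcs G. if c 0 = e then w e else 0)"
    unfolding filter_of_def using True by (intro sum.cong) (auto simp: cyl_def indicator_def)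
  also have "\<dots> = w (c 0)" using E_infD(1)[OF True, of 0] by (simp add: sum.delta)
  finally show ?thesis using True by simp
qed (auto simp: filter_of_def cyl_def)

lemma filter_of_closed: "m \<in> C_inf"
  by (rule C_of_locally_constantI[of _ _ _ "{0}"]) (auto simp: filter_of_eq)

section \<open>The dilation and its inverse on continuous functions\<close>

lemma dilation_eq: "x \<in> C_two \<Longrightarrow> dil x d = (if d \<in> two_paths then w (d 0) * x (two_shift d) else 0)"
  using C_of_outside[of x _ "two_shift d"] trunc_0_closed[of d]
  by (auto simp: dilation_pre_def filter_of_eq two_shift_iff trunc_def)

lemma dilation_closed:
  assumes "x \<in> C_two" shows "dil x \<in> C_two"
proof -
  have "dil x = (\<lambda>d. pull m d * x (two_shift d))"
    using assms trunc_0_closed by (auto simp: dilation_eq pull_def filter_of_eq trunc_def fun_eq_iff)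
  then show ?thesis
    using C_of_mult[OF pull_closed[OF filter_of_closed] two_shift_C_of[OF assms]] by simp
qed

text \<open>The inverse of D: the factor m(\<pi>_0(h^(-1)(d))) to be divided out is the weight of
  coordinate -1 of d, which is nonzero for every path d.\<close>

definition undilate :: "((int \<Rightarrow> 'e) \<Rightarrow> complex) \<Rightarrow> (int \<Rightarrow> 'e) \<Rightarrow> complex" where
  "undilate y = (\<lambda>d. y (\<lambda>i. d (i - 1)) / w (d (-1)))"

lemma two_shift_unshift: "two_shift (\<lambda>i. d (i - 1)) = d"
  by (simp add: two_shift_def)

lemma unshift_iff: "(\<lambda>i. d (i - 1)) \<in> two_paths \<longleftrightarrow> d \<in> two_paths"
  using two_shift_iff[of "\<lambda>i. d (i - 1)"] by (simp add: two_shift_unshift)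

lemma weight_nonzero: "d \<in> two_paths \<Longrightarrow> w (d i) \<noteq> 0"
  by (simp add: topspace_path_space_iff nonzero)

lemma undilate_closed:
  assumes "y \<in> C_two" shows "undilate y \<in> C_two"
proof -
  have "(\<lambda>d. if d \<in> two_paths then y (\<lambda>i. d (i - 1)) else 0) \<in> C_two"
    by (rule C_of_precompose[OF assms, where J = "\<lambda>i. {i - 1}"]) (auto simp: unshift_iff)
  moreover have "(\<lambda>d. if d \<in> two_paths then 1 / w (d (-1)) else 0) \<in> C_two"
    by (rule C_of_locally_constantI[of _ _ _ "{-1}"]) auto
  ultimately have "(\<lambda>d. (if d \<in> two_paths then y (\<lambda>i. d (i - 1)) else 0)
      * (if d \<in> two_paths then 1 / w (d (-1)) else 0)) \<in> C_two"
    by (rule C_of_mult)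
  also have "(\<lambda>d. (if d \<in> two_paths then y (\<lambda>i. d (i - 1)) else 0)
      * (if d \<in> two_paths then 1 / w (d (-1)) else 0)) = undilate y"
  proof
    fix d
    have "y (\<lambda>i. d (i - 1)) = 0" if "d \<notin> two_paths"
      using C_of_outside[OF assms, of "\<lambda>i. d (i - 1)"] that unshift_iff[of d] by blast
    then show "(if d \<in> two_paths then y (\<lambda>i. d (i - 1)) else 0)
      * (if d \<in> two_paths then 1 / w (d (-1)) else 0) = undilate y d"
      by (auto simp: undilate_def)
  qed
  finally show ?thesis .
qed

lemma dilation_undilate:
  assumes "y \<in> C_two" shows "dil (undilate y) = y"
proof
  fix d
  show "dil (undilate y) d = y d"
    unfolding dilation_eq[OF undilate_closed[OF assms]]
    using C_of_outside[OF assms, of d] weight_nonzero[of d 0]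
    by (simp add: undilate_def two_shift_def)
qed

lemma undilate_dilation:
  assumes "x \<in> C_two" shows "undilate (dil x) = x"
proof
  fix d
  show "undilate (dil x) d = x d"
    using C_of_outside[OF assms, of d] weight_nonzero[of d "-1"] unshift_iff[of d]
    by (auto simp: undilate_def dilation_eq assms two_shift_unshift)
qed

text \<open>Over the fibre of ec the two dilations contribute the constant |w(e)|^2. Divided by the
  number of arcs averaged over, it is the probability of e, and the average becomes the right side
  of \<open>mean_markov\<close>.\<close>

lemma dilation_isometric:
  assumes x: "x \<in> C_two" and y: "y \<in> C_two"
  shows "transfer G (hip XP (dil x) (dil y)) = hip XP x y"
proof
  fix c
  show "transfer G (hip XP (dil x) (dil y)) c = hip XP x y c"
  proof (cases "c \<in> paths")
    case True
    let ?v = "path_range G c" and ?F = "\<lambda>d. cnj (x d) * y d"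
    have "1 / of_nat (card (out_arcs G ?v)) * hip XP (dil x) (dil y) (path_cons e c)
        = of_real (arc_prob ?v e) * mean (path_cons e c) (\<lambda>d. ?F (two_shift d))" if e: "e \<in> out_arcs G ?v" for e
    proof -
      have ec: "path_cons e c \<in> paths" by (rule path_cons_closed[OF True e])
      have "mean (path_cons e c) (\<lambda>d. cnj (dil x d) * dil y d)
          = mean (path_cons e c) (\<lambda>d. of_real ((cmod (w e))\<^sup>2) * ?F (two_shift d))"
      proof (rule mean_cong[OF ec])
        fix d assume d: "d \<in> two_paths" "trunc 0 d = path_cons e c"
        have "d 0 = e" using fun_cong[OF d(2), of 0] by (simp add: trunc_def path_cons_def)
        then show "cnj (dil x d) * dil y d = of_real ((cmod (w e))\<^sup>2) * ?F (two_shift d)"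
          using d x y by (simp only: dilation_eq complex_norm_square) simp
      qed
      also have "\<dots> = of_real ((cmod (w e))\<^sup>2) * mean (path_cons e c) (\<lambda>d. ?F (two_shift d))"
        by (rule mean_scale)
      finally show ?thesis
        using e ec x y by (simp add: X_pre_ip dilation_closed arc_prob_def)
    qed
    then have "(\<Sum>e\<in>out_arcs G ?v. 1 / of_nat (card (out_arcs G ?v)) *
          hip XP (dil x) (dil y) (path_cons e c))
        = (\<Sum>e\<in>out_arcs G ?v. of_real (arc_prob ?v e) * mean (path_cons e c) (\<lambda>d. ?F (two_shift d)))"
      by (intro sum.cong refl)
    also have "\<dots> = mean c ?F"
      by (rule mean_markov[OF True C_of_E_two_mult[OF x y], symmetric])
    finally show ?thesis
      using True by (simp add: transfer_def X_pre_ip[OF x y] sum_distrib_left)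
  qed (use x y in \<open>simp add: transfer_def X_pre_ip\<close>)
qed

lemma shift_endo_trunc:
  "d \<in> two_paths \<Longrightarrow> shift_endo G f (trunc 0 d) = f (trunc 0 (two_shift d))"
proof -
  assume d: "d \<in> two_paths"
  have "path_shift (trunc 0 d) = trunc 0 (two_shift d)"
    by (auto simp: path_shift_def trunc_def two_shift_def fun_eq_iff)
  then show ?thesis using trunc_0_closed[OF d] by (simp add: shift_endo_def)
qed

text \<open>The range is all of \<open>C_two\<close>, by \<open>undilate\<close>. Compatibility with
  the twisted action is the relation \<pi>_0 \<circ> h = \<sigma> \<circ> \<pi>_0.\<close>

lemma dense_isometry_dilation: "dense_isometry XP (twist_L G XP) (dil)"
proof -
  interpret T: pre_hilbert_module "twist_L G XP"
    by (rule pre_hilbert_twist[OF pre_hilbert_X_pre]) (simp add: X_pre_simps)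
  show ?thesis
  proof (unfold_locales, unfold twist_L_simps X_pre_simps)
    show "dil (\<lambda>d. x d * f (trunc 0 d)) = (\<lambda>d. dil x d * shift_endo G f (trunc 0 d))"
      if "x \<in> C_two" "f \<in> C_inf" for x f
      using that by (auto simp: fun_eq_iff dilation_eq act_C_of shift_endo_trunc)
    show "\<exists>x\<in>C_two. hnorm (twist_L G XP) (\<lambda>d. v d - dil x d) < \<epsilon>"
      if "v \<in> C_two" "\<epsilon> > 0" for v \<epsilon>
      using that T.hdist_self[of v]
      by (intro bexI[of _ "undilate v"]) (simp_all add: dilation_undilate undilate_closed twist_L_simps X_pre_simps)
  qed (auto simp: C_of_add C_of_scale act_C_of dilation_closed dilation_eq fun_eq_iff algebra_simps
      dilation_isometric)
qed

interpretation Dil: dense_isometry "XP" "twist_L G XP" "dil"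
  by (rule dense_isometry_dilation)

subsection \<open>The direct limit\<close>

text \<open>\<open>level k n\<close> represents \<open>D\<^sup>-\<^sup>k(\<phi> \<cdot> n)\<close>, so that \<open>V\<^sub>k\<close> is the image of \<open>level k\<close>.\<close>

definition level :: "nat \<Rightarrow> ((int \<Rightarrow> 'e) \<Rightarrow> complex) \<Rightarrow> (int \<Rightarrow> 'e) \<Rightarrow> complex" where
  "level k n = (undilate ^^ k) (pull n)"

lemma level_0: "level 0 n = pull n"
  by (simp add: level_def)

lemma level_Suc: "level (Suc k) n = undilate (level k n)"
  by (simp add: level_def)

lemma level_closed: "n \<in> C_inf \<Longrightarrow> level k n \<in> C_two"
  by (induction k) (auto simp: level_def pull_closed undilate_closed)

lemma level_add: "level k (\<lambda>c. n c + n' c) = (\<lambda>d. level k n d + level k n' d)"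
  by (induction k) (auto simp: level_def pull_add undilate_def add_divide_distrib)

lemma level_scale: "level k (\<lambda>c. z * n c) = (\<lambda>d. z * level k n d)"
  by (induction k) (auto simp: level_def pull_scale undilate_def)

lemma level_zero: "level k (\<lambda>_. 0) = (\<lambda>_. 0)"
  by (induction k) (auto simp: level_def pull_zero undilate_def)

text \<open>Again \<pi>_0 \<circ> h = \<sigma> \<circ> \<pi>_0: one \<alpha> is cancelled when
  D^(-1) passes the action.\<close>

lemma undilate_act:
  assumes y: "y \<in> C_two"
  shows "undilate (\<lambda>d. y d * shift_endo G f (trunc 0 d)) = (\<lambda>d. undilate y d * f (trunc 0 d))"
proof
  fix d
  show "undilate (\<lambda>d. y d * shift_endo G f (trunc 0 d)) d = undilate y d * f (trunc 0 d)"
  proof (cases "d \<in> two_paths")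
    case True
    then have "shift_endo G f (trunc 0 (\<lambda>i. d (i - 1))) = f (trunc 0 d)"
      using shift_endo_trunc[of "\<lambda>i. d (i - 1)" f] by (simp add: unshift_iff two_shift_unshift)
    then show ?thesis by (simp add: undilate_def)
  next
    case False
    then have "y (\<lambda>i. d (i - 1)) = 0"
      using C_of_outside[OF y, of "\<lambda>i. d (i - 1)"] unshift_iff[of d] by blast
    then show ?thesis by (simp add: undilate_def)
  qed
qed

lemma level_act:
  assumes "n \<in> C_inf"
  shows "level k (\<lambda>c. n c * (shift_endo G ^^ k) f c) = (\<lambda>d. level k n d * f (trunc 0 d))"
\<comment> \<open>f varies because the induction step applies the hypothesis to \<alpha>(f).\<close>
proof (induction k arbitrary: f)
  case 0
  then show ?case by (simp add: level_def pull_mult)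
next
  case (Suc k)
  have "level (Suc k) (\<lambda>c. n c * (shift_endo G ^^ Suc k) f c)
      = undilate (level k (\<lambda>c. n c * (shift_endo G ^^ k) (shift_endo G f) c))"
    by (simp add: level_Suc funpow_swap1)
  also have "\<dots> = (\<lambda>d. level (Suc k) n d * f (trunc 0 d))"
    by (simp add: Suc.IH level_Suc undilate_act level_closed assms)
  finally show ?case .
qed

lemma pull_ip:
  assumes "n \<in> C_inf" "n' \<in> C_inf"
  shows "hip XP (pull n) (pull n') = (\<lambda>c. cnj (n c) * n' c)"
proof
  fix c
  show "hip XP (pull n) (pull n') c = cnj (n c) * n' c"
    unfolding X_pre_ip[OF pull_closed[OF assms(1)] pull_closed[OF assms(2)]]
    using C_of_outside[OF assms(1), of c] by (auto simp: pull_def intro!: mean_const)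
qed

text \<open>Each D^(-1) costs one application of L, since D is isometric for the twisted product;
  after k of them the inner product of M_(L^k) appears.\<close>

lemma level_ip:
  assumes "n \<in> C_inf" "n' \<in> C_inf"
  shows "hip XP (level k n) (level k n') = (transfer G ^^ k) (\<lambda>c. cnj (n c) * n' c)"
proof (induction k)
  case 0
  then show ?case by (simp add: level_def pull_ip assms)
next
  case (Suc k)
  have "hip XP (level (Suc k) n) (level (Suc k) n')
      = transfer G (hip XP (level k n) (level k n'))"
    using dilation_isometric[of "level (Suc k) n" "level (Suc k) n'"] assms
    by (simp add: level_closed undilate_closed level_Suc dilation_undilate)
  then show ?case by (simp add: Suc.IH)
qed

lemma filter_tensor_eq: "filter_tensor G m k n = (\<lambda>c. m c * shift_endo G n c)"
  by (simp add: filter_tensor_def M_pow_def tensor_def)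

lemma filter_tensor_closed:
  "n \<in> C_inf \<Longrightarrow> filter_tensor G m k n \<in> C_inf"
  by (simp add: filter_tensor_eq C_of_mult filter_of_closed shift_endo_closed)

lemma dilation_pull:
  assumes "n \<in> C_inf"
  shows "dil (pull n) = pull (\<lambda>c. m c * shift_endo G n c)"
proof
  fix d :: "int \<Rightarrow> 'e"
  have "trunc 0 d 0 = d 0" by (simp add: trunc_def)
  then show "dil (pull n) d = pull (\<lambda>c. m c * shift_endo G n c) d"
    unfolding dilation_eq[OF pull_closed[OF assms]]
    by (simp add: pull_def filter_of_eq shift_endo_trunc two_shift_iff trunc_0_closed)
qed

text \<open>D carries the pulled-back n to the pulled-back m\<alpha>(n), and one D^(-1) undoes this.
  The maps of the direct system thus become inclusions of function spaces. The index j is free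
  because the connecting map has one formula at all stages, stage 0 included.\<close>

lemma level_filter_tensor:
  assumes "n \<in> C_inf"
  shows "level (Suc k) (filter_tensor G m j n) = level k n"
proof -
  have "level (Suc k) (filter_tensor G m j n) = (undilate ^^ k) (undilate (dil (pull n)))"
    using assms by (simp add: level_def funpow_swap1 filter_tensor_eq dilation_pull)
  then show ?thesis using assms by (simp add: undilate_dilation pull_closed level_def)
qed

section \<open>The algebraic limit realised by functions\<close>

abbreviation "lim_rel \<equiv> limit_rel (M_pow G) (filter_tensor G m)"

abbreviation "alg_lim \<equiv> alg_limit (M_pow G) (filter_tensor G m)"

abbreviation "ftpush \<equiv> push (filter_tensor G m)"

definition realize :: "(nat \<times> ((int \<Rightarrow> 'e) \<Rightarrow> complex)) set \<Rightarrow> (int \<Rightarrow> 'e) \<Rightarrow> complex" where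
  "realize p = (case rep p of (k, n) \<Rightarrow> level k n)"

lemma limit_union_iff: "(k, n) \<in> limit_union (M_pow G) \<longleftrightarrow> n \<in> C_inf"
  by (simp add: limit_union_def M_pow_def)

text \<open>The two ends of a generating pair (k, n), (k + 1, T_k n) have the same function, and so
  have the ends of every zigzag of such pairs. This makes \<open>realize\<close> independent of the
  representative.\<close>

lemma limit_rel_level:
  assumes "((k, n), (l, n')) \<in> lim_rel"
  shows "n' \<in> C_inf" "level l n' = level k n"
proof -
  define R where "R = {((k, n), (Suc k, filter_tensor G m k n)) | k n. n \<in> hcarrier (M_pow G k)}"
  have r: "((k, n), (l, n')) \<in> (R \<union> R\<inverse>)\<^sup>*" and u: "n' \<in> C_inf"
    using assms by (auto simp: limit_rel_def R_def Let_def limit_union_iff)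
  show "n' \<in> C_inf" by (fact u)
  have "case q of (l, n') \<Rightarrow> level l n' = level k n" if "((k, n), q) \<in> (R \<union> R\<inverse>)\<^sup>*" for q
    using that
  proof (induction rule: rtrancl_induct)
    case base
    then show ?case by simp
  next
    case (step y z)
    obtain i x where "x \<in> C_inf"
      "(y, z) = ((i, x), (Suc i, filter_tensor G m i x)) \<or>
       (z, y) = ((i, x), (Suc i, filter_tensor G m i x))"
      using step.hyps(2) by (auto simp: R_def M_pow_def)
    then show ?case using step.IH level_filter_tensor[of x i i] by auto
  qed
  from this[OF r] show "level l n' = level k n" by simp
qed

lemma limit_rel_refl: "n \<in> C_inf \<Longrightarrow> ((k, n), (k, n)) \<in> lim_rel"
  by (simp add: limit_rel_def Let_def limit_union_iff)

lemma rep_limit_class: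
  assumes "n \<in> C_inf"
  obtains l n' where "rep (lim_rel `` {(k, n)}) = (l, n')" "n' \<in> C_inf" "level l n' = level k n"
proof -
  obtain l n' where r: "rep (lim_rel `` {(k, n)}) = (l, n')" by (cases "rep (lim_rel `` {(k, n)})")
  have "(k, n) \<in> lim_rel `` {(k, n)}" using limit_rel_refl[OF assms] by simp
  then have "rep (lim_rel `` {(k, n)}) \<in> lim_rel `` {(k, n)}"
    unfolding rep_def by (metis someI)
  then have "((k, n), (l, n')) \<in> lim_rel" by (simp add: r)
  then show thesis using that[OF r] limit_rel_level by blast
qed

lemma realize_class: "n \<in> C_inf \<Longrightarrow> realize (lim_rel `` {(k, n)}) = level k n"
  by (erule rep_limit_class[of n k]) (simp add: realize_def)

lemma alg_lim_class: "n \<in> C_inf \<Longrightarrow> lim_rel `` {(k, n)} \<in> hcarrier alg_lim"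
  by (simp add: alg_limit_def quotientI limit_union_iff)

lemma alg_lim_rep:
  assumes "p \<in> hcarrier alg_lim"
  obtains k n where "rep p = (k, n)" "n \<in> C_inf" "realize p = level k n"
proof -
  obtain k n where p: "p = lim_rel `` {(k, n)}" "n \<in> C_inf"
    using assms by (auto simp: alg_limit_def limit_union_iff elim!: quotientE)
  obtain l n' where "rep p = (l, n')" "n' \<in> C_inf"
    using rep_limit_class[OF p(2)] p(1) by metis
  then show thesis using that by (simp add: realize_def)
qed

lemma push_level:
  assumes "n \<in> C_inf"
  shows "ftpush k j n \<in> C_inf \<and> level (k + j) (ftpush k j n) = level k n"
  by (induction j) (auto simp: assms filter_tensor_closed level_filter_tensor)

text \<open>Addition and inner product push both arguments to stage max k l. The last two parts
  serve the second argument, for which the maximum is taken in the other order.\<close>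

lemma push_max:
  assumes "n \<in> C_inf"
  shows "ftpush k (max k l - k) n \<in> C_inf" "level (max k l) (ftpush k (max k l - k) n) = level k n"
    "ftpush k (max l k - k) n \<in> C_inf" "level (max l k) (ftpush k (max l k - k) n) = level k n"
  using push_level[OF assms, of k "max k l - k"] by (auto simp: max.commute)

lemma realize_closed: "p \<in> hcarrier alg_lim \<Longrightarrow> realize p \<in> C_two"
  by (erule alg_lim_rep) (simp add: level_closed)

lemma alg_lim_add:
  assumes "p \<in> hcarrier alg_lim" "q \<in> hcarrier alg_lim"
  shows "hadd alg_lim p q \<in> hcarrier alg_lim"
    "realize (hadd alg_lim p q) = (\<lambda>d. realize p d + realize q d)"
proof -
  obtain k n where p: "rep p = (k, n)" "n \<in> C_inf" "realize p = level k n"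
    using assms(1) by (rule alg_lim_rep)
  obtain l n' where q: "rep q = (l, n')" "n' \<in> C_inf" "realize q = level l n'"
    using assms(2) by (rule alg_lim_rep)
  let ?u = "\<lambda>c. ftpush k (max k l - k) n c + ftpush l (max k l - l) n' c"
  have u: "?u \<in> C_inf" using p q by (intro C_of_add push_max)
  have a: "hadd alg_lim p q = lim_rel `` {(max k l, ?u)}"
    by (simp add: alg_limit_def p q Let_def M_pow_def)
  show "hadd alg_lim p q \<in> hcarrier alg_lim" unfolding a by (rule alg_lim_class[OF u])
  show "realize (hadd alg_lim p q) = (\<lambda>d. realize p d + realize q d)"
    unfolding a realize_class[OF u] using p q by (simp add: level_add push_max)
qed

lemma alg_lim_scale:
  assumes "p \<in> hcarrier alg_lim"
  shows "hscale alg_lim z p \<in> hcarrier alg_lim" "realize (hscale alg_lim z p) = (\<lambda>d. z * realize p d)"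
proof -
  obtain k n where p: "rep p = (k, n)" "n \<in> C_inf" "realize p = level k n"
    using assms(1) by (rule alg_lim_rep)
  have u: "(\<lambda>c. z * n c) \<in> C_inf" using p by (simp add: C_of_scale)
  have a: "hscale alg_lim z p = lim_rel `` {(k, \<lambda>c. z * n c)}"
    by (simp add: alg_limit_def p M_pow_def)
  show "hscale alg_lim z p \<in> hcarrier alg_lim" unfolding a by (rule alg_lim_class[OF u])
  show "realize (hscale alg_lim z p) = (\<lambda>d. z * realize p d)"
    unfolding a realize_class[OF u] using p by (simp add: level_scale)
qed

lemma alg_lim_act:
  assumes "p \<in> hcarrier alg_lim" "f \<in> C_inf"
  shows "hact alg_lim p f \<in> hcarrier alg_lim" "realize (hact alg_lim p f) = (\<lambda>d. realize p d * f (trunc 0 d))"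
proof -
  obtain k n where p: "rep p = (k, n)" "n \<in> C_inf" "realize p = level k n"
    using assms(1) by (rule alg_lim_rep)
  let ?u = "\<lambda>c. n c * (shift_endo G ^^ k) f c"
  have u: "?u \<in> C_inf" using p assms(2) by (simp add: C_of_mult shift_endo_funpow_closed)
  have a: "hact alg_lim p f = lim_rel `` {(k, ?u)}"
    by (simp add: alg_limit_def p M_pow_def)
  show "hact alg_lim p f \<in> hcarrier alg_lim" unfolding a by (rule alg_lim_class[OF u])
  show "realize (hact alg_lim p f) = (\<lambda>d. realize p d * f (trunc 0 d))"
    unfolding a realize_class[OF u] using p by (simp add: level_act)
qed

lemma alg_lim_ip:
  assumes "p \<in> hcarrier alg_lim" "q \<in> hcarrier alg_lim"
  shows "hip alg_lim p q = hip XP (realize p) (realize q)"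
proof -
  obtain k n where p: "rep p = (k, n)" "n \<in> C_inf" "realize p = level k n"
    using assms(1) by (rule alg_lim_rep)
  obtain l n' where q: "rep q = (l, n')" "n' \<in> C_inf" "realize q = level l n'"
    using assms(2) by (rule alg_lim_rep)
  have "hip alg_lim p q = (transfer G ^^ max k l)
      (\<lambda>c. cnj (ftpush k (max k l - k) n c) * ftpush l (max k l - l) n' c)"
    by (simp add: alg_limit_def p q Let_def M_pow_def)
  also have "\<dots> = hip XP (level (max k l) (ftpush k (max k l - k) n)) (level (max k l) (ftpush l (max k l - l) n'))"
    using p q by (simp add: level_ip push_max(1,3))
  also have "\<dots> = hip XP (realize p) (realize q)"
    using p q by (simp add: push_max)
  finally show ?thesis .
qed

subsection \<open>Density of the levels\<close>

lemma dilation_funpow_closed: "y \<in> C_two \<Longrightarrow> (dil ^^ k) y \<in> C_two"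
  by (induction k) (auto simp: dilation_closed)

text \<open>Iterating D multiplies the values of m along the orbit, which are the weights of the
  coordinates 0 to k - 1 of d, and moves y by h^k.\<close>

lemma dilation_funpow:
  assumes "y \<in> C_two" "d \<in> two_paths"
  shows "(dil ^^ k) y d = (\<Prod>i<k. w (d (int i))) * y (\<lambda>i. d (i + int k))"
  using assms(2)
proof (induction k arbitrary: d)
  case 0
  then show ?case by simp
next
  case (Suc k)
  have "(dil ^^ Suc k) y d = w (d 0) * (dil ^^ k) y (two_shift d)"
    using Suc.prems assms(1) by (simp add: dilation_eq dilation_funpow_closed)
  also have "\<dots> = w (d 0) * ((\<Prod>i<k. w (two_shift d (int i))) * y (\<lambda>i. two_shift d (i + int k)))"
    by (simp add: Suc.IH two_shift_closed Suc.prems)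
  also have "\<dots> = (\<Prod>i<Suc k. w (d (int i))) * y (\<lambda>i. d (i + int (Suc k)))"
  proof -
    have "(\<Prod>i<Suc k. w (d (int i))) = w (d 0) * (\<Prod>i<k. w (d (int i + 1)))"
      by (subst prod.lessThan_Suc_shift) (simp add: add.commute)
    then show ?thesis by (simp add: two_shift_def ac_simps del: prod.lessThan_Suc)
  qed
  finally show ?case .
qed

lemma dilation_level: "n \<in> C_inf \<Longrightarrow> (dil ^^ k) (level k n) = pull n"
proof (induction k)
  case 0
  then show ?case by (simp add: level_def)
next
  case (Suc k)
  have "(dil ^^ Suc k) (level (Suc k) n)
      = (dil ^^ k) (dil (undilate (level k n)))"
    by (simp only: level_Suc funpow_Suc_right comp_apply)
  then show ?case using Suc by (simp only: dilation_undilate level_closed)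
qed

lemma shift_by_closed: "d \<in> two_paths \<Longrightarrow> (\<lambda>i. d (i + j)) \<in> two_paths"
  unfolding topspace_path_space_iff by (auto simp: ac_simps)

text \<open>D^k pushes the finitely many coordinates that matter for y, up to \<epsilon>, to
  nonnegative positions. Replacing the past by a fixed continuous choice then yields a function n of
  the path from 0 on, and \<open>level k n\<close> is close to y in the supremum norm.\<close>

lemma level_dense:
  assumes y: "y \<in> C_two" and "\<epsilon> > 0"
  obtains k n where "n \<in> C_inf" "\<And>d. cmod (y d - level k n d) \<le> \<epsilon>"
proof -
  obtain J where J: "finite J" "J \<subseteq> UNIV" "\<And>d d'. d \<in> two_paths \<Longrightarrow> d' \<in> two_paths \<Longrightarrow>
      \<forall>i\<in>J. d i = d' i \<Longrightarrow> cmod (y d - y d') < \<epsilon>"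
    using C_of_uniformly_continuous[OF finite_arcs y \<open>\<epsilon> > 0\<close>] by blast
  \<comment> \<open>Every coordinate in J is then at least -k; the inserted 0 covers an empty
    J.\<close>
  define k where "k = Max (insert 0 ((\<lambda>i. nat (- i)) ` J))"
  have k: "i \<ge> - int k" if "i \<in> J" for i
  proof -
    have "nat (- i) \<le> k" unfolding k_def using J(1) that by (intro Max_ge) auto
    then show ?thesis by linarith
  qed
  \<comment> \<open>Any fixed sequence of choices will do: \<open>clip\<close> makes the
    prolongation a path for each of them.\<close>
  define \<omega> where "\<omega> = (undefined :: ('v \<Rightarrow> 'e) stream)"
  define n where "n = (\<lambda>c. if c \<in> paths then (dil ^^ k) y (join c \<omega>) else 0)"
  have n: "n \<in> C_inf"
    unfolding n_def
    \<comment> \<open>Coordinate i of the prolongation is c i for i at least 0; below, it depends on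
      c only through r(c), that is through c 0.\<close>
    by (rule C_of_precompose[OF dilation_funpow_closed[OF y] join_closed, where J = "\<lambda>i. {0, max i 0}"])
      (auto simp: join_def path_range_def max_def)
  have "cmod (y d - level k n d) \<le> \<epsilon>" for d
  proof (cases "d \<in> two_paths")
    case True
    define e where "e = (\<lambda>i. d (i - int k))"
    have e: "e \<in> two_paths" using shift_by_closed[OF True, of "- int k"] by (simp add: e_def)
    let ?e = "join (trunc 0 e) \<omega>"
    have te: "trunc 0 e \<in> paths" by (rule trunc_0_closed[OF e])
    have e': "?e \<in> two_paths" by (rule join_closed[OF te])
    have eq: "?e i = e i" if "i \<ge> 0" for i using that by (simp add: join_def trunc_def)
    have ek: "(\<lambda>i. e (i + int k)) = d" by (simp add: e_def)
    \<comment> \<open>Both functions are compared after D^k, at e = h^(-k)(d). The weights in front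
      involve only the coordinates 0 to k - 1, where e and its modification agree; being nonzero,
      they cancel.\<close>
    have "(\<Prod>i<k. w (e (int i))) * level k n d = (dil ^^ k) (level k n) e"
      by (simp add: dilation_funpow level_closed n e ek)
    also have "\<dots> = n (trunc 0 e)" using e by (simp add: dilation_level n pull_def)
    also have "\<dots> = (dil ^^ k) y ?e" using te by (simp add: n_def)
    also have "\<dots> = (\<Prod>i<k. w (e (int i))) * y (\<lambda>i. ?e (i + int k))"
      by (simp add: dilation_funpow y e' eq)
    finally have "level k n d = y (\<lambda>i. ?e (i + int k))"
      using weight_nonzero[OF e] by simp
    moreover have "cmod (y d - y (\<lambda>i. ?e (i + int k))) < \<epsilon>"
    proof (rule J(3)[OF True shift_by_closed[OF e']], intro ballI)
      fix i assume "i \<in> J"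
      then show "d i = ?e (i + int k)" using k[of i] eq[of "i + int k"] by (simp add: e_def)
    qed
    ultimately show ?thesis by simp
  next
    case False
    then show ?thesis
      using C_of_outside[OF y False] C_of_outside[OF level_closed[OF n] False] \<open>\<epsilon> > 0\<close> by simp
  qed
  then show thesis using that n by blast
qed

text \<open>The fibre measures have mass 1, so approximation in the supremum norm gives
  approximation in the module norm.\<close>

lemma X_pre_norm_le:
  assumes x: "x \<in> C_two" and B: "B \<ge> 0" "\<And>d. cmod (x d) \<le> B"
  shows "hnorm XP x \<le> B"
proof (rule X.hnorm_le[OF B(1)])
  fix c assume c: "c \<in> topspace (hbase XP)"
  have "cmod (cnj (x d) * x d) \<le> B\<^sup>2" for d
    using B by (simp add: norm_mult power2_eq_square mult_mono)
  then show "cmod (hip XP x x c) \<le> B\<^sup>2"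
    using c x by (auto simp: X_pre_simps X_pre_ip intro!: mean_norm_le C_of_E_two_mult)
qed

lemma dense_isometry_realize: "dense_isometry alg_lim XP realize"
proof (unfold_locales, unfold X_pre_simps)
  show "hbase alg_lim = E_inf G" by (simp add: alg_limit_def M_pow_def)
  show "\<exists>p\<in>hcarrier alg_lim. hnorm XP (\<lambda>d. v d - realize p d) < \<epsilon>"
    if v: "v \<in> C_two" and e: "\<epsilon> > 0" for v \<epsilon>
  proof -
    obtain k n where n: "n \<in> C_inf" and d: "\<And>d. cmod (v d - level k n d) \<le> \<epsilon> / 2"
      using level_dense[OF v half_gt_zero[OF e]] by blast
    have "(\<lambda>d. v d - level k n d) \<in> C_two"
      using X.minus_closed[of v "level k n"] v level_closed[OF n] by (simp add: X_pre_simps)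
    then have "hnorm XP (\<lambda>d. v d - level k n d) \<le> \<epsilon> / 2"
      using e by (intro X_pre_norm_le d) auto
    then show ?thesis
      using e n by (intro bexI[of _ "lim_rel `` {(k, n)}"]) (simp_all add: realize_class alg_lim_class)
  qed
qed (auto simp: alg_lim_add alg_lim_scale alg_lim_act alg_lim_ip realize_closed)

interpretation Re: dense_isometry alg_lim "XP" realize
  by (rule dense_isometry_realize)

subsection \<open>The multi-resolution analysis\<close>

abbreviation "XI \<equiv> X_inf G w"
abbreviation "emb \<equiv> to_completion XP"
abbreviation "DI \<equiv> Dil.extension"

lemma X_inf_hilbert: "hilbert_module XI"
  unfolding X_inf_def by (rule XC.hilbert_module_axioms)

interpretation XI: hilbert_module XI by (rule X_inf_hilbert)

lemma X_inf_base: "hbase XI = E_inf G"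
  by (simp add: X_inf_def X.completion_base X_pre_simps)

lemma emb_closed: "x \<in> C_two \<Longrightarrow> emb x \<in> hcarrier XI"
  using X.to_completion_closed[of x] by (simp add: X_inf_def X_pre_simps)

lemma emb_ops:
  "x \<in> C_two \<Longrightarrow> y \<in> C_two \<Longrightarrow> hadd XI (emb x) (emb y) = emb (\<lambda>d. x d + y d)"
  "x \<in> C_two \<Longrightarrow> hscale XI z (emb x) = emb (\<lambda>d. z * x d)"
  "x \<in> C_two \<Longrightarrow> f \<in> C_inf \<Longrightarrow> hact XI (emb x) f = emb (\<lambda>d. x d * f (trunc 0 d))"
  "x \<in> C_two \<Longrightarrow> y \<in> C_two \<Longrightarrow> hip XI (emb x) (emb y) = hip XP x y"
  "hzero XI = emb (\<lambda>_. 0)"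
  using X.to_completion_add[of x y] X.to_completion_scale[of x z] X.to_completion_act[of x f]
    X.to_completion_ip[of x y] X.to_completion_zero
  by (simp_all add: X_inf_def X_pre_simps)

text \<open>\<open>Dil.extension\<close> yields classes for the twisted norm; as the null sequences
  agree, they are the classes that make up \<open>X_inf\<close>.\<close>

lemma DI_emb: "x \<in> C_two \<Longrightarrow> DI (emb x) = emb (dil x)"
  using Dil.extension_to_completion[of x] twist_null_rel[OF pre_hilbert_X_pre]
  by (simp add: X_pre_simps to_completion_def)

lemma DI_iso: "hilbert_iso XI (twist_L G XI) DI"
  unfolding X_inf_def
  by (rule twist_completion[OF pre_hilbert_X_pre _ Dil.extension_iso]) (simp add: X_pre_simps)

lemma DI_closed: "x \<in> hcarrier XI \<Longrightarrow> DI x \<in> hcarrier XI"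
  using DI_iso bij_betwE unfolding hilbert_iso_def linear_iso_def twist_L_simps by fast

lemma DI_add: "x \<in> hcarrier XI \<Longrightarrow> y \<in> hcarrier XI \<Longrightarrow> DI (hadd XI x y) = hadd XI (DI x) (DI y)"
  and DI_scale: "x \<in> hcarrier XI \<Longrightarrow> DI (hscale XI z x) = hscale XI z (DI x)"
  and DI_ip: "x \<in> hcarrier XI \<Longrightarrow> y \<in> hcarrier XI \<Longrightarrow> transfer G (hip XI (DI x) (DI y)) = hip XI x y"
  using DI_iso unfolding hilbert_iso_def linear_iso_def twist_L_simps by auto

lemma DI_pow_closed: "x \<in> hcarrier XI \<Longrightarrow> (DI ^^ k) x \<in> hcarrier XI"
  by (induction k) (auto simp: DI_closed)

lemma DI_pow_minus:
  assumes "x \<in> hcarrier XI" "y \<in> hcarrier XI"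
  shows "(DI ^^ k) (hminus XI x y) = hminus XI ((DI ^^ k) x) ((DI ^^ k) y)"
  by (induction k) (auto simp: assms hminus_def DI_add DI_scale DI_pow_closed XI.closed)

lemma DI_pow_ip:
  assumes "x \<in> hcarrier XI" "y \<in> hcarrier XI"
  shows "(transfer G ^^ k) (hip XI ((DI ^^ k) x) ((DI ^^ k) y)) = hip XI x y"
proof (induction k)
  case (Suc k)
  have "(transfer G ^^ Suc k) (hip XI ((DI ^^ Suc k) x) ((DI ^^ Suc k) y))
      = (transfer G ^^ k) (transfer G (hip XI (DI ((DI ^^ k) x)) (DI ((DI ^^ k) y))))"
    by (simp add: funpow_swap1)
  then show ?case by (simp only: DI_ip DI_pow_closed assms Suc.IH)
qed simp

text \<open>D^k preserves inner products up to an application of L^k, so equal images force the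
  difference to have length zero.\<close>

lemma DI_pow_inj:
  assumes "x \<in> hcarrier XI" "y \<in> hcarrier XI" "(DI ^^ k) x = (DI ^^ k) y"
  shows "x = y"
proof (rule XI.eqI_minus[OF assms(1,2)])
  have z: "(transfer G ^^ k) (\<lambda>_. 0) = (\<lambda>_. 0)" by (induction k) (auto simp: transfer_zero)
  have "hip XI (hminus XI ((DI ^^ k) x) ((DI ^^ k) y)) (hminus XI ((DI ^^ k) x) ((DI ^^ k) y)) = (\<lambda>_. 0)"
    using assms by (simp add: XI.minus_self DI_pow_closed XI.ip_zero XI.zero_closed)
  then show "hip XI (hminus XI x y) (hminus XI x y) = (\<lambda>_. 0)"
    using DI_pow_ip[of "hminus XI x y" "hminus XI x y" k] assms
    by (simp add: DI_pow_minus XI.closed z)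
qed

lemma DI_pow_emb: "x \<in> C_two \<Longrightarrow> (DI ^^ k) (emb x) = emb ((dil ^^ k) x)"
  by (induction k) (auto simp: DI_emb dilation_funpow_closed)

abbreviation "\<phi> \<equiv> emb (one_C (E_two G))"

lemma phi_closed: "\<phi> \<in> hcarrier XI"
  by (rule emb_closed[OF C_of_one])

lemma phi_act:
  assumes "f \<in> C_inf"
  shows "hact XI \<phi> f = emb (pull f)"
proof -
  have "(\<lambda>d. one_C (E_two G) d * f (trunc 0 d)) = pull f"
    by (auto simp: pull_def one_C_def fun_eq_iff)
  then show ?thesis using emb_ops(3)[OF C_of_one assms] by simp
qed

lemma one_pull: "one_C (E_two G) = pull (one_C (E_inf G))"
  using trunc_0_closed by (auto simp: pull_def one_C_def indicator_def fun_eq_iff)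

lemma phi_ip: "hip XI \<phi> \<phi> = one_C (E_inf G)"
proof -
  have "hip XI \<phi> \<phi> = hip XP (pull (one_C (E_inf G))) (pull (one_C (E_inf G)))"
    by (simp add: emb_ops C_of_one flip: one_pull)
  also have "\<dots> = one_C (E_inf G)"
    unfolding pull_ip[OF C_of_one C_of_one] by (auto simp: one_C_def indicator_def)
  finally show ?thesis .
qed

lemma DI_phi: "DI \<phi> = hact XI \<phi> m"
proof -
  have "dil (one_C (E_two G)) = pull m"
    unfolding one_pull dilation_pull[OF C_of_one] shift_endo_one
    by (auto simp: pull_def fun_eq_iff one_C_def filter_of_eq)
  then show ?thesis by (simp add: DI_emb C_of_one phi_act filter_of_closed)
qed

section \<open>The resolution spaces\<close>

definition V :: "nat \<Rightarrow> (nat \<Rightarrow> (int \<Rightarrow> 'e) \<Rightarrow> complex) set set" where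
  "V k = (\<lambda>n. emb (level k n)) ` C_inf"

lemma V_I: "n \<in> C_inf \<Longrightarrow> emb (level k n) \<in> V k"
  by (simp add: V_def)

lemma V_carrier: "V k \<subseteq> hcarrier XI"
  by (auto simp: V_def emb_closed level_closed)

lemma V_zero: "hzero XI \<in> V k"
  using V_I[OF C_of_zero, of k] by (simp add: emb_ops level_zero)

lemma V_add: "x \<in> V k \<Longrightarrow> y \<in> V k \<Longrightarrow> hadd XI x y \<in> V k"
  by (auto simp: V_def emb_ops level_closed simp flip: level_add intro!: imageI C_of_add)

lemma V_scale: "x \<in> V k \<Longrightarrow> hscale XI z x \<in> V k"
  by (auto simp: V_def emb_ops level_closed simp flip: level_scale intro!: imageI C_of_scale)

lemma V_act: "x \<in> V k \<Longrightarrow> f \<in> C_inf \<Longrightarrow> hact XI x f \<in> V k"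
  by (auto simp: V_def emb_ops level_closed simp flip: level_act
      intro!: imageI C_of_mult shift_endo_funpow_closed)

text \<open>The connecting map T_k leaves the realised function unchanged, so the functions of stage
  k reappear at stage k + 1.\<close>

lemma V_Suc: "V k \<subseteq> V (Suc k)"
proof
  fix x assume "x \<in> V k"
  then obtain n where n: "n \<in> C_inf" "x = emb (level k n)" by (auto simp: V_def)
  then have "x = emb (level (Suc k) (filter_tensor G m k n))"
    by (simp add: level_filter_tensor)
  then show "x \<in> V (Suc k)" using V_I[OF filter_tensor_closed[OF n(1)]] by simp
qed

lemma DI_pow_level: "n \<in> C_inf \<Longrightarrow> (DI ^^ k) (emb (level k n)) = emb (pull n)"
  by (simp add: DI_pow_emb level_closed dilation_level)

text \<open>One inclusion evaluates D^k on a level. For the other, if D^k x is \<phi> \<cdot> n,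
  then x and \<open>level k n\<close> have the same image under the injective map D^k.\<close>

lemma V_preimage: "V k = {x \<in> hcarrier XI. (DI ^^ k) x \<in> V 0}"
proof (intro equalityI subsetI)
  fix x assume "x \<in> V k"
  then obtain n where n: "n \<in> C_inf" "x = emb (level k n)" by (auto simp: V_def)
  then show "x \<in> {x \<in> hcarrier XI. (DI ^^ k) x \<in> V 0}"
    using V_I[of n 0] by (simp add: DI_pow_level emb_closed level_closed level_0)
next
  fix x assume x: "x \<in> {x \<in> hcarrier XI. (DI ^^ k) x \<in> V 0}"
  then obtain n where n: "n \<in> C_inf" "(DI ^^ k) x = emb (pull n)" by (auto simp: V_def level_0)
  then have "(DI ^^ k) x = (DI ^^ k) (emb (level k n))" by (simp add: DI_pow_level)
  then have "x = emb (level k n)"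
    using x n by (intro DI_pow_inj[of x _ k]) (auto simp: emb_closed level_closed)
  then show "x \<in> V k" using n by (simp add: V_I)
qed

text \<open>The projection onto \<open>V\<^sub>0\<close> is \<open>y \<mapsto> \<phi> \<cdot> \<langle>\<phi>, y\<rangle>\<close>, and \<open>D\<^sup>-\<^sup>k\<close> carries its decomposition of
  \<open>D\<^sup>k x\<close> to the decomposition of \<open>x\<close> along \<open>V\<^sub>k\<close>.\<close>

lemma V_split:
  assumes x: "x \<in> hcarrier XI"
  shows "\<exists>p\<in>V k. \<exists>q\<in>orth_compl XI (V k). x = hadd XI p q"
proof -
  define y where "y = (DI ^^ k) x"
  define f where "f = hip XI \<phi> y"
  have y: "y \<in> hcarrier XI" using x by (simp add: y_def DI_pow_closed)
  have f: "f \<in> C_inf" using XI.ip_closed[OF phi_closed y] by (simp add: f_def X_inf_base)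
  define p where "p = emb (level k f)"
  have pV: "p \<in> V k" using f by (simp add: p_def V_I)
  then have p: "p \<in> hcarrier XI" using V_carrier by blast
  have Dp: "(DI ^^ k) p = hact XI \<phi> f" using f by (simp add: p_def DI_pow_level phi_act)
  define q where "q = hminus XI x p"
  have q: "q \<in> hcarrier XI" using x p by (simp add: q_def XI.closed)
  have Dq: "(DI ^^ k) q = hminus XI y (hact XI \<phi> f)"
    using x p by (simp add: q_def DI_pow_minus Dp flip: y_def)
  have z: "(transfer G ^^ k) (\<lambda>_. 0) = (\<lambda>_. 0)" by (induction k) (auto simp: transfer_zero)
  have "hip XI q v = (\<lambda>_. 0)" if vV: "v \<in> V k" for v
  proof -
    obtain g where g: "g \<in> C_inf" "v = emb (level k g)" using vV by (auto simp: V_def)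
    have v: "v \<in> hcarrier XI" using vV V_carrier by blast
    have Dv: "(DI ^^ k) v = hact XI \<phi> g" using g by (simp add: DI_pow_level phi_act)
    have "hip XI y \<phi> = (\<lambda>c. cnj (f c))" unfolding f_def by (rule XI.ip_cnj[OF phi_closed y])
    then have "hip XI ((DI ^^ k) q) ((DI ^^ k) v) = (\<lambda>c. (cnj (f c) - cnj (f c) * one_C (E_inf G) c) * g c)"
      using y f g(1) phi_closed
      by (simp add: Dq Dv XI.ip_minus_left XI.ip_act XI.ip_act_left XI.closed X_inf_base phi_ip algebra_simps)
    \<comment> \<open>\<open>one_C\<close> is 1 on the paths, where the first factor vanishes; off
      them g does.\<close>
    also have "\<dots> = (\<lambda>_. 0)"
      using C_of_outside[OF g(1)] by (auto simp: one_C_def indicator_def fun_eq_iff)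
    finally show ?thesis using DI_pow_ip[OF q v, of k] z by simp
  qed
  then have "q \<in> orth_compl XI (V k)" using q by (simp add: orth_compl_def)
  moreover have "x = hadd XI p q"
    using x p q by (intro XI.eqI_minus) (auto simp: q_def XI.closed XI.ip_expand fun_eq_iff)
  ultimately show ?thesis using pV by blast
qed

text \<open>The splitting along V_k is available in the whole module; for S containing V_k,
  \<open>complementedI\<close> keeps the orthogonal summand inside S. The cases of interest are the
  full carrier and V_(k+1).\<close>

lemma V_complemented:
  assumes "S \<subseteq> hcarrier XI" "V k \<subseteq> S"
    "\<And>x y. x \<in> S \<Longrightarrow> y \<in> S \<Longrightarrow> hadd XI x y \<in> S" "\<And>z x. x \<in> S \<Longrightarrow> hscale XI z x \<in> S"
  shows "complemented (hsubmod XI S) (V k)"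
proof (rule XI.complementedI)
  show "\<exists>p\<in>V k. \<exists>q\<in>orth_compl XI (V k). x = hadd XI p q" if "x \<in> S" for x
    using V_split assms(1) that by blast
qed (use assms in \<open>auto simp: V_zero V_add V_scale V_act X_inf_base\<close>)

text \<open>Continuous functions are dense in the completion, and the levels are dense among them
  for the supremum norm, which dominates the module norm.\<close>

lemma V_dense: "dense_in XI (\<Union>k. V k)"
  unfolding dense_in_def
proof (intro conjI ballI allI impI)
  show "(\<Union>k. V k) \<subseteq> hcarrier XI" using V_carrier by blast
  fix x and \<epsilon> :: real assume x: "x \<in> hcarrier XI" and e: "\<epsilon> > 0"
  have "x \<in> hcarrier (completion XP)" using x by (simp add: X_inf_def)
  from X.completion_approx[OF this, of "\<epsilon> / 3"] e
  obtain y where y: "y \<in> C_two" and xy: "hdist XI x (emb y) \<le> \<epsilon> / 3"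
    by (auto simp: X_inf_def X_pre_simps)
  have e3: "\<epsilon> / 3 > 0" using e by simp
  obtain k n where n: "n \<in> C_inf" and d: "\<And>d. cmod (y d - level k n d) \<le> \<epsilon> / 3"
    using level_dense[OF y e3] by blast
  have l: "level k n \<in> C_two" by (rule level_closed[OF n])
  have m: "(\<lambda>d. y d - level k n d) \<in> C_two"
    using X.minus_closed[of y "level k n"] y l by (simp add: X_pre_simps)
  have "hdist XI (emb y) (emb (level k n)) = hnorm XP (\<lambda>d. y d - level k n d)"
    using X.to_completion_minus[of y "level k n"] X.to_completion_norm[of "\<lambda>d. y d - level k n d"] y l m
    by (simp add: X_inf_def X_pre_simps)
  also have "\<dots> \<le> \<epsilon> / 3" using e by (intro X_pre_norm_le m d) auto
  finally have "hdist XI x (emb (level k n)) < \<epsilon>"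
    using XI.hdist_triangle[OF x emb_closed[OF y] emb_closed[OF l]] xy e by linarith
  then show "\<exists>y\<in>\<Union>k. V k. hdist XI x y < \<epsilon>"
    using V_I[OF n, of k] by blast
qed

lemma V_projective_mra: "projective_mra XI DI V"
  unfolding projective_mra_def
proof (intro conjI allI)
  show "complemented XI (V 0)"
    using V_complemented[of "hcarrier XI" 0] V_carrier XI.closed XI.hsubmod_self by auto
  show "V k = {x \<in> hcarrier XI. (DI ^^ k) x \<in> V 0}" for k by (rule V_preimage)
  show "complemented (hsubmod XI (V (Suc k))) (V k)" for k
    by (intro V_complemented V_carrier V_Suc V_add V_scale)
qed (rule V_dense)

text \<open><m, m>(c) is the average of |w(e)|^2 over the arcs e with s(e) = r(c), and the
  normalisation of the weights makes this 1.\<close>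

lemma filter_of_is_filter: "is_filter_elt (M_pow G 1) m"
  unfolding is_filter_elt_def
proof (intro conjI correspondence_M_pow_1)
  show "m \<in> hcarrier (M_pow G 1)" by (simp add: M_pow_def filter_of_closed)
  show "hip (M_pow G 1) m m = one_C (hbase (M_pow G 1))"
  proof
    fix c
    show "hip (M_pow G 1) m m c = one_C (hbase (M_pow G 1)) c"
    proof (cases "c \<in> paths")
      case True
      let ?v = "path_range G c"
      have "(\<Sum>e\<in>out_arcs G ?v. cnj (m (path_cons e c)) * m (path_cons e c))
          = (\<Sum>e\<in>out_arcs G ?v. of_real ((cmod (w e))\<^sup>2))"
        using path_cons_closed[OF True]
        by (intro sum.cong refl) (simp only: filter_of_eq path_cons_0 complex_norm_square mult.commute if_True)
      also have "\<dots> = of_nat (card (out_arcs G ?v))"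
        using normalized[OF path_range_verts[OF True]] by (simp flip: of_real_sum of_real_power)
      finally show ?thesis
        using True card_out_arcs[OF True] by (simp add: M_pow_def transfer_def one_C_def)
    qed (simp add: M_pow_def transfer_def one_C_def)
  qed
qed

theorem scaling_function_mra:
  "is_filter_elt (M_pow G 1) (filter_of G w) \<and>
    (\<exists>D. (\<forall>x\<in>C_of (E_two G). D (to_completion (X_pre G w) x) = to_completion (X_pre G w) (dilation_pre G w x)) \<and>
       linear_iso (X_inf G w) (X_inf G w) D \<and>
       scaling_function G (filter_of G w) (X_inf G w) D (to_completion (X_pre G w) (one_C (E_two G))) \<and>
       (\<exists>Q. hilbert_iso (M_inf G (filter_of G w)) (X_inf G w) Q \<and>
          projective_mra (X_inf G w) D
            (\<lambda>k. Q ` (iota G (filter_of G w) k ` hcarrier (M_pow G k)))))"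
proof (intro conjI exI[of _ DI] exI[of _ Re.extension] ballI)
  show "is_filter_elt (M_pow G 1) m" by (rule filter_of_is_filter)
  show "DI (emb x) = emb (dil x)" if "x \<in> C_two" for x by (rule DI_emb[OF that])
  show "linear_iso XI XI DI"
    using DI_iso unfolding hilbert_iso_def linear_iso_def twist_L_simps by blast
  show "scaling_function G m XI DI \<phi>"
    unfolding scaling_function_def
    by (intro conjI X_inf_hilbert X_inf_base DI_iso phi_closed phi_ip DI_phi)
  show "hilbert_iso (M_inf G m) XI Re.extension"
    using Re.extension_iso by (simp add: M_inf_def direct_limit_def X_inf_def)
  \<comment> \<open>Q sends \<iota>^k(n) to the class of \<open>level k n\<close>, so the images of
    the stages are exactly the spaces \<open>V k\<close>.\<close>
  have "Re.extension (iota G m k n) = emb (level k n)" if "n \<in> C_inf" for k n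
    using Re.extension_to_completion[OF alg_lim_class[OF that]] that
    by (simp add: iota_def limit_map_def realize_class)
  then have "(\<lambda>k. Re.extension ` (iota G m k ` hcarrier (M_pow G k))) = V"
    by (auto simp: V_def M_pow_def image_image fun_eq_iff)
  then show "projective_mra XI DI (\<lambda>k. Re.extension ` (iota G m k ` hcarrier (M_pow G k)))"
    using V_projective_mra by simp
qed

end

theorem proposition6p3:
  fixes G :: "('v, 'e) pre_digraph" and w :: "'e \<Rightarrow> complex"
  assumes finite_graph: "fin_digraph G"
    and no_sources: "\<forall>v\<in>verts G. in_arcs G v \<noteq> {}"
    and no_sinks: "\<forall>v\<in>verts G. out_arcs G v \<noteq> {}"
    and nonzero: "\<forall>e\<in>arcs G. w e \<noteq> 0"
    and normalized: "\<forall>v\<in>verts G. (\<Sum>e\<in>out_arcs G v. (cmod (w e))\<^sup>2) = real (card (out_arcs G v))"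
  shows "is_filter_elt (M_pow G 1) (filter_of G w) \<and>
    (\<exists>D. (\<forall>x\<in>C_of (E_two G). D (to_completion (X_pre G w) x) = to_completion (X_pre G w) (dilation_pre G w x)) \<and>
       linear_iso (X_inf G w) (X_inf G w) D \<and>
       scaling_function G (filter_of G w) (X_inf G w) D (to_completion (X_pre G w) (one_C (E_two G))) \<and>
       (\<exists>Q. hilbert_iso (M_inf G (filter_of G w)) (X_inf G w) Q \<and>
          projective_mra (X_inf G w) D
            (\<lambda>k. Q ` (iota G (filter_of G w) k ` hcarrier (M_pow G k)))))"
proof -
  interpret fin_digraph G by (rule finite_graph)
  interpret weighted_digraph G w
    using no_sinks nonzero normalized by unfold_locales auto
  show ?thesis by (rule scaling_function_mra)
qed

end
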